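(* For every fixed integer $K\ge 2$ there is a constant $C_K<\infty$ such that, for every $d,N\ge 1$ and every complex-valued function $f:C_K^N\to\mathbb{C}$ whose Fourier transform is supported on $\{\alpha: s(\alpha)\le d\}$, $$\left(\sum_{s(\alpha)\le d}|\widehat f(\alpha)|^{p_d}\right)^{1/p_d}\le C_K\, d^{4\gamma_K+5}\,\|f\|_\infty,\qquad p_d=\frac{2d}{d+1},$$ where $$\gamma_2=\frac12,\qquad \gamma_K=\frac{K\log(K-1)}{4(K-2)}\quad (K\ge 3).$$ Consequently, for $K\ge 3$ the displayed power is $4\gamma_K+5=5+\frac{K\log(K-1)}{K-2}$. The same bound holds for functions of canonical total degree at most $d$; that is, for every $d,N\ge1$ and every $f:C_K^N\to\mathbb{C}$ whose Fourier transform is supported on $\{\alpha:|\alpha|\le d\}$, $$\left(\sum_{|\alpha|\le d}|\widehat f(\alpha)|^{p_d}\right)^{1/p_d}\le C_K\, d^{4\gamma_K+5}\,\|f\|_\infty .$$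
   Context: For an integer $K\ge2$ let $\omega=e^{2\pi i/K}$ and $C_K=\{1,\omega,\dots,\omega^{K-1}\}$, with normalized counting measure (and product measure on $C_K^N$). For $\alpha\in\{0,\dots,K-1\}^N$ put $\chi_\alpha(x)=\prod_{j=1}^N x_j^{\alpha_j}$, let $s(\alpha)=\#\{j:\alpha_j\neq0\}$ (the interaction order) and $|\alpha|=\alpha_1+\dots+\alpha_N$ (the canonical total degree). Every $f:C_K^N\to\mathbb{C}$ is written $f=\sum_\alpha\widehat f(\alpha)\chi_\alpha$ with $\widehat f(\alpha)=\mathbb{E}_x f(x)\overline{\chi_\alpha(x)}$, $\alpha$ ranging over $\{0,\dots,K-1\}^N$. $\|f\|_\infty=\max_{x\in C_K^N}|f(x)|$; $\log$ is the natural logarithm. The constant $C_K$ depends only on $K$ (not on $d$, $N$, $f$). *)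

theory Defs
  imports "HOL-Analysis.Analysis"
begin

text \<open>
  The dimension \<open>N\<close> is a natural number quantified inside the theorem, below the constant.
  Points of $C_K^N$ and multi-indices in $\{0,\dots,K-1\}^N$ are therefore extensional
  functions on \<open>{..<N}\<close>, and a function on $C_K^N$ is a HOL function of which only the values
  on \<open>cyclic_cube K N\<close> are used.
\<close>

definition root_of_unity :: "nat \<Rightarrow> complex" where
  "root_of_unity K = exp (2 * of_real pi * \<i> / of_nat K)"

definition cyclic_set :: "nat \<Rightarrow> complex set" where
  "cyclic_set K = (\<lambda>k. root_of_unity K ^ k) ` {..<K}"

definition cyclic_cube :: "nat \<Rightarrow> nat \<Rightarrow> (nat \<Rightarrow> complex) set" where
  "cyclic_cube K N = PiE {..<N} (\<lambda>_. cyclic_set K)"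

definition multi_indices :: "nat \<Rightarrow> nat \<Rightarrow> (nat \<Rightarrow> nat) set" where
  "multi_indices K N = PiE {..<N} (\<lambda>_. {..<K})"

definition character :: "nat \<Rightarrow> (nat \<Rightarrow> nat) \<Rightarrow> (nat \<Rightarrow> complex) \<Rightarrow> complex" where
  "character N \<alpha> x = (\<Prod>j<N. x j ^ \<alpha> j)"

definition interaction_order :: "nat \<Rightarrow> (nat \<Rightarrow> nat) \<Rightarrow> nat" where
  "interaction_order N \<alpha> = card {j. j < N \<and> \<alpha> j \<noteq> 0}"

definition total_degree :: "nat \<Rightarrow> (nat \<Rightarrow> nat) \<Rightarrow> nat" where
  "total_degree N \<alpha> = (\<Sum>j<N. \<alpha> j)"

definition cube_expectation :: "nat \<Rightarrow> nat \<Rightarrow> ((nat \<Rightarrow> complex) \<Rightarrow> complex) \<Rightarrow> complex" where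
  "cube_expectation K N g = (\<Sum>x\<in>cyclic_cube K N. g x) / of_nat (card (cyclic_cube K N))"

definition fourier_coeff ::
  "nat \<Rightarrow> nat \<Rightarrow> ((nat \<Rightarrow> complex) \<Rightarrow> complex) \<Rightarrow> (nat \<Rightarrow> nat) \<Rightarrow> complex" where
  "fourier_coeff K N f \<alpha> = cube_expectation K N (\<lambda>x. f x * cnj (character N \<alpha> x))"

definition fourier_support ::
  "nat \<Rightarrow> nat \<Rightarrow> ((nat \<Rightarrow> complex) \<Rightarrow> complex) \<Rightarrow> (nat \<Rightarrow> nat) set" where
  "fourier_support K N f = {\<alpha> \<in> multi_indices K N. fourier_coeff K N f \<alpha> \<noteq> 0}"

definition cube_sup_norm :: "nat \<Rightarrow> nat \<Rightarrow> ((nat \<Rightarrow> complex) \<Rightarrow> complex) \<Rightarrow> real" where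
  "cube_sup_norm K N f = Max ((\<lambda>x. cmod (f x)) ` cyclic_cube K N)"

definition bh_exponent :: "nat \<Rightarrow> real" where
  "bh_exponent d = 2 * real d / (real d + 1)"

definition bh_gamma :: "nat \<Rightarrow> real" where
  "bh_gamma K = (if K = 2 then 1 / 2 else real K * ln (real K - 1) / (4 * (real K - 2)))"

end

theory Submission
  imports Defs
begin

text \<open>
  For a level \<open>k\<close>, one bounds the $\ell_{p_k}$ norms of the Fourier coefficients of all interaction
  orders up to \<open>k\<close> simultaneously, each order \<open>a\<close> with its own exponent $p_a$. To pass from \<open>k\<close> to
  almost \<open>2k\<close>, split the coordinates randomly into \<open>A\<close> and its complement. A multi-index of order
  just below \<open>2k\<close> then splits into two halves of order at most \<open>k\<close> and comparable size with high
  probability. Freezing the variables outside \<open>A\<close> leaves a function with the same sup norm and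
  degree, so the coefficients indexed by the first half satisfy the level-\<open>k\<close> bound;
  hypercontractivity from $L^{p_a}$ to $L^2$ in the frozen variables costs a bounded factor because
  $p_a - 1 = 1 - 2/(a+1)$ and the second half has order about \<open>a\<close>. A pointwise Young inequality
  (Blei's inequality) combines the two halves. No projection of \<open>f\<close> to a level is needed, so each
  doubling costs a constant factor, and the product of these factors is a power of \<open>d\<close>.

  The recursion starts at level 3. The parts of \<open>f\<close> of order 1, 2 and 3 have sup norm of order
  $d^3$ by Bernstein's inequality in the noise parameter, and then one may work with functions of
  degree 3, for which all constants are absolute.
\<close>

section \<open>Fourier analysis on the cyclic cube\<close>

text \<open>The obstacle is order 1. An index of order at least 4 can be split into two halves of
  order at least 2, an index of order 2 or 3 cannot; hence level 3 is the base, and it is treated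
  for functions of degree 3.

  The final exponent is 3 from this reduction plus 4 gamma_K + 2 from the doublings. With A =
  \<open>bonami_const K\<close>, extending the bound costs A^(2R) times a numerical factor, where R
  bounds the ratio of the two halves. Concentration of the random split makes R close to 1 only at
  large levels; there R = 21/20 and the whole cost is 2 A^(21/10). Smaller levels are climbed one at
  a time with wasteful constants: their number is fixed, so the loss depends on K alone. The
  constant gamma_K enters only when the logarithm of the doubling cost to base 39/20 is compared
  with 4 gamma_K + 2.\<close>

lemma root_of_unity_power:
  "root_of_unity K ^ k = cis (2 * pi * real k / real K)"
proof -
  have "root_of_unity K = cis (2 * pi / real K)"
    by (simp add: root_of_unity_def cis_conv_exp mult_ac)
  then show ?thesis by (simp only: Complex.DeMoivre) (simp add: mult_ac)
qed

lemma cyclic_set_eq_roots: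
  assumes "K > 0"
  shows "cyclic_set K = {z. z ^ K = 1}"
  using Complex.bij_betw_roots_unity[OF assms]
  by (auto simp: cyclic_set_def root_of_unity_power bij_betw_def)

lemma finite_cyclic_set [simp]: "finite (cyclic_set K)"
  by (simp add: cyclic_set_def)

lemma card_cyclic_set:
  assumes "K > 0"
  shows "card (cyclic_set K) = K"
  using card_roots_unity_eq[OF assms] assms by (simp add: cyclic_set_eq_roots)

lemma norm_cyclic_set:
  assumes "z \<in> cyclic_set K"
  shows "cmod z = 1"
  using assms by (auto simp: cyclic_set_def root_of_unity_power)

lemma cnj_mult_cyclic_set:
  assumes "z \<in> cyclic_set K"
  shows "z * cnj z = 1"
  using norm_cyclic_set[OF assms] by (metis complex_norm_square of_real_1 power_one)

lemma root_of_unity_power_inj: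
  assumes "a < K" "b < K" "root_of_unity K ^ a = root_of_unity K ^ b"
  shows "a = b"
  using Complex.bij_betw_roots_unity[of K] assms
  by (auto simp: root_of_unity_power bij_betw_def inj_on_def)

lemma root_of_unity_in_cyclic_set:
  assumes "K > 0"
  shows "root_of_unity K \<in> cyclic_set K"
  using assms by (simp add: cyclic_set_eq_roots root_of_unity_power)

lemma sum_cyclic_set_rotate:
  assumes "K > 0"
  shows "(\<Sum>z\<in>cyclic_set K. g (root_of_unity K * z)) = (\<Sum>z\<in>cyclic_set K. g z)"
proof (rule sum.reindex_bij_witness)
  let ?w = "root_of_unity K"
  have w: "?w ^ K = 1" using root_of_unity_in_cyclic_set[OF assms] assms
    by (simp add: cyclic_set_eq_roots)
  then have nz: "?w \<noteq> 0" using assms by (auto simp: power_0_left)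
  show "?w * z \<in> cyclic_set K" if "z \<in> cyclic_set K" for z
    using that w assms by (simp add: cyclic_set_eq_roots power_mult_distrib)
  show "z / ?w \<in> cyclic_set K" if "z \<in> cyclic_set K" for z
    using that w assms by (simp add: cyclic_set_eq_roots power_divide)
  show "?w * (z / ?w) = z" for z using nz by simp
  show "?w * z / ?w = z" for z using nz by simp
qed auto

text \<open>Rotating the summation variable by \<open>root_of_unity K\<close> multiplies the sum by
  a factor that differs from 1 for distinct exponents below K, so the sum vanishes.\<close>

lemma cyclic_set_power_orthogonal:
  assumes "a < K" "b < K"
  shows "(\<Sum>z\<in>cyclic_set K. z ^ a * cnj z ^ b) = (if a = b then of_nat K else 0)"
proof (cases "a = b")
  case True
  have "z ^ b * cnj z ^ b = 1" if "z \<in> cyclic_set K" for z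
    using cnj_mult_cyclic_set[OF that] by (metis power_mult_distrib power_one)
  then show ?thesis using True assms by (simp add: card_cyclic_set)
next
  case False
  have K: "K > 0" using assms by simp
  let ?w = "root_of_unity K"
  let ?S = "\<Sum>z\<in>cyclic_set K. z ^ a * cnj z ^ b"
  have "?S = (\<Sum>z\<in>cyclic_set K. (?w * z) ^ a * cnj (?w * z) ^ b)"
    by (rule sum_cyclic_set_rotate[OF K, symmetric])
  also have "\<dots> = ?w ^ a * cnj ?w ^ b * ?S"
    by (simp add: power_mult_distrib sum_distrib_left mult_ac)
  finally have *: "?S = ?w ^ a * cnj ?w ^ b * ?S" .
  have "?w ^ a * cnj ?w ^ b \<noteq> 1"
  proof
    assume "?w ^ a * cnj ?w ^ b = 1"
    then have "?w ^ a * (cnj ?w ^ b * ?w ^ b) = ?w ^ b" by (metis mult.assoc mult_1)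
    moreover have "cnj ?w ^ b * ?w ^ b = 1"
      using cnj_mult_cyclic_set[OF root_of_unity_in_cyclic_set[OF K]]
      by (metis power_mult_distrib power_one mult.commute)
    ultimately show False using root_of_unity_power_inj[OF assms] False by simp
  qed
  moreover have "s = 0" if "s = c * s" "c \<noteq> 1" for c s :: complex
    using that by (metis mult_cancel_right2)
  ultimately have "?S = 0" using * by blast
  then show ?thesis using False by simp
qed

text \<open>A geometric sum in \<open>z * cnj w\<close>, a K-th root of unity that equals 1 only for
  z = w. It is the one-variable completeness relation behind Fourier inversion.\<close>

lemma sum_powers_cyclic_set:
  assumes "z \<in> cyclic_set K" "w \<in> cyclic_set K" "K > 0"
  shows "(\<Sum>a<K. z ^ a * cnj w ^ a) = (if z = w then of_nat K else 0)"
proof -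
  have w: "w * cnj w = 1" by (rule cnj_mult_cyclic_set[OF assms(2)])
  have zw: "z * cnj w = 1 \<longleftrightarrow> z = w"
    using w by (metis mult.commute mult.left_commute mult.right_neutral)
  have "(z * cnj w) ^ K = 1"
    using assms by (simp add: cyclic_set_eq_roots power_mult_distrib flip: complex_cnj_power)
  then show ?thesis
    using zw assms by (simp add: power_mult_distrib[symmetric] sum_gp_strict)
qed

section \<open>Characters of the product group and their two orthogonality relations\<close>

lemma finite_cyclic_cube [simp]: "finite (cyclic_cube K N)"
  by (simp add: cyclic_cube_def finite_PiE)

lemma finite_multi_indices [simp]: "finite (multi_indices K N)"
  by (simp add: multi_indices_def finite_PiE)

lemma card_cyclic_cube: "K > 0 \<Longrightarrow> card (cyclic_cube K N) = K ^ N"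
  by (simp add: cyclic_cube_def card_PiE card_cyclic_set)

lemma cyclic_cube_mem: "x \<in> cyclic_cube K N \<Longrightarrow> j < N \<Longrightarrow> x j \<in> cyclic_set K"
  by (auto simp: cyclic_cube_def)

lemma multi_indices_mem: "\<alpha> \<in> multi_indices K N \<Longrightarrow> j < N \<Longrightarrow> \<alpha> j < K"
  by (auto simp: multi_indices_def)

lemma norm_character:
  assumes "x \<in> cyclic_cube K N"
  shows "cmod (character N \<alpha> x) = 1"
proof -
  have "(\<Prod>j<N. cmod (x j) ^ \<alpha> j) = 1"
    by (intro prod.neutral) (use assms in \<open>auto simp: norm_cyclic_set[OF cyclic_cube_mem]\<close>)
  then show ?thesis by (simp add: character_def norm_power flip: prod_norm)
qed

lemma cyclic_cube_sum_prod:
  "(\<Sum>x\<in>cyclic_cube K N. \<Prod>j<N. g j (x j)) = (\<Prod>j<N. \<Sum>z\<in>cyclic_set K. g j z :: 'a :: comm_semiring_1)"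
  unfolding cyclic_cube_def by (rule prod_sum_PiE[symmetric]) auto

lemma multi_indices_sum_prod:
  "(\<Sum>\<alpha>\<in>multi_indices K N. \<Prod>j<N. g j (\<alpha> j)) = (\<Prod>j<N. \<Sum>a<K. g j a :: 'a :: comm_semiring_1)"
  unfolding multi_indices_def by (rule prod_sum_PiE[symmetric]) auto

lemma character_orthogonal:
  assumes "\<alpha> \<in> multi_indices K N" "\<beta> \<in> multi_indices K N"
  shows "(\<Sum>x\<in>cyclic_cube K N. character N \<alpha> x * cnj (character N \<beta> x))
    = (if \<alpha> = \<beta> then of_nat K ^ N else 0)"
proof -
  have "(\<Sum>x\<in>cyclic_cube K N. character N \<alpha> x * cnj (character N \<beta> x))
    = (\<Sum>x\<in>cyclic_cube K N. \<Prod>j<N. x j ^ \<alpha> j * cnj (x j) ^ \<beta> j)"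
    by (simp add: character_def prod.distrib)
  also have "\<dots> = (\<Prod>j<N. \<Sum>z\<in>cyclic_set K. z ^ \<alpha> j * cnj z ^ \<beta> j)"
    by (rule cyclic_cube_sum_prod)
  also have "\<dots> = (\<Prod>j<N. if \<alpha> j = \<beta> j then of_nat K else 0)"
    by (intro prod.cong refl cyclic_set_power_orthogonal) (use assms in \<open>auto simp: multi_indices_mem\<close>)
  also have "\<dots> = (if \<alpha> = \<beta> then of_nat K ^ N else 0)"
  proof (cases "\<alpha> = \<beta>")
    case False
    then obtain j where "j < N" "\<alpha> j \<noteq> \<beta> j"
      using assms unfolding multi_indices_def by (metis PiE_ext lessThan_iff)
    then show ?thesis using False by (auto intro!: prod_zero)
  qed simp
  finally show ?thesis .
qed

lemma character_complete:
  assumes "x \<in> cyclic_cube K N" "y \<in> cyclic_cube K N" "K > 0"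
  shows "(\<Sum>\<alpha>\<in>multi_indices K N. character N \<alpha> x * cnj (character N \<alpha> y))
    = (if x = y then of_nat K ^ N else 0)"
proof -
  have "(\<Sum>\<alpha>\<in>multi_indices K N. character N \<alpha> x * cnj (character N \<alpha> y))
    = (\<Sum>\<alpha>\<in>multi_indices K N. \<Prod>j<N. x j ^ \<alpha> j * cnj (y j) ^ \<alpha> j)"
    by (simp add: character_def prod.distrib)
  also have "\<dots> = (\<Prod>j<N. \<Sum>a<K. x j ^ a * cnj (y j) ^ a)"
    by (rule multi_indices_sum_prod)
  also have "\<dots> = (\<Prod>j<N. if x j = y j then of_nat K else 0)"
    by (intro prod.cong refl sum_powers_cyclic_set) (use assms in \<open>auto simp: cyclic_cube_mem\<close>)
  also have "\<dots> = (if x = y then of_nat K ^ N else 0)"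
  proof (cases "x = y")
    case False
    then obtain j where "j < N" "x j \<noteq> y j"
      using assms unfolding cyclic_cube_def by (metis PiE_ext lessThan_iff)
    then show ?thesis using False by (auto intro!: prod_zero)
  qed simp
  finally show ?thesis .
qed

text \<open>The argument manipulates coefficient families instead of functions: restriction, noise
  and selection of a level are all operations on \<open>c\<close>, and this definition returns to
  the values.\<close>

definition trig_poly :: "nat \<Rightarrow> nat \<Rightarrow> ((nat \<Rightarrow> nat) \<Rightarrow> complex) \<Rightarrow> (nat \<Rightarrow> complex) \<Rightarrow> complex" where
  "trig_poly K N c x = (\<Sum>\<alpha>\<in>multi_indices K N. c \<alpha> * character N \<alpha> x)"

lemma trig_poly_fourier_coeff:
  assumes "x \<in> cyclic_cube K N" "K > 0"
  shows "trig_poly K N (fourier_coeff K N f) x = f x"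
proof -
  have "trig_poly K N (fourier_coeff K N f) x
    = (\<Sum>\<alpha>\<in>multi_indices K N. (\<Sum>y\<in>cyclic_cube K N. f y * cnj (character N \<alpha> y)) / of_nat (K ^ N) * character N \<alpha> x)"
    using assms by (simp add: trig_poly_def fourier_coeff_def cube_expectation_def card_cyclic_cube)
  also have "\<dots> = (\<Sum>\<alpha>\<in>multi_indices K N. \<Sum>y\<in>cyclic_cube K N. f y / of_nat (K ^ N) * (character N \<alpha> x * cnj (character N \<alpha> y)))"
    unfolding sum_divide_distrib sum_distrib_right by (intro sum.cong refl) simp
  also have "\<dots> = (\<Sum>y\<in>cyclic_cube K N. f y / of_nat (K ^ N) * (\<Sum>\<alpha>\<in>multi_indices K N. character N \<alpha> x * cnj (character N \<alpha> y)))"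
    unfolding sum_distrib_left by (rule sum.swap)
  also have "\<dots> = (\<Sum>y\<in>cyclic_cube K N. if x = y then f y else 0)"
    by (intro sum.cong refl) (use assms in \<open>simp add: character_complete\<close>)
  also have "\<dots> = f x" using assms by simp
  finally show ?thesis .
qed

lemma trig_poly_orthogonal:
  assumes "\<beta> \<in> multi_indices K N"
  shows "(\<Sum>x\<in>cyclic_cube K N. trig_poly K N c x * cnj (character N \<beta> x)) = of_nat K ^ N * c \<beta>"
proof -
  have "(\<Sum>x\<in>cyclic_cube K N. trig_poly K N c x * cnj (character N \<beta> x))
    = (\<Sum>\<alpha>\<in>multi_indices K N. c \<alpha> * (\<Sum>x\<in>cyclic_cube K N. character N \<alpha> x * cnj (character N \<beta> x)))"
    by (simp add: trig_poly_def sum_distrib_right sum_distrib_left mult_ac) (rule sum.swap)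
  also have "\<dots> = (\<Sum>\<alpha>\<in>multi_indices K N. if \<alpha> = \<beta> then of_nat K ^ N * c \<alpha> else 0)"
    by (intro sum.cong refl) (use assms in \<open>simp add: character_orthogonal\<close>)
  also have "\<dots> = of_nat K ^ N * c \<beta>" using assms by simp
  finally show ?thesis .
qed

lemma trig_poly_inner:
  "(\<Sum>x\<in>cyclic_cube K N. trig_poly K N c x * cnj (trig_poly K N e x))
    = of_nat K ^ N * (\<Sum>\<beta>\<in>multi_indices K N. c \<beta> * cnj (e \<beta>))"
proof -
  have "(\<Sum>x\<in>cyclic_cube K N. trig_poly K N c x * cnj (trig_poly K N e x))
    = (\<Sum>x\<in>cyclic_cube K N. \<Sum>\<beta>\<in>multi_indices K N. cnj (e \<beta>) * (trig_poly K N c x * cnj (character N \<beta> x)))"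
    by (simp add: trig_poly_def[of K N e] sum_distrib_left mult_ac)
  also have "\<dots> = (\<Sum>\<beta>\<in>multi_indices K N. cnj (e \<beta>) * (\<Sum>x\<in>cyclic_cube K N. trig_poly K N c x * cnj (character N \<beta> x)))"
    unfolding sum_distrib_left by (rule sum.swap)
  also have "\<dots> = of_nat K ^ N * (\<Sum>\<beta>\<in>multi_indices K N. c \<beta> * cnj (e \<beta>))"
    unfolding sum_distrib_left[of "of_nat K ^ N"]
    by (intro sum.cong refl) (simp add: trig_poly_orthogonal)
  finally show ?thesis .
qed

section \<open>Normalized averages and Parseval's identity\<close>

definition cube_avg :: "nat \<Rightarrow> nat \<Rightarrow> ((nat \<Rightarrow> complex) \<Rightarrow> real) \<Rightarrow> real" where
  "cube_avg K N g = (\<Sum>x\<in>cyclic_cube K N. g x) / real K ^ N"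

lemma cube_avg_mono:
  "(\<And>x. x \<in> cyclic_cube K N \<Longrightarrow> g x \<le> h x) \<Longrightarrow> cube_avg K N g \<le> cube_avg K N h"
  by (simp add: cube_avg_def divide_right_mono sum_mono)

lemma cube_avg_const: "K > 0 \<Longrightarrow> cube_avg K N (\<lambda>_. a) = a"
  by (simp add: cube_avg_def card_cyclic_cube)

lemma cube_avg_nonneg: "(\<And>x. x \<in> cyclic_cube K N \<Longrightarrow> 0 \<le> g x) \<Longrightarrow> 0 \<le> cube_avg K N g"
  by (simp add: cube_avg_def sum_nonneg)

lemma cube_avg_add: "cube_avg K N (\<lambda>x. g x + h x) = cube_avg K N g + cube_avg K N h"
  by (simp add: cube_avg_def sum.distrib add_divide_distrib)

lemma cube_avg_cmult: "cube_avg K N (\<lambda>x. a * g x) = a * cube_avg K N g"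
  by (simp add: cube_avg_def sum_distrib_left)

lemma cube_avg_sum: "cube_avg K N (\<lambda>x. \<Sum>i\<in>I. g i x) = (\<Sum>i\<in>I. cube_avg K N (g i))"
  unfolding cube_avg_def by (subst sum.swap) (simp add: sum_divide_distrib)

lemma parseval:
  assumes "K > 0"
  shows "cube_avg K N (\<lambda>x. cmod (trig_poly K N c x) ^ 2) = (\<Sum>\<alpha>\<in>multi_indices K N. cmod (c \<alpha>) ^ 2)"
proof -
  have "complex_of_real (\<Sum>x\<in>cyclic_cube K N. cmod (trig_poly K N c x) ^ 2)
     = complex_of_real (real K ^ N * (\<Sum>\<alpha>\<in>multi_indices K N. cmod (c \<alpha>) ^ 2))"
    using trig_poly_inner[of K N c c] unfolding complex_norm_square[symmetric] by simp
  then have "(\<Sum>x\<in>cyclic_cube K N. cmod (trig_poly K N c x) ^ 2)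
     = real K ^ N * (\<Sum>\<alpha>\<in>multi_indices K N. cmod (c \<alpha>) ^ 2)"
    by (simp only: of_real_eq_iff)
  then show ?thesis using assms by (simp add: cube_avg_def)
qed

section \<open>Hypercontractivity\<close>

text \<open>Concavity of ln, used as the tangent line at the weighted mean m. Three factors serve
  both Hoelder's inequality on the cube and the pointwise Blei inequality.\<close>

lemma weighted_arith_geo_mean3:
  fixes x y z a b c :: real
  assumes "0 < x" "0 < y" "0 < z" "0 \<le> a" "0 \<le> b" "0 \<le> c" "a + b + c = 1"
  shows "x powr a * y powr b * z powr c \<le> a * x + b * y + c * z"
proof -
  define m where "m = a * x + b * y + c * z"
  have "m > 0"
  proof -
    have "a > 0 \<or> b > 0 \<or> c > 0" using assms by linarith
    moreover have "0 \<le> a * x" "0 \<le> b * y" "0 \<le> c * z" using assms by auto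
    moreover have "a > 0 \<Longrightarrow> 0 < a * x" "b > 0 \<Longrightarrow> 0 < b * y" "c > 0 \<Longrightarrow> 0 < c * z"
      using assms by auto
    ultimately show ?thesis unfolding m_def by linarith
  qed
  have le: "ln t \<le> ln m + (t / m - 1)" if "t > 0" for t
    using ln_le_minus_one[of "t / m"] that \<open>m > 0\<close> by (simp add: ln_div)
  have "a * ln x + b * ln y + c * ln z
      \<le> a * (ln m + (x / m - 1)) + b * (ln m + (y / m - 1)) + c * (ln m + (z / m - 1))"
    using assms by (intro add_mono mult_left_mono le) auto
  also have "\<dots> = (a + b + c) * ln m + (a * x + b * y + c * z) / m - (a + b + c)"
    by (simp add: algebra_simps add_divide_distrib)
  also have "\<dots> = ln m" using assms \<open>m > 0\<close> by (simp add: m_def[symmetric])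
  finally have "exp (a * ln x + b * ln y + c * ln z) \<le> m" using \<open>m > 0\<close> by (simp add: ln_ge_iff)
  then show ?thesis using assms by (simp add: powr_def exp_add m_def)
qed

text \<open>The reciprocal of a noise parameter r that contracts from L^2 to L^4. The one-variable
  estimate needs 4 r^2 <= 1 and 3 (K - 1) r^4 <= 1; the two entries of the maximum are these two
  conditions.\<close>

definition bonami_const :: "nat \<Rightarrow> real" where
  "bonami_const K = max 2 ((3 * (real K - 1)) powr (1/4))"

lemma bonami_const_ge: "bonami_const K \<ge> 2"
  by (simp add: bonami_const_def)

lemma bonami_const_pow4:
  assumes "K \<ge> 2"
  shows "3 * (real K - 1) \<le> bonami_const K ^ 4"
proof -
  have "3 * (real K - 1) = ((3 * (real K - 1)) powr (1/4)) ^ 4"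
    using assms by (simp add: powr_realpow[symmetric] powr_powr)
  also have "\<dots> \<le> bonami_const K ^ 4"
    by (intro power_mono) (auto simp: bonami_const_def)
  finally show ?thesis .
qed

text \<open>Expand the square of |u + r w|^2. The term linear in w is kept exactly because it
  averages to zero when w has mean zero; the cubic term is distributed to its neighbours by 2 U (r
  W) <= U^2 + (r W)^2, which produces the coefficients 8 and 3.\<close>

lemma norm_sum_power4_le:
  fixes u w :: complex and r :: real
  assumes "0 \<le> r"
  shows "cmod (u + of_real r * w) ^ 4 \<le> cmod u ^ 4 + 4 * r * (cmod u)\<^sup>2 * Re (cnj u * w)
    + 8 * r\<^sup>2 * (cmod u)\<^sup>2 * (cmod w)\<^sup>2 + 3 * r ^ 4 * cmod w ^ 4"
proof -
  define U W X where "U = cmod u" and "W = cmod w" and "X = Re (cnj u * w)"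
  have X: "\<bar>X\<bar> \<le> U * W"
    unfolding X_def U_def W_def by (metis abs_Re_le_cmod complex_mod_cnj norm_mult)
  have nn: "0 \<le> U" "0 \<le> W" by (auto simp: U_def W_def)
  have sq: "(cmod (u + of_real r * w))\<^sup>2 = U\<^sup>2 + 2 * r * X + r\<^sup>2 * W\<^sup>2"
    unfolding U_def W_def X_def cmod_power2 by (simp add: power2_eq_square algebra_simps)
  have "cmod (u + of_real r * w) ^ 4 = (U\<^sup>2 + 2 * r * X + r\<^sup>2 * W\<^sup>2)\<^sup>2"
    unfolding sq[symmetric] by simp
  also have "\<dots> = U ^ 4 + 4 * r * U\<^sup>2 * X + 2 * r\<^sup>2 * U\<^sup>2 * W\<^sup>2 + r ^ 4 * W ^ 4
      + 4 * r\<^sup>2 * X\<^sup>2 + 4 * r ^ 3 * X * W\<^sup>2"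
    by (simp add: power2_eq_square power4_eq_xxxx power3_eq_cube algebra_simps)
  also have "\<dots> \<le> U ^ 4 + 4 * r * U\<^sup>2 * X + 2 * r\<^sup>2 * U\<^sup>2 * W\<^sup>2 + r ^ 4 * W ^ 4
      + 4 * r\<^sup>2 * (U\<^sup>2 * W\<^sup>2) + (2 * r\<^sup>2 * U\<^sup>2 * W\<^sup>2 + 2 * r ^ 4 * W ^ 4)"
  proof -
    have "X\<^sup>2 \<le> U\<^sup>2 * W\<^sup>2"
      using X by (metis abs_ge_zero power2_abs power_mono power_mult_distrib)
    then have 1: "4 * r\<^sup>2 * X\<^sup>2 \<le> 4 * r\<^sup>2 * (U\<^sup>2 * W\<^sup>2)" by (intro mult_left_mono) auto
    have "4 * r ^ 3 * X * W\<^sup>2 \<le> 4 * r ^ 3 * (U * W) * W\<^sup>2"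
      using X assms by (intro mult_right_mono mult_left_mono) auto
    also have "\<dots> = 2 * r\<^sup>2 * W\<^sup>2 * (2 * U * (r * W))"
      by (simp add: power2_eq_square power3_eq_cube)
    also have "\<dots> \<le> 2 * r\<^sup>2 * W\<^sup>2 * (U\<^sup>2 + (r * W)\<^sup>2)"
      using sum_squares_bound[of U "r * W"] by (intro mult_left_mono) auto
    also have "\<dots> = 2 * r\<^sup>2 * U\<^sup>2 * W\<^sup>2 + 2 * r ^ 4 * W ^ 4"
      by (simp add: power2_eq_square power4_eq_xxxx algebra_simps)
    finally show ?thesis using 1 by linarith
  qed
  also have "\<dots> = U ^ 4 + 4 * r * U\<^sup>2 * X + 8 * r\<^sup>2 * U\<^sup>2 * W\<^sup>2 + 3 * r ^ 4 * W ^ 4"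
    by (simp add: algebra_simps)
  finally show ?thesis by (simp add: U_def W_def X_def)
qed

text \<open>Write the function as its mean u plus r w. Here w has mean zero, mean square S and, by
  Cauchy-Schwarz, |w|^2 at most (K - 1) S. The linear term drops out, and the conditions on r reduce
  the rest to the perfect square (|u|^2 + S)^2.\<close>

lemma bonami_one_variable:
  fixes g :: "nat \<Rightarrow> complex"
  assumes K: "K \<ge> 2" and r: "0 \<le> r" "r * bonami_const K \<le> 1"
  shows "(\<Sum>z\<in>cyclic_set K. cmod (\<Sum>a<K. (if a = 0 then 1 else of_real r) * g a * z ^ a) ^ 4)
     \<le> real K * (\<Sum>a<K. (cmod (g a))\<^sup>2)\<^sup>2"
proof -
  define w where "w z = (\<Sum>a\<in>{1..<K}. g a * z ^ a)" for z
  define u where "u = g 0"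
  define S where "S = (\<Sum>a\<in>{1..<K}. (cmod (g a))\<^sup>2)"
  have split: "{..<K} = insert 0 {1..<K}" using K by auto
  have eq: "(\<Sum>a<K. (if a = 0 then 1 else of_real r) * g a * z ^ a) = u + of_real r * w z" for z
    unfolding split w_def u_def by (simp add: sum_distrib_left mult_ac)
  have mean: "(\<Sum>z\<in>cyclic_set K. w z) = 0"
  proof -
    have "(\<Sum>z\<in>cyclic_set K. w z) = (\<Sum>a\<in>{1..<K}. g a * (\<Sum>z\<in>cyclic_set K. z ^ a * cnj z ^ 0))"
      unfolding w_def sum_distrib_left by (subst sum.swap) simp
    also have "\<dots> = 0"
      by (intro sum.neutral ballI) (use K in \<open>subst cyclic_set_power_orthogonal, auto\<close>)
    finally show ?thesis .
  qed
  have S0: "S \<ge> 0" unfolding S_def by (intro sum_nonneg) auto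
  have var: "(\<Sum>z\<in>cyclic_set K. (cmod (w z))\<^sup>2) = real K * S"
  proof -
    have "complex_of_real (\<Sum>z\<in>cyclic_set K. (cmod (w z))\<^sup>2)
       = (\<Sum>z\<in>cyclic_set K. \<Sum>a\<in>{1..<K}. \<Sum>b\<in>{1..<K}. g a * cnj (g b) * (z ^ a * cnj z ^ b))"
      unfolding w_def of_real_sum complex_norm_square cnj_sum sum_product
      by (intro sum.cong refl) (simp add: mult_ac)
    also have "\<dots> = (\<Sum>a\<in>{1..<K}. \<Sum>b\<in>{1..<K}. g a * cnj (g b) * (\<Sum>z\<in>cyclic_set K. z ^ a * cnj z ^ b))"
      unfolding sum_distrib_left
      by (subst sum.swap, intro sum.cong refl, subst sum.swap, rule refl)
    also have "\<dots> = (\<Sum>a\<in>{1..<K}. \<Sum>b\<in>{1..<K}. if a = b then of_nat K * (g a * cnj (g a)) else 0)"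
      by (intro sum.cong refl) (subst cyclic_set_power_orthogonal, auto)
    also have "\<dots> = of_nat K * (\<Sum>a\<in>{1..<K}. g a * cnj (g a))"
      by (simp add: sum_distrib_left)
    also have "\<dots> = complex_of_real (real K * S)"
      unfolding S_def of_real_mult of_real_sum complex_norm_square by simp
    finally show ?thesis by (simp only: of_real_eq_iff)
  qed
  have sup: "(cmod (w z))\<^sup>2 \<le> (real K - 1) * S" if z: "z \<in> cyclic_set K" for z
  proof -
    have "cmod (w z) \<le> (\<Sum>a\<in>{1..<K}. cmod (g a))"
      unfolding w_def using norm_cyclic_set[OF z]
      by (intro order_trans[OF norm_sum] sum_mono) (simp add: norm_mult norm_power)
    then have "(cmod (w z))\<^sup>2 \<le> (\<Sum>a\<in>{1..<K}. cmod (g a) * 1)\<^sup>2"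
      by (intro power_mono) auto
    also have "\<dots> \<le> (\<Sum>a\<in>{1..<K}. (cmod (g a))\<^sup>2) * (\<Sum>a\<in>{1..<K}. 1\<^sup>2)"
      by (rule Cauchy_Schwarz_ineq_sum)
    finally show ?thesis using K by (simp add: S_def mult.commute of_nat_diff)
  qed
  have r2: "4 * r\<^sup>2 \<le> 1"
  proof -
    have "r * 2 \<le> r * bonami_const K" using bonami_const_ge r by (intro mult_left_mono) auto
    then have "(r * 2)\<^sup>2 \<le> 1\<^sup>2" using r by (intro power_mono) auto
    then show ?thesis by (simp add: power_mult_distrib)
  qed
  have r4: "3 * r ^ 4 * (real K - 1) \<le> 1"
  proof -
    have "r ^ 4 * (3 * (real K - 1)) \<le> r ^ 4 * bonami_const K ^ 4"
      using bonami_const_pow4[OF K] by (intro mult_left_mono) auto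
    also have "\<dots> \<le> 1 ^ 4" unfolding power_mult_distrib[symmetric]
      using r bonami_const_ge[of K] by (intro power_mono) auto
    finally show ?thesis by (simp add: algebra_simps)
  qed
  have "(\<Sum>z\<in>cyclic_set K. cmod (u + of_real r * w z) ^ 4)
     \<le> (\<Sum>z\<in>cyclic_set K. cmod u ^ 4 + 4 * r * (cmod u)\<^sup>2 * Re (cnj u * w z)
    + 8 * r\<^sup>2 * (cmod u)\<^sup>2 * (cmod (w z))\<^sup>2 + 3 * r ^ 4 * ((real K - 1) * S) * (cmod (w z))\<^sup>2)"
  proof (intro sum_mono order_trans[OF norm_sum_power4_le[OF r(1)]] add_left_mono)
    fix z assume "z \<in> cyclic_set K"
    then have "(cmod (w z))\<^sup>2 * (cmod (w z))\<^sup>2 \<le> ((real K - 1) * S) * (cmod (w z))\<^sup>2"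
      by (intro mult_right_mono sup) auto
    then have "3 * r ^ 4 * ((cmod (w z))\<^sup>2 * (cmod (w z))\<^sup>2) \<le> 3 * r ^ 4 * (((real K - 1) * S) * (cmod (w z))\<^sup>2)"
      by (intro mult_left_mono) auto
    then show "3 * r ^ 4 * cmod (w z) ^ 4 \<le> 3 * r ^ 4 * ((real K - 1) * S) * (cmod (w z))\<^sup>2"
      by (simp add: power2_eq_square power4_eq_xxxx mult_ac)
  qed
  also have "\<dots> = real K * cmod u ^ 4 + 4 * r * (cmod u)\<^sup>2 * Re (cnj u * (\<Sum>z\<in>cyclic_set K. w z))
    + 8 * r\<^sup>2 * (cmod u)\<^sup>2 * (\<Sum>z\<in>cyclic_set K. (cmod (w z))\<^sup>2)
    + 3 * r ^ 4 * ((real K - 1) * S) * (\<Sum>z\<in>cyclic_set K. (cmod (w z))\<^sup>2)"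
    using K unfolding sum.distrib sum_distrib_left[symmetric] Re_sum[symmetric]
    by (simp add: card_cyclic_set)
  also have "\<dots> = real K * (cmod u ^ 4 + (4 * r\<^sup>2) * (2 * (cmod u)\<^sup>2 * S) + (3 * r ^ 4 * (real K - 1)) * S\<^sup>2)"
    unfolding mean var by (simp add: algebra_simps power2_eq_square)
  also have "\<dots> \<le> real K * (cmod u ^ 4 + 1 * (2 * (cmod u)\<^sup>2 * S) + 1 * S\<^sup>2)"
    using S0 by (intro mult_left_mono add_mono mult_right_mono r2 r4) auto
  also have "\<dots> = real K * ((cmod u)\<^sup>2 + S)\<^sup>2"
    by (simp add: power2_eq_square power4_eq_xxxx algebra_simps)
  also have "(cmod u)\<^sup>2 + S = (\<Sum>a<K. (cmod (g a))\<^sup>2)"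
    unfolding split S_def u_def by simp
  finally show ?thesis by (simp only: eq)
qed

section \<open>Tensorization over the coordinates\<close>

lemma sum_PiE_insert:
  assumes "i \<notin> I"
  shows "(\<Sum>x\<in>PiE (insert i I) (\<lambda>_. T). F x)
    = (\<Sum>x\<in>PiE I (\<lambda>_. T). \<Sum>z\<in>T. F (x(i := z)) :: 'a :: comm_monoid_add)"
proof -
  have "(\<Sum>x\<in>PiE (insert i I) (\<lambda>_. T). F x) = (\<Sum>(z, x)\<in>T \<times> PiE I (\<lambda>_. T). F (x(i := z)))"
    unfolding PiE_insert_eq
    by (subst sum.reindex[OF inj_combinator[OF assms]]) (simp add: split_def)
  also have "\<dots> = (\<Sum>z\<in>T. \<Sum>x\<in>PiE I (\<lambda>_. T). F (x(i := z)))"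
    by (rule sum.cartesian_product[symmetric])
  finally show ?thesis by (simp add: sum.swap[of _ T])
qed

lemma sum_cyclic_cube_Suc:
  "(\<Sum>x\<in>cyclic_cube K (Suc N). F x)
    = (\<Sum>x\<in>cyclic_cube K N. \<Sum>z\<in>cyclic_set K. F (x(N := z)) :: 'a :: comm_monoid_add)"
  unfolding cyclic_cube_def lessThan_Suc by (rule sum_PiE_insert) simp

lemma sum_multi_indices_Suc:
  "(\<Sum>\<alpha>\<in>multi_indices K (Suc N). F \<alpha>)
    = (\<Sum>\<alpha>\<in>multi_indices K N. \<Sum>a<K. F (\<alpha>(N := a)) :: 'a :: comm_monoid_add)"
  unfolding multi_indices_def lessThan_Suc[of N] by (rule sum_PiE_insert) simp

lemma character_upd: "character (Suc N) (\<alpha>(N := a)) (x(N := z)) = character N \<alpha> x * z ^ a"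
  by (simp add: character_def)

lemma interaction_order_upd:
  "interaction_order (Suc N) (\<alpha>(N := a)) = interaction_order N \<alpha> + (if a = 0 then 0 else 1)"
proof -
  have "{j. j < Suc N \<and> (\<alpha>(N := a)) j \<noteq> 0} = {j. j < N \<and> \<alpha> j \<noteq> 0} \<union> (if a = 0 then {} else {N})"
    by (auto simp: less_Suc_eq)
  then show ?thesis by (simp add: interaction_order_def)
qed

text \<open>Minkowski's inequality in L^2, written with squared norms: expand the square and apply
  Cauchy-Schwarz to each pair. In the tensor step \<open>f i\<close> is the squared modulus of the
  slice with last exponent i.\<close>

lemma sum_product_square_root_le:
  fixes f :: "'i \<Rightarrow> 'x \<Rightarrow> real"
  assumes "finite I" "\<And>i. i \<in> I \<Longrightarrow> (\<Sum>x\<in>X. (f i x)\<^sup>2) \<le> (b i)\<^sup>2" "\<And>i. i \<in> I \<Longrightarrow> 0 \<le> b i"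
  shows "(\<Sum>x\<in>X. (\<Sum>i\<in>I. f i x)\<^sup>2) \<le> (\<Sum>i\<in>I. b i)\<^sup>2"
proof -
  have "(\<Sum>x\<in>X. f i x * f j x) \<le> b i * b j" if "i \<in> I" "j \<in> I" for i j
  proof -
    have "(\<Sum>x\<in>X. f i x * f j x)\<^sup>2 \<le> (\<Sum>x\<in>X. (f i x)\<^sup>2) * (\<Sum>x\<in>X. (f j x)\<^sup>2)"
      by (rule Cauchy_Schwarz_ineq_sum)
    also have "\<dots> \<le> (b i)\<^sup>2 * (b j)\<^sup>2"
      using assms that by (intro mult_mono) (auto intro: sum_nonneg)
    finally have "(\<Sum>x\<in>X. f i x * f j x)\<^sup>2 \<le> (b i * b j)\<^sup>2" by (simp add: power_mult_distrib)
    then show ?thesis by (rule power2_le_imp_le) (use assms that in auto)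
  qed
  then have "(\<Sum>i\<in>I. \<Sum>j\<in>I. \<Sum>x\<in>X. f i x * f j x) \<le> (\<Sum>i\<in>I. \<Sum>j\<in>I. b i * b j)"
    by (intro sum_mono)
  moreover have "(\<Sum>x\<in>X. (\<Sum>i\<in>I. f i x)\<^sup>2) = (\<Sum>i\<in>I. \<Sum>j\<in>I. \<Sum>x\<in>X. f i x * f j x)"
    unfolding power2_eq_square sum_product
    by (subst sum.swap, intro sum.cong refl, subst sum.swap, rule refl)
  ultimately show ?thesis by (simp add: power2_eq_square sum_product)
qed

text \<open>Tensorization of the one-variable inequality, with Minkowski's inequality in $L^2$ for the
  squares of the slices.\<close>

lemma bonami_noise:
  assumes K: "K \<ge> 2" and r: "0 \<le> r" "r * bonami_const K \<le> 1"
  shows "(\<Sum>x\<in>cyclic_cube K N. cmod (\<Sum>\<alpha>\<in>multi_indices K N.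
      of_real r ^ interaction_order N \<alpha> * c \<alpha> * character N \<alpha> x) ^ 4)
    \<le> real K ^ N * (\<Sum>\<alpha>\<in>multi_indices K N. (cmod (c \<alpha>))\<^sup>2)\<^sup>2"
proof (induction N arbitrary: c)
  case 0
  show ?case
    by (simp add: cyclic_cube_def multi_indices_def character_def interaction_order_def)
next
  case (Suc N)
  define G where "G a x = (\<Sum>\<alpha>\<in>multi_indices K N.
      of_real r ^ interaction_order N \<alpha> * c (\<alpha>(N := a)) * character N \<alpha> x)" for a x
  define b where "b a = (\<Sum>\<alpha>\<in>multi_indices K N. (cmod (c (\<alpha>(N := a))))\<^sup>2)" for a
  have b0: "b a \<ge> 0" for a unfolding b_def by (intro sum_nonneg) auto
  have slice: "(\<Sum>\<alpha>\<in>multi_indices K (Suc N).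
      of_real r ^ interaction_order (Suc N) \<alpha> * c \<alpha> * character (Suc N) \<alpha> (x(N := z)))
    = (\<Sum>a<K. (if a = 0 then 1 else of_real r) * G a x * z ^ a)" for x z
    unfolding sum_multi_indices_Suc character_upd interaction_order_upd G_def
    by (subst sum.swap) (auto simp: sum_distrib_left sum_distrib_right power_add mult_ac intro!: sum.cong)
  have "(\<Sum>x\<in>cyclic_cube K (Suc N). cmod (\<Sum>\<alpha>\<in>multi_indices K (Suc N).
      of_real r ^ interaction_order (Suc N) \<alpha> * c \<alpha> * character (Suc N) \<alpha> x) ^ 4)
    = (\<Sum>x\<in>cyclic_cube K N. \<Sum>z\<in>cyclic_set K.
        cmod (\<Sum>a<K. (if a = 0 then 1 else of_real r) * G a x * z ^ a) ^ 4)"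
    by (simp only: sum_cyclic_cube_Suc slice)
  also have "\<dots> \<le> (\<Sum>x\<in>cyclic_cube K N. real K * (\<Sum>a<K. (cmod (G a x))\<^sup>2)\<^sup>2)"
    by (intro sum_mono bonami_one_variable K r)
  also have "\<dots> = real K * (\<Sum>x\<in>cyclic_cube K N. (\<Sum>a<K. (cmod (G a x))\<^sup>2)\<^sup>2)"
    by (simp add: sum_distrib_left)
  also have "\<dots> \<le> real K * (\<Sum>a<K. sqrt (real K ^ N) * b a)\<^sup>2"
  proof (intro mult_left_mono sum_product_square_root_le)
    fix a
    have "(\<Sum>x\<in>cyclic_cube K N. ((cmod (G a x))\<^sup>2)\<^sup>2) \<le> real K ^ N * (b a)\<^sup>2"
      using Suc.IH[of "\<lambda>\<alpha>. c (\<alpha>(N := a))"] by (simp add: G_def b_def)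
    then show "(\<Sum>x\<in>cyclic_cube K N. ((cmod (G a x))\<^sup>2)\<^sup>2) \<le> (sqrt (real K ^ N) * b a)\<^sup>2"
      by (simp add: power_mult_distrib)
    show "0 \<le> sqrt (real K ^ N) * b a" using b0 by simp
  qed auto
  also have "\<dots> = real K ^ Suc N * (\<Sum>a<K. b a)\<^sup>2"
    unfolding sum_distrib_left[symmetric] by (simp add: power_mult_distrib)
  also have "(\<Sum>a<K. b a) = (\<Sum>\<alpha>\<in>multi_indices K (Suc N). (cmod (c \<alpha>))\<^sup>2)"
    unfolding b_def sum_multi_indices_Suc by (rule sum.swap)
  finally show ?case .
qed

text \<open>The coefficients are first multiplied by A^s, with s the interaction order, so that
  noise with parameter 1/A gives back the given polynomial. On orders up to j this costs at most A^j
  per coefficient.\<close>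

lemma bonami:
  assumes K: "K \<ge> 2" and c: "\<And>\<alpha>. \<alpha> \<in> multi_indices K N \<Longrightarrow> c \<alpha> \<noteq> 0 \<Longrightarrow> interaction_order N \<alpha> \<le> j"
  shows "cube_avg K N (\<lambda>x. cmod (trig_poly K N c x) ^ 4)
    \<le> bonami_const K ^ (4 * j) * (\<Sum>\<alpha>\<in>multi_indices K N. (cmod (c \<alpha>))\<^sup>2)\<^sup>2"
proof -
  let ?A = "bonami_const K"
  have A: "?A \<ge> 2" by (rule bonami_const_ge)
  define e where "e \<alpha> = of_real (?A ^ interaction_order N \<alpha>) * c \<alpha>" for \<alpha>
  have "cube_avg K N (\<lambda>x. cmod (trig_poly K N c x) ^ 4)
     = (\<Sum>x\<in>cyclic_cube K N. cmod (\<Sum>\<alpha>\<in>multi_indices K N.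
      of_real (1 / ?A) ^ interaction_order N \<alpha> * e \<alpha> * character N \<alpha> x) ^ 4) / real K ^ N"
    using A by (simp add: cube_avg_def trig_poly_def e_def power_divide)
  also have "\<dots> \<le> (real K ^ N * (\<Sum>\<alpha>\<in>multi_indices K N. (cmod (e \<alpha>))\<^sup>2)\<^sup>2) / real K ^ N"
    using A by (intro divide_right_mono bonami_noise K) auto
  also have "\<dots> = (\<Sum>\<alpha>\<in>multi_indices K N. (cmod (e \<alpha>))\<^sup>2)\<^sup>2" using K by simp
  also have "\<dots> \<le> (\<Sum>\<alpha>\<in>multi_indices K N. (?A ^ j)\<^sup>2 * (cmod (c \<alpha>))\<^sup>2)\<^sup>2"
  proof (intro power_mono sum_mono sum_nonneg)
    fix \<alpha> assume \<alpha>: "\<alpha> \<in> multi_indices K N"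
    show "(cmod (e \<alpha>))\<^sup>2 \<le> (?A ^ j)\<^sup>2 * (cmod (c \<alpha>))\<^sup>2"
    proof (cases "c \<alpha> = 0")
      case False
      then have "?A ^ interaction_order N \<alpha> \<le> ?A ^ j"
        using c[OF \<alpha>] A by (intro power_increasing) auto
      then show ?thesis using A
        by (auto simp: e_def norm_mult norm_power power_mult_distrib intro!: mult_right_mono power_mono)
    qed (simp add: e_def)
  qed auto
  also have "\<dots> = ?A ^ (4 * j) * (\<Sum>\<alpha>\<in>multi_indices K N. (cmod (c \<alpha>))\<^sup>2)\<^sup>2"
    unfolding sum_distrib_left[symmetric] by (simp add: power_mult_distrib mult_ac flip: power_mult)
  finally show ?thesis .
qed

section \<open>Hoelder's inequality and the dual estimate\<close>

lemma power_powr: "0 < x \<Longrightarrow> (x ^ n) powr a = x powr (real n * a)" for x :: real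
  by (simp add: powr_powr flip: powr_realpow)

text \<open>The weighted mean inequality is applied to f/F, g/G and h/H. Positive upper bounds F, G,
  H take the place of the averages themselves, so that the division is always legitimate.\<close>

lemma cube_avg_holder3:
  assumes "\<And>x. x \<in> cyclic_cube K N \<Longrightarrow> 0 \<le> f x" "\<And>x. x \<in> cyclic_cube K N \<Longrightarrow> 0 \<le> g x"
    and "\<And>x. x \<in> cyclic_cube K N \<Longrightarrow> 0 \<le> h x"
    and "0 < F" "0 < G" "0 < H" "cube_avg K N f \<le> F" "cube_avg K N g \<le> G" "cube_avg K N h \<le> H"
    and "0 \<le> a" "0 \<le> b" "0 \<le> c" "a + b + c = 1"
  shows "cube_avg K N (\<lambda>x. f x powr a * g x powr b * h x powr c) \<le> F powr a * G powr b * H powr c"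
proof -
  let ?Z = "F powr a * G powr b * H powr c"
  have Z: "?Z > 0" using assms by simp
  have "f x powr a * g x powr b * h x powr c \<le> ?Z * (a / F * f x + b / G * g x + c / H * h x)"
    if x: "x \<in> cyclic_cube K N" for x
  \<comment> \<open>Since \<open>0 powr a\<close> is 0 for every exponent, including 0, the left
    side vanishes in this case; the logarithmic mean inequality covers positive values only.\<close>
  proof (cases "f x = 0 \<or> g x = 0 \<or> h x = 0")
    case True
    then show ?thesis using assms(1-3)[OF x] assms Z
      by (auto intro!: mult_nonneg_nonneg add_nonneg_nonneg)
  next
    case False
    then have pos: "f x > 0" "g x > 0" "h x > 0" using assms(1-3)[OF x] by auto
    have "f x powr a * g x powr b * h x powr c
        = ?Z * ((f x / F) powr a * (g x / G) powr b * (h x / H) powr c)"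
      using pos assms by (simp add: powr_divide)
    also have "\<dots> \<le> ?Z * (a * (f x / F) + b * (g x / G) + c * (h x / H))"
      using pos assms Z by (intro mult_left_mono weighted_arith_geo_mean3) auto
    finally show ?thesis by simp
  qed
  then have "cube_avg K N (\<lambda>x. f x powr a * g x powr b * h x powr c)
      \<le> cube_avg K N (\<lambda>x. ?Z * (a / F * f x + b / G * g x + c / H * h x))"
    by (intro cube_avg_mono)
  also have "\<dots> = ?Z * (a * (cube_avg K N f / F) + b * (cube_avg K N g / G) + c * (cube_avg K N h / H))"
    by (simp only: cube_avg_cmult cube_avg_add) simp
  also have "\<dots> \<le> ?Z * (a * 1 + b * 1 + c * 1)"
    using assms Z by (intro mult_left_mono add_mono) auto
  finally show ?thesis using assms by simp
qed

lemma bh_exponent_pos: "a \<ge> 1 \<Longrightarrow> bh_exponent a > 0"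
  by (simp add: bh_exponent_def)

lemma bh_exponent_ge_1: "a \<ge> 1 \<Longrightarrow> bh_exponent a \<ge> 1"
  by (simp add: bh_exponent_def divide_simps)

lemma bh_exponent_mono: "a \<le> b \<Longrightarrow> bh_exponent a \<le> bh_exponent b"
  by (simp add: bh_exponent_def divide_simps) (simp add: algebra_simps)

text \<open>Pairing the function with its own projection to S gives the squared L^2 norm of the
  projection. A lower bound for the function thus follows without any bound for the projection as an
  operator.\<close>

lemma projection_norm_le:
  assumes "K \<ge> 2" "S \<subseteq> multi_indices K N"
  shows "(\<Sum>V\<in>S. (cmod (e V))\<^sup>2) \<le> cube_avg K N (\<lambda>x. cmod (trig_poly K N e x)
    * cmod (trig_poly K N (\<lambda>V. if V \<in> S then e V else 0) x))"
proof -
  let ?g = "trig_poly K N (\<lambda>V. if V \<in> S then e V else 0)"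
  have "complex_of_real (real K ^ N * (\<Sum>V\<in>S. (cmod (e V))\<^sup>2))
      = of_nat K ^ N * (\<Sum>V\<in>multi_indices K N. if V \<in> S then e V * cnj (e V) else 0)"
    using assms(2) unfolding of_real_mult of_real_sum complex_norm_square
    by (simp add: sum.If_cases Int_absorb1)
  also have "(\<Sum>V\<in>multi_indices K N. if V \<in> S then e V * cnj (e V) else 0)
      = (\<Sum>V\<in>multi_indices K N. e V * cnj (if V \<in> S then e V else 0))"
    by (intro sum.cong) auto
  finally have "complex_of_real (real K ^ N * (\<Sum>V\<in>S. (cmod (e V))\<^sup>2))
      = (\<Sum>x\<in>cyclic_cube K N. trig_poly K N e x * cnj (?g x))"
    by (simp only: trig_poly_inner)
  then have "cmod (complex_of_real (real K ^ N * (\<Sum>V\<in>S. (cmod (e V))\<^sup>2)))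
      \<le> (\<Sum>x\<in>cyclic_cube K N. cmod (trig_poly K N e x) * cmod (?g x))"
    by (simp only:) (rule order_trans[OF norm_sum], simp add: norm_mult)
  then have "real K ^ N * (\<Sum>V\<in>S. (cmod (e V))\<^sup>2)
      \<le> (\<Sum>x\<in>cyclic_cube K N. cmod (trig_poly K N e x) * cmod (?g x))"
    by (simp only: norm_of_real abs_le_iff)
  then show ?thesis using assms(1) by (simp add: cube_avg_def field_simps)
qed

text \<open>Dual hypercontractivity from $L^{p_a}$ to $L^2$. Interpolating the fourth moment gives the
  constant $A^{2j/a}$ for $a \ge 2$; for $a = 1$ the dual exponent is infinite, and only functions
  without a high-order part are covered.\<close>

lemma bonami_dual:
  assumes K: "K \<ge> 2" and a: "a \<ge> 1" and S: "S \<subseteq> multi_indices K N"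
    and j: "\<And>V. V \<in> S \<Longrightarrow> interaction_order N V \<le> j"
    and low: "2 \<le> a \<or> (\<forall>V\<in>multi_indices K N - S. e V = 0)"
  shows "sqrt (\<Sum>V\<in>S. (cmod (e V))\<^sup>2) powr bh_exponent a
    \<le> (bonami_const K powr (2 * real j / real a)) powr bh_exponent a
       * cube_avg K N (\<lambda>x. cmod (trig_poly K N e x) powr bh_exponent a)"
proof -
  define A where "A = bonami_const K"
  have A: "A \<ge> 2" unfolding A_def by (rule bonami_const_ge)
  define p where "p = bh_exponent a"
  have p: "p > 0" using bh_exponent_pos[OF a] by (simp add: p_def)
  define f where "f = trig_poly K N e"
  define g where "g = trig_poly K N (\<lambda>V. if V \<in> S then e V else 0)"
  define \<sigma> where "\<sigma> = sqrt (\<Sum>V\<in>S. (cmod (e V))\<^sup>2)"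
  define H where "H = cube_avg K N (\<lambda>x. cmod (f x) powr p)"
  have sum0: "(\<Sum>V\<in>S. (cmod (e V))\<^sup>2) \<ge> 0" by (intro sum_nonneg) auto
  then have \<sigma>2: "\<sigma>\<^sup>2 = (\<Sum>V\<in>S. (cmod (e V))\<^sup>2)" by (simp add: \<sigma>_def)
  have sq: "(\<Sum>\<alpha>\<in>multi_indices K N. (cmod (if \<alpha> \<in> S then e \<alpha> else 0))\<^sup>2) = \<sigma>\<^sup>2"
    using S by (simp add: \<sigma>2 if_distrib[of cmod] if_distrib[of "\<lambda>x. x\<^sup>2"] sum.If_cases Int_absorb1 cong: if_cong)
  have g2: "cube_avg K N (\<lambda>x. (cmod (g x))\<^sup>2) = \<sigma>\<^sup>2"
    unfolding g_def using K by (subst parseval) (auto simp: sq)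
  have g4: "cube_avg K N (\<lambda>x. cmod (g x) ^ 4) \<le> A ^ (4 * j) * \<sigma> ^ 4"
  proof -
    have "cube_avg K N (\<lambda>x. cmod (g x) ^ 4) \<le> A ^ (4 * j) * (\<sigma>\<^sup>2)\<^sup>2"
      unfolding g_def A_def sq[symmetric] by (intro bonami K) (use j in \<open>auto split: if_splits\<close>)
    then show ?thesis by simp
  qed
  have fg: "\<sigma>\<^sup>2 \<le> cube_avg K N (\<lambda>x. cmod (f x) * cmod (g x))"
    unfolding \<sigma>2 f_def g_def by (rule projection_norm_le[OF K S])
  have H0: "H \<ge> 0" unfolding H_def by (intro cube_avg_nonneg) auto
  have "\<sigma> \<le> H powr (1 / p) * A powr (2 * real j / real a)" if \<sigma>: "\<sigma> > 0"
  proof -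
    have "H \<noteq> 0"
    proof
      assume "H = 0"
      then have "(\<Sum>x\<in>cyclic_cube K N. cmod (f x) powr p) = 0"
        using K by (simp add: H_def cube_avg_def)
      then have "\<forall>x\<in>cyclic_cube K N. f x = 0"
        by (subst (asm) sum_nonneg_eq_0_iff) auto
      then have "cube_avg K N (\<lambda>x. cmod (f x) * cmod (g x)) = 0"
        by (simp add: cube_avg_def)
      then show False using fg \<sigma> by simp
    qed
    with H0 have H: "H > 0" by simp
    define B where "B = A ^ (4 * j) * \<sigma> ^ 4"
    have B: "B > 0" using A \<sigma> by (simp add: B_def)
    show ?thesis
    proof (cases "2 \<le> a")
      case True
      \<comment> \<open>These solve 1/p + u + v = 1, as Hoelder's inequality demands, and 2 u + 4 v
        = 1, so that |g| appears to the first power. Nonnegativity of u is exactly the condition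
        that the order a is at least 2.\<close>
      define u v where "u = (real a - 2) / (2 * real a)" and "v = 1 / (2 * real a)"
      have uv: "0 \<le> u" "0 \<le> v" "1 / p + u + v = 1" "2 * u + 4 * v = 1"
        using True by (auto simp: u_def v_def p_def bh_exponent_def field_simps)
      have "cmod (f x) * cmod (g x)
          = (cmod (f x) powr p) powr (1 / p) * ((cmod (g x))\<^sup>2) powr u * (cmod (g x) ^ 4) powr v" for x
      proof (cases "g x = 0")
        case False
        have "((cmod (g x))\<^sup>2) powr u * (cmod (g x) ^ 4) powr v = cmod (g x) powr (2 * u + 4 * v)"
          using False by (simp add: power_powr powr_add)
        then show ?thesis using p uv by (simp add: powr_powr mult.assoc)
      qed simp
      then have "cube_avg K N (\<lambda>x. cmod (f x) * cmod (g x))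
         = cube_avg K N (\<lambda>x. (cmod (f x) powr p) powr (1 / p) * ((cmod (g x))\<^sup>2) powr u * (cmod (g x) ^ 4) powr v)"
        by simp
      also have "\<dots> \<le> H powr (1 / p) * (\<sigma>\<^sup>2) powr u * B powr v"
      proof (rule cube_avg_holder3)
        show "cube_avg K N (\<lambda>x. cmod (g x) ^ 4) \<le> B" using g4 by (simp add: B_def)
        show "cube_avg K N (\<lambda>x. (cmod (g x))\<^sup>2) \<le> \<sigma>\<^sup>2" by (simp add: g2)
        show "cube_avg K N (\<lambda>x. cmod (f x) powr p) \<le> H" by (simp add: H_def)
        show "0 \<le> 1 / p" using p by simp
        show "0 < \<sigma>\<^sup>2" using \<sigma> by simp
      qed (simp_all add: H B uv)
      also have "\<dots> = H powr (1 / p) * (\<sigma> powr (2 * u + 4 * v) * A powr (real (4 * j) * v))"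
        using \<sigma> A unfolding B_def by (simp add: powr_mult power_powr powr_add)
      also have "\<dots> = \<sigma> * (H powr (1 / p) * A powr (2 * real j / real a))"
        using uv \<sigma> by (simp add: v_def)
      finally have "\<sigma> * \<sigma> \<le> \<sigma> * (H powr (1 / p) * A powr (2 * real j / real a))"
        using fg by (simp add: power2_eq_square)
      then show ?thesis using \<sigma> by simp
    next
      case False
      then have a1: "a = 1" and full: "\<forall>V\<in>multi_indices K N - S. e V = 0" using a low by auto
      have p1: "p = 1" by (simp add: p_def a1 bh_exponent_def)
      have fg': "f = g" unfolding f_def g_def
        by (intro ext) (use full in \<open>auto simp: trig_poly_def intro!: sum.cong\<close>)
      \<comment> \<open>For a = 1 the function equals its projection, and its L^2 norm is
        interpolated between L^1 and L^4. The trivial third factor only fits the shape of the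
        three-factor inequality.\<close>
      have "cmod (f x) * cmod (g x) = cmod (f x) powr (2 / 3) * (cmod (g x) ^ 4) powr (1 / 3) * 1 powr 0" for x
      proof (cases "g x = 0")
        case False
        have "cmod (g x) powr (2 / 3) * (cmod (g x) ^ 4) powr (1 / 3) = cmod (g x) powr 2"
          using False by (simp add: power_powr flip: powr_add)
        then show ?thesis by (simp add: fg' power2_eq_square)
      qed simp
      then have "cube_avg K N (\<lambda>x. cmod (f x) * cmod (g x))
         = cube_avg K N (\<lambda>x. cmod (f x) powr (2 / 3) * (cmod (g x) ^ 4) powr (1 / 3) * 1 powr 0)"
        by simp
      also have "\<dots> \<le> H powr (2 / 3) * B powr (1 / 3) * 1 powr 0"
      proof (rule cube_avg_holder3)
        show "cube_avg K N (\<lambda>x. cmod (g x) ^ 4) \<le> B" using g4 by (simp add: B_def)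
        show "cube_avg K N (\<lambda>x. cmod (f x)) \<le> H" by (simp add: H_def p1)
        show "cube_avg K N (\<lambda>_. 1) \<le> 1" using K by (simp add: cube_avg_const)
      qed (simp_all add: H B)
      finally have "(\<sigma>\<^sup>2) ^ 3 \<le> (H powr (2 / 3) * B powr (1 / 3)) ^ 3"
        using fg by (intro power_mono) auto
      also have "\<dots> = H\<^sup>2 * B"
        using H B by (simp add: power_mult_distrib powr_power)
      also have "\<dots> = \<sigma> ^ 4 * (H * A ^ (2 * j))\<^sup>2"
      proof -
        have "A ^ (4 * j) = (A ^ (2 * j))\<^sup>2" by (simp flip: power_mult)
        then show ?thesis by (simp add: B_def power_mult_distrib)
      qed
      also have "(\<sigma>\<^sup>2) ^ 3 = \<sigma> ^ 4 * \<sigma>\<^sup>2" by (simp flip: power_mult power_add)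
      finally have "\<sigma> ^ 4 * \<sigma>\<^sup>2 \<le> \<sigma> ^ 4 * (H * A ^ (2 * j))\<^sup>2" .
      then have "\<sigma>\<^sup>2 \<le> (H * A ^ (2 * j))\<^sup>2"
        by (rule mult_left_le_imp_le) (use \<sigma> in simp)
      then have "\<sigma> \<le> H * A ^ (2 * j)" by (rule power2_le_imp_le) (use H A in auto)
      moreover have "A ^ (2 * j) = A powr (2 * real j)" using A powr_realpow[of A "2 * j"] by simp
      ultimately show ?thesis using H unfolding p1 a1 by (simp only: div_by_1 of_nat_1 powr_one)
    qed
  qed
  then have "\<sigma> powr p \<le> (A powr (2 * real j / real a)) powr p * H"
  proof (cases "\<sigma> = 0")
    case False
    then have "\<sigma> > 0" using sum0 by (simp add: \<sigma>_def order_less_le)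
    then have "\<sigma> powr p \<le> (H powr (1 / p) * A powr (2 * real j / real a)) powr p"
      using \<open>\<sigma> > 0 \<Longrightarrow> _\<close> p by (intro powr_mono2) auto
    also have "\<dots> = (A powr (2 * real j / real a)) powr p * H"
      using H0 p by (simp add: powr_mult powr_powr[of H])
    finally show ?thesis .
  qed (use H0 in simp)
  then show ?thesis by (simp add: \<sigma>_def A_def p_def H_def f_def)
qed

section \<open>Random restrictions\<close>

text \<open>Values beyond N are left alone, since there a multi-index is \<open>undefined\<close>;
  the masked index then stays in \<open>multi_indices\<close>. Only the part of A below N matters,
  so \<open>- A\<close> can stand for the complementary block of coordinates.\<close>

definition mask_index :: "nat \<Rightarrow> nat set \<Rightarrow> (nat \<Rightarrow> nat) \<Rightarrow> nat \<Rightarrow> nat" where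
  "mask_index N A \<alpha> = (\<lambda>j. if j < N \<and> j \<notin> A then 0 else \<alpha> j)"

definition merge_points :: "nat \<Rightarrow> nat set \<Rightarrow> (nat \<Rightarrow> complex) \<Rightarrow> (nat \<Rightarrow> complex) \<Rightarrow> nat \<Rightarrow> complex" where
  "merge_points N A x y = (\<lambda>j. if j < N \<and> j \<notin> A then y j else x j)"

lemma mask_mem: "\<alpha> \<in> multi_indices K N \<Longrightarrow> mask_index N A \<alpha> \<in> multi_indices K N"
  by (auto simp: mask_index_def multi_indices_def PiE_iff extensional_def)

lemma merge_points_mem:
  "x \<in> cyclic_cube K N \<Longrightarrow> y \<in> cyclic_cube K N \<Longrightarrow> merge_points N A x y \<in> cyclic_cube K N"
  by (auto simp: merge_points_def cyclic_cube_def PiE_iff extensional_def)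

lemma mask_inject:
  assumes "mask_index N A \<alpha> = mask_index N A \<beta>" "mask_index N (- A) \<alpha> = mask_index N (- A) \<beta>"
  shows "\<alpha> = \<beta>"
proof
  fix j
  show "\<alpha> j = \<beta> j"
    using fun_cong[OF assms(1), of j] fun_cong[OF assms(2), of j]
    by (cases "j \<in> A") (auto simp: mask_index_def split: if_splits)
qed

lemma interaction_order_mask:
  "interaction_order N (mask_index N A \<alpha>) = card (A \<inter> {j. j < N \<and> \<alpha> j \<noteq> 0})"
proof -
  have "{j. j < N \<and> mask_index N A \<alpha> j \<noteq> 0} = A \<inter> {j. j < N \<and> \<alpha> j \<noteq> 0}"
    by (auto simp: mask_index_def)
  then show ?thesis by (simp add: interaction_order_def)
qed

lemma interaction_order_split:
  "interaction_order N \<alpha> = interaction_order N (mask_index N A \<alpha>) + interaction_order N (mask_index N (- A) \<alpha>)"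
proof -
  let ?T = "{j. j < N \<and> \<alpha> j \<noteq> 0}"
  have "?T = (A \<inter> ?T) \<union> (- A \<inter> ?T)" by auto
  then have "card ?T = card (A \<inter> ?T) + card (- A \<inter> ?T)"
    by (metis (no_types, lifting) Int_assoc Int_commute card_Un_disjoint compl_inf_bot finite_Collect_less_nat
        finite_Int finite_subset inf_bot_left mem_Collect_eq subsetI)
  then show ?thesis unfolding interaction_order_mask by (simp add: interaction_order_def)
qed

lemma character_merge:
  "character N \<alpha> (merge_points N A x y) = character N (mask_index N A \<alpha>) x * character N (mask_index N (- A) \<alpha>) y"
  unfolding character_def prod.distrib[symmetric]
  by (intro prod.cong) (auto simp: merge_points_def mask_index_def)

text \<open>The Fourier coefficients of the function obtained by freezing the coordinates outside A
  at y. It is still regarded as a function of all N coordinates, so that a level bound for the same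
  K, N and d applies to it.\<close>

definition restrict_coeff ::
  "nat \<Rightarrow> nat \<Rightarrow> nat set \<Rightarrow> (nat \<Rightarrow> complex) \<Rightarrow> ((nat \<Rightarrow> nat) \<Rightarrow> complex) \<Rightarrow> (nat \<Rightarrow> nat) \<Rightarrow> complex" where
  "restrict_coeff K N A y c U =
    (\<Sum>\<alpha>\<in>{\<alpha> \<in> multi_indices K N. mask_index N A \<alpha> = U}. c \<alpha> * character N (mask_index N (- A) \<alpha>) y)"

lemma trig_poly_restrict_coeff:
  "trig_poly K N (restrict_coeff K N A y c) x = trig_poly K N c (merge_points N A x y)"
proof -
  have "trig_poly K N (restrict_coeff K N A y c) x
    = (\<Sum>U\<in>multi_indices K N. \<Sum>\<alpha>\<in>{\<alpha> \<in> multi_indices K N. mask_index N A \<alpha> = U}.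
        c \<alpha> * character N \<alpha> (merge_points N A x y))"
    unfolding trig_poly_def restrict_coeff_def sum_distrib_right
    by (intro sum.cong refl) (auto simp: character_merge)
  also have "\<dots> = trig_poly K N c (merge_points N A x y)"
    unfolding trig_poly_def by (rule sum.group) (auto simp: mask_mem)
  finally show ?thesis .
qed

definition bounded_poly :: "nat \<Rightarrow> nat \<Rightarrow> nat \<Rightarrow> ((nat \<Rightarrow> nat) \<Rightarrow> complex) \<Rightarrow> bool" where
  "bounded_poly K N d c \<longleftrightarrow>
     (\<forall>\<alpha>\<in>multi_indices K N. c \<alpha> \<noteq> 0 \<longrightarrow> interaction_order N \<alpha> \<le> d) \<and>
     (\<forall>x\<in>cyclic_cube K N. cmod (trig_poly K N c x) \<le> 1)"

lemma bounded_poly_restrict_coeff: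
  assumes "bounded_poly K N d c" "y \<in> cyclic_cube K N"
  shows "bounded_poly K N d (restrict_coeff K N A y c)"
proof -
  have "interaction_order N U \<le> d" if "restrict_coeff K N A y c U \<noteq> 0" for U
  proof -
    have "\<exists>\<alpha>\<in>{\<alpha> \<in> multi_indices K N. mask_index N A \<alpha> = U}. c \<alpha> * character N (mask_index N (- A) \<alpha>) y \<noteq> 0"
      using that unfolding restrict_coeff_def by (meson sum.neutral)
    then obtain \<alpha> where \<alpha>: "\<alpha> \<in> multi_indices K N" "mask_index N A \<alpha> = U" "c \<alpha> \<noteq> 0"
      by auto
    then have "interaction_order N \<alpha> \<le> d" using assms by (auto simp: bounded_poly_def)
    then show ?thesis using interaction_order_split[of N \<alpha> A] \<alpha> by simp
  qed
  then show ?thesis using assms merge_points_mem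
    by (auto simp: bounded_poly_def trig_poly_restrict_coeff)
qed

text \<open>The exponent depends on the level. Controlling all levels up to \<open>k\<close> at once is what makes
  the recursion lose only a bounded factor per doubling of \<open>k\<close>.\<close>

definition level_bound :: "nat \<Rightarrow> nat \<Rightarrow> nat \<Rightarrow> nat \<Rightarrow> real \<Rightarrow> bool" where
  "level_bound K N d k D \<longleftrightarrow> (\<forall>c. bounded_poly K N d c \<longrightarrow>
     (\<Sum>\<alpha>\<in>{\<alpha> \<in> multi_indices K N. 1 \<le> interaction_order N \<alpha> \<and> interaction_order N \<alpha> \<le> k}.
        (cmod (c \<alpha>) / D) powr bh_exponent (interaction_order N \<alpha>)) \<le> 1)"

lemma level_boundD:
  "level_bound K N d k D \<Longrightarrow> bounded_poly K N d c \<Longrightarrow>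
    (\<Sum>\<alpha>\<in>{\<alpha> \<in> multi_indices K N. 1 \<le> interaction_order N \<alpha> \<and> interaction_order N \<alpha> \<le> k}.
        (cmod (c \<alpha>) / D) powr bh_exponent (interaction_order N \<alpha>)) \<le> 1"
  by (simp add: level_bound_def)

text \<open>The l^2 norm of t on the fibre over U, restricted to a set G because for a given A only
  the indices that A splits well are summed.\<close>

definition slice_norm ::
  "nat \<Rightarrow> nat set \<Rightarrow> (nat \<Rightarrow> nat) set \<Rightarrow> ((nat \<Rightarrow> nat) \<Rightarrow> real) \<Rightarrow> (nat \<Rightarrow> nat) \<Rightarrow> real" where
  "slice_norm N A G t U = sqrt (\<Sum>\<alpha>\<in>{\<alpha>\<in>G. mask_index N A \<alpha> = U}. (t \<alpha>)\<^sup>2)"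

lemma slice_norm_le_restrict_coeff:
  assumes K: "K \<ge> 2" and R: "R \<ge> 1" and c: "bounded_poly K N d c" and G: "G \<subseteq> multi_indices K N"
    and U: "1 \<le> interaction_order N U"
    and ratio: "\<And>\<alpha>. \<alpha> \<in> G \<Longrightarrow> mask_index N A \<alpha> = U \<Longrightarrow>
       real (interaction_order N (mask_index N (- A) \<alpha>)) \<le> R * real (interaction_order N U)"
    and low: "2 \<le> interaction_order N U \<or> real d \<le> R"
  shows "slice_norm N A G (\<lambda>\<alpha>. cmod (c \<alpha>)) U powr bh_exponent (interaction_order N U)
    \<le> (bonami_const K powr (2 * R)) powr bh_exponent (interaction_order N U)
      * cube_avg K N (\<lambda>y. cmod (restrict_coeff K N A y c U) powr bh_exponent (interaction_order N U))"
proof -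
  let ?a = "interaction_order N U"
  define p where "p = bh_exponent ?a"
  have p: "p > 0" using bh_exponent_pos[OF U] by (simp add: p_def)
  define j where "j = nat \<lfloor>R * real ?a\<rfloor>"
  define I where "I = {\<alpha> \<in> multi_indices K N. mask_index N A \<alpha> = U}"
  define e where "e V = (\<Sum>\<alpha>\<in>{\<alpha>\<in>I. mask_index N (- A) \<alpha> = V}. c \<alpha>)" for V
  define S where "S = {V \<in> multi_indices K N. interaction_order N V \<le> j}"
  define T where "T = {\<alpha>\<in>G. mask_index N A \<alpha> = U}"
  have TI: "T \<subseteq> I" using G by (auto simp: T_def I_def)
  have inj: "inj_on (mask_index N (- A)) I"
    by (intro inj_onI) (auto simp: I_def intro: mask_inject)
  have e: "e (mask_index N (- A) \<alpha>) = c \<alpha>" if "\<alpha> \<in> I" for \<alpha>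
  proof -
    have "{\<beta>\<in>I. mask_index N (- A) \<beta> = mask_index N (- A) \<alpha>} = {\<alpha>}"
      using that inj by (auto simp: inj_on_def)
    then show ?thesis by (simp add: e_def)
  qed
  have finI: "finite I" by (simp add: I_def)
  have h: "trig_poly K N e y = restrict_coeff K N A y c U" for y
  proof -
    have "trig_poly K N e y = (\<Sum>V\<in>multi_indices K N. \<Sum>\<alpha>\<in>{\<alpha>\<in>I. mask_index N (- A) \<alpha> = V}.
        c \<alpha> * character N (mask_index N (- A) \<alpha>) y)"
      unfolding trig_poly_def e_def sum_distrib_right by (intro sum.cong refl) auto
    also have "\<dots> = (\<Sum>\<alpha>\<in>I. c \<alpha> * character N (mask_index N (- A) \<alpha>) y)"
      by (rule sum.group) (auto simp: finI, auto simp: I_def mask_mem)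
    finally show ?thesis by (simp add: restrict_coeff_def I_def)
  qed
  have j: "real j \<le> R * real ?a" using R by (simp add: j_def)
  have "slice_norm N A G (\<lambda>\<alpha>. cmod (c \<alpha>)) U = sqrt (\<Sum>\<alpha>\<in>T. (cmod (c \<alpha>))\<^sup>2)"
    by (simp add: slice_norm_def T_def)
  also have "\<dots> = sqrt (\<Sum>V\<in>mask_index N (- A) ` T. (cmod (e V))\<^sup>2)"
    using TI e by (subst sum.reindex[OF inj_on_subset[OF inj TI]]) (auto intro!: arg_cong[where f=sqrt] sum.cong)
  also have "\<dots> \<le> sqrt (\<Sum>V\<in>S. (cmod (e V))\<^sup>2)"
  proof (intro real_sqrt_le_mono sum_mono2)
    show "mask_index N (- A) ` T \<subseteq> S"
    proof (intro image_subsetI)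
      fix \<alpha> assume \<alpha>: "\<alpha> \<in> T"
      then have "real (interaction_order N (mask_index N (- A) \<alpha>)) \<le> R * real ?a"
        using ratio by (auto simp: T_def)
      then have "interaction_order N (mask_index N (- A) \<alpha>) \<le> j" unfolding j_def by (simp add: le_nat_floor)
      then show "mask_index N (- A) \<alpha> \<in> S" using \<alpha> TI by (auto simp: S_def I_def mask_mem)
    qed
  qed (auto simp: S_def)
  finally have "slice_norm N A G (\<lambda>\<alpha>. cmod (c \<alpha>)) U powr p \<le> sqrt (\<Sum>V\<in>S. (cmod (e V))\<^sup>2) powr p"
    using p by (intro powr_mono2) (auto simp: slice_norm_def intro!: sum_nonneg)
  also have "\<dots> \<le> (bonami_const K powr (2 * real j / real ?a)) powr p
      * cube_avg K N (\<lambda>y. cmod (trig_poly K N e y) powr p)"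
    unfolding p_def
  proof (rule bonami_dual[OF K U])
    \<comment> \<open>Since U has order at least 1, d <= R gives d <= j. Then S contains every V
      with a nonzero coefficient, which is what the case of order 1 requires.\<close>
    have "e V = 0" if V: "V \<in> multi_indices K N" "V \<notin> S" and d: "real d \<le> R" for V
    proof (rule ccontr)
      assume "e V \<noteq> 0"
      then obtain \<alpha> where \<alpha>: "\<alpha> \<in> multi_indices K N" "mask_index N (- A) \<alpha> = V" "c \<alpha> \<noteq> 0"
        using sum.not_neutral_contains_not_neutral[of c] unfolding e_def I_def by blast
      then have "interaction_order N \<alpha> \<le> d" using c by (auto simp: bounded_poly_def)
      then have "interaction_order N V \<le> d" using interaction_order_split[of N \<alpha> A] \<alpha> by simp
      moreover have "d \<le> j"
      proof -
        have "R * 1 \<le> R * real ?a" using U R by (intro mult_left_mono) auto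
        then show ?thesis using d unfolding j_def by (intro le_nat_floor) linarith
      qed
      ultimately show False using V by (auto simp: S_def)
    qed
    then show "2 \<le> ?a \<or> (\<forall>V\<in>multi_indices K N - S. e V = 0)" using low by auto
  qed (auto simp: S_def)
  also have "\<dots> \<le> (bonami_const K powr (2 * R)) powr p
      * cube_avg K N (\<lambda>y. cmod (trig_poly K N e y) powr p)"
    using j U bonami_const_ge[of K] p
    by (intro mult_right_mono powr_mono2 powr_mono cube_avg_nonneg) (auto simp: field_simps)
  finally show ?thesis by (simp add: h p_def)
qed

text \<open>The exponent depends on U alone, so each U is estimated with its own exponent and the
  sum over U is then moved inside the average over y. For every single y the restricted polynomial
  is again bounded, and the level bound applies to it.\<close>

lemma sum_slice_norm_le_1:
  assumes K: "K \<ge> 2" and R: "R \<ge> 1" and D: "D > 0" and c: "bounded_poly K N d c"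
    and lev: "level_bound K N d k D" and G: "G \<subseteq> multi_indices K N"
    and order: "\<And>\<alpha>. \<alpha> \<in> G \<Longrightarrow> 1 \<le> interaction_order N (mask_index N A \<alpha>) \<and> interaction_order N (mask_index N A \<alpha>) \<le> k"
    and ratio: "\<And>\<alpha>. \<alpha> \<in> G \<Longrightarrow>
       real (interaction_order N (mask_index N (- A) \<alpha>)) \<le> R * real (interaction_order N (mask_index N A \<alpha>))"
    and low: "\<And>\<alpha>. \<alpha> \<in> G \<Longrightarrow> 2 \<le> interaction_order N (mask_index N A \<alpha>) \<or> real d \<le> R"
  shows "(\<Sum>U\<in>mask_index N A ` G. slice_norm N A G (\<lambda>\<alpha>. cmod (c \<alpha>) / (bonami_const K powr (2 * R) * D)) U
      powr bh_exponent (interaction_order N U)) \<le> 1"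
proof -
  define B where "B = bonami_const K powr (2 * R)"
  have B: "B > 0" using bonami_const_ge[of K] by (simp add: B_def)
  let ?L = "{\<alpha> \<in> multi_indices K N. 1 \<le> interaction_order N \<alpha> \<and> interaction_order N \<alpha> \<le> k}"
  have scale: "slice_norm N A G (\<lambda>\<alpha>. cmod (c \<alpha>) / (B * D)) U = slice_norm N A G (\<lambda>\<alpha>. cmod (c \<alpha>)) U / (B * D)" for U
    using B D by (simp add: slice_norm_def power_divide real_sqrt_divide flip: sum_divide_distrib)
  have "(\<Sum>U\<in>mask_index N A ` G. slice_norm N A G (\<lambda>\<alpha>. cmod (c \<alpha>) / (B * D)) U powr bh_exponent (interaction_order N U))
     \<le> (\<Sum>U\<in>mask_index N A ` G. cube_avg K N (\<lambda>y. (cmod (restrict_coeff K N A y c U) / D) powr bh_exponent (interaction_order N U)))"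
  proof (rule sum_mono)
    fix U assume "U \<in> mask_index N A ` G"
    then obtain \<beta> where \<beta>: "\<beta> \<in> G" "U = mask_index N A \<beta>" by auto
    define p where "p = bh_exponent (interaction_order N U)"
    have "slice_norm N A G (\<lambda>\<alpha>. cmod (c \<alpha>)) U powr p
      \<le> B powr p * cube_avg K N (\<lambda>y. cmod (restrict_coeff K N A y c U) powr p)"
      unfolding p_def B_def
      by (rule slice_norm_le_restrict_coeff[OF K R c G]) (use \<beta> order low ratio in force)+
    then have "slice_norm N A G (\<lambda>\<alpha>. cmod (c \<alpha>)) U powr p / (B * D) powr p
      \<le> B powr p * cube_avg K N (\<lambda>y. cmod (restrict_coeff K N A y c U) powr p) / (B * D) powr p"
      by (rule divide_right_mono) simp
    also have "\<dots> = cube_avg K N (\<lambda>y. (cmod (restrict_coeff K N A y c U) / D) powr p)"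
      using B D by (simp add: powr_mult powr_divide cube_avg_def sum_divide_distrib[symmetric] mult_ac)
    finally show "slice_norm N A G (\<lambda>\<alpha>. cmod (c \<alpha>) / (B * D)) U powr bh_exponent (interaction_order N U)
      \<le> cube_avg K N (\<lambda>y. (cmod (restrict_coeff K N A y c U) / D) powr bh_exponent (interaction_order N U))"
      using B D unfolding scale p_def by (simp add: powr_divide slice_norm_def sum_nonneg)
  qed
  also have "\<dots> \<le> (\<Sum>U\<in>?L. cube_avg K N (\<lambda>y. (cmod (restrict_coeff K N A y c U) / D) powr bh_exponent (interaction_order N U)))"
    by (rule sum_mono2) (use order G mask_mem in \<open>auto intro!: cube_avg_nonneg\<close>)
  also have "\<dots> = cube_avg K N (\<lambda>y. \<Sum>U\<in>?L. (cmod (restrict_coeff K N A y c U) / D) powr bh_exponent (interaction_order N U))"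
    by (rule cube_avg_sum[symmetric])
  also have "\<dots> \<le> cube_avg K N (\<lambda>_. 1)"
    by (intro cube_avg_mono level_boundD[OF lev] bounded_poly_restrict_coeff[OF c])
  also have "\<dots> = 1" using K by (simp add: cube_avg_const)
  finally show ?thesis by (simp add: B_def)
qed

section \<open>A pointwise Blei inequality and the recursion over levels\<close>

text \<open>The weights a/(a+b+1), b/(a+b+1) and 1/(a+b+1) are those for which all powers of r and s
  cancel in the weighted geometric mean, while t keeps the power 2(a+b)/(a+b+1).\<close>

lemma blei_pointwise:
  fixes t r s :: real
  assumes "0 < t" "0 < r" "0 < s" "1 \<le> a" "1 \<le> b"
  shows "t powr bh_exponent (a + b)
    \<le> real a / real (a + b + 1) * (t\<^sup>2 * r powr (bh_exponent a - 2))
      + real b / real (a + b + 1) * (t\<^sup>2 * s powr (bh_exponent b - 2))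
      + 1 / real (a + b + 1) * (r powr bh_exponent a * s powr bh_exponent b)"
proof -
  define u v w where "u = real a / real (a + b + 1)" and "v = real b / real (a + b + 1)"
    and "w = 1 / real (a + b + 1)"
  have uvw: "u + v + w = 1"
    by (simp add: u_def v_def w_def flip: add_divide_distrib)
  have e1: "2 * u + 2 * v = bh_exponent (a + b)"
    by (simp add: u_def v_def bh_exponent_def add_divide_distrib add_ac)
  have e2: "(bh_exponent a - 2) * u + bh_exponent a * w = 0" "(bh_exponent b - 2) * v + bh_exponent b * w = 0"
    using assms by (simp_all add: u_def v_def w_def bh_exponent_def divide_simps)
  have "(t\<^sup>2 * r powr (bh_exponent a - 2)) powr u * (t\<^sup>2 * s powr (bh_exponent b - 2)) powr v
      * (r powr bh_exponent a * s powr bh_exponent b) powr w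
    = (t powr (2 * u) * t powr (2 * v)) * (r powr ((bh_exponent a - 2) * u) * r powr (bh_exponent a * w))
      * (s powr ((bh_exponent b - 2) * v) * s powr (bh_exponent b * w))"
    using assms by (simp add: powr_mult powr_powr power_powr)
  also have "\<dots> = t powr bh_exponent (a + b)"
    unfolding powr_add[symmetric] e1 e2 using assms by simp
  finally have "(t\<^sup>2 * r powr (bh_exponent a - 2)) powr u * (t\<^sup>2 * s powr (bh_exponent b - 2)) powr v
      * (r powr bh_exponent a * s powr bh_exponent b) powr w = t powr bh_exponent (a + b)" .
  moreover have "(t\<^sup>2 * r powr (bh_exponent a - 2)) powr u * (t\<^sup>2 * s powr (bh_exponent b - 2)) powr v
      * (r powr bh_exponent a * s powr bh_exponent b) powr w
    \<le> u * (t\<^sup>2 * r powr (bh_exponent a - 2)) + v * (t\<^sup>2 * s powr (bh_exponent b - 2))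
      + w * (r powr bh_exponent a * s powr bh_exponent b)"
    using assms uvw by (intro weighted_arith_geo_mean3) (auto simp: u_def v_def w_def)
  ultimately show ?thesis by (simp add: u_def v_def w_def)
qed

text \<open>On one fibre the slice norm r is constant and the squares of t add up to r^2; multiplied
  by r^(p-2) this gives r^p.\<close>

lemma sum_slice_norm_weighted:
  assumes "finite G"
  shows "(\<Sum>\<alpha>\<in>G. (t \<alpha>)\<^sup>2 * slice_norm N A G t (mask_index N A \<alpha>) powr (bh_exponent (interaction_order N (mask_index N A \<alpha>)) - 2))
    = (\<Sum>U\<in>mask_index N A ` G. slice_norm N A G t U powr bh_exponent (interaction_order N U))"
proof -
  let ?r = "slice_norm N A G t" and ?p = "\<lambda>U. bh_exponent (interaction_order N U)"
  have "(\<Sum>\<alpha>\<in>G. (t \<alpha>)\<^sup>2 * ?r (mask_index N A \<alpha>) powr (?p (mask_index N A \<alpha>) - 2))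
    = (\<Sum>U\<in>mask_index N A ` G. \<Sum>\<alpha>\<in>{\<alpha>\<in>G. mask_index N A \<alpha> = U}. (t \<alpha>)\<^sup>2 * ?r (mask_index N A \<alpha>) powr (?p (mask_index N A \<alpha>) - 2))"
    by (rule sum.image_gen[OF assms])
  also have "\<dots> = (\<Sum>U\<in>mask_index N A ` G. (?r U)\<^sup>2 * ?r U powr (?p U - 2))"
    by (intro sum.cong refl) (simp add: slice_norm_def sum_nonneg flip: sum_distrib_right)
  also have "\<dots> = (\<Sum>U\<in>mask_index N A ` G. ?r U powr ?p U)"
  proof (intro sum.cong refl)
    fix U
    have "?r U \<ge> 0" by (simp add: slice_norm_def sum_nonneg)
    then show "(?r U)\<^sup>2 * ?r U powr (?p U - 2) = ?r U powr ?p U"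
      by (cases "?r U = 0") (simp_all add: powr_diff)
  qed
  finally show ?thesis .
qed

text \<open>The pointwise inequality is summed with r and s the two slice norms. The first two terms
  collapse to the sums in \<open>X\<close> and \<open>Y\<close>; the third is at most their product,
  because distinct indices have distinct pairs of halves. The numbers \<tau> and \<tau>' bound the
  Blei weights, so that evenly split indices of high order give a total near 1.\<close>

lemma blei_sum:
  fixes t :: "(nat \<Rightarrow> nat) \<Rightarrow> real"
  assumes fin: "finite G" and t: "\<And>\<alpha>. \<alpha> \<in> G \<Longrightarrow> t \<alpha> \<ge> 0"
    and ord: "\<And>\<alpha>. \<alpha> \<in> G \<Longrightarrow> 1 \<le> interaction_order N (mask_index N A \<alpha>)"
      "\<And>\<alpha>. \<alpha> \<in> G \<Longrightarrow> 1 \<le> interaction_order N (mask_index N (- A) \<alpha>)"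
    and tau: "\<And>\<alpha>. \<alpha> \<in> G \<Longrightarrow> real (interaction_order N (mask_index N A \<alpha>)) \<le> \<tau> * real (interaction_order N \<alpha> + 1)"
      "\<And>\<alpha>. \<alpha> \<in> G \<Longrightarrow> real (interaction_order N (mask_index N (- A) \<alpha>)) \<le> \<tau> * real (interaction_order N \<alpha> + 1)"
      "\<And>\<alpha>. \<alpha> \<in> G \<Longrightarrow> 1 \<le> \<tau>' * real (interaction_order N \<alpha> + 1)"
    and pos: "0 \<le> \<tau>" "0 \<le> \<tau>'"
    and X: "(\<Sum>U\<in>mask_index N A ` G. slice_norm N A G t U powr bh_exponent (interaction_order N U)) \<le> 1"
    and Y: "(\<Sum>V\<in>mask_index N (- A) ` G. slice_norm N (- A) G t V powr bh_exponent (interaction_order N V)) \<le> 1"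
  shows "(\<Sum>\<alpha>\<in>G. t \<alpha> powr bh_exponent (interaction_order N \<alpha>)) \<le> 2 * \<tau> + \<tau>'"
proof -
  let ?U = "mask_index N A" and ?V = "mask_index N (- A)"
  let ?p = "\<lambda>U. bh_exponent (interaction_order N U)"
  define r s where "r = slice_norm N A G t" and "s = slice_norm N (- A) G t"
  have slice_ge: "t \<alpha> \<le> slice_norm N B G t (mask_index N B \<alpha>)" if "\<alpha> \<in> G" for \<alpha> B
  proof -
    have "(t \<alpha>)\<^sup>2 \<le> (\<Sum>\<beta>\<in>{\<beta>\<in>G. mask_index N B \<beta> = mask_index N B \<alpha>}. (t \<beta>)\<^sup>2)"
      by (rule member_le_sum) (use that fin in auto)
    then show ?thesis unfolding slice_norm_def by (rule real_le_rsqrt)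
  qed
  have point: "t \<alpha> powr ?p \<alpha> \<le> \<tau> * ((t \<alpha>)\<^sup>2 * r (?U \<alpha>) powr (?p (?U \<alpha>) - 2))
      + \<tau> * ((t \<alpha>)\<^sup>2 * s (?V \<alpha>) powr (?p (?V \<alpha>) - 2))
      + \<tau>' * (r (?U \<alpha>) powr ?p (?U \<alpha>) * s (?V \<alpha>) powr ?p (?V \<alpha>))" if \<alpha>: "\<alpha> \<in> G" for \<alpha>
  proof (cases "t \<alpha> = 0")
    case False
    then have t0: "0 < t \<alpha>" using t[OF \<alpha>] by simp
    have rs: "0 < r (?U \<alpha>)" "0 < s (?V \<alpha>)"
      using slice_ge[OF \<alpha>, of A] slice_ge[OF \<alpha>, of "- A"] t0 by (auto simp: r_def s_def)
    let ?a = "interaction_order N (?U \<alpha>)" and ?b = "interaction_order N (?V \<alpha>)"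
    have ab: "interaction_order N \<alpha> = ?a + ?b" by (rule interaction_order_split)
    have "t \<alpha> powr ?p \<alpha> \<le> real ?a / real (?a + ?b + 1) * ((t \<alpha>)\<^sup>2 * r (?U \<alpha>) powr (?p (?U \<alpha>) - 2))
      + real ?b / real (?a + ?b + 1) * ((t \<alpha>)\<^sup>2 * s (?V \<alpha>) powr (?p (?V \<alpha>) - 2))
      + 1 / real (?a + ?b + 1) * (r (?U \<alpha>) powr ?p (?U \<alpha>) * s (?V \<alpha>) powr ?p (?V \<alpha>))"
      unfolding ab by (rule blei_pointwise[OF t0 rs ord[OF \<alpha>]])
    also have "\<dots> \<le> \<tau> * ((t \<alpha>)\<^sup>2 * r (?U \<alpha>) powr (?p (?U \<alpha>) - 2))
      + \<tau> * ((t \<alpha>)\<^sup>2 * s (?V \<alpha>) powr (?p (?V \<alpha>) - 2))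
      + \<tau>' * (r (?U \<alpha>) powr ?p (?U \<alpha>) * s (?V \<alpha>) powr ?p (?V \<alpha>))"
      using tau[OF \<alpha>] unfolding ab
      by (intro add_mono mult_right_mono) (auto simp: pos_divide_le_eq)
    finally show ?thesis .
  qed (use pos in \<open>auto intro!: add_nonneg_nonneg mult_nonneg_nonneg\<close>)
  have XY: "(\<Sum>\<alpha>\<in>G. r (?U \<alpha>) powr ?p (?U \<alpha>) * s (?V \<alpha>) powr ?p (?V \<alpha>)) \<le> 1"
  proof -
    let ?F = "\<lambda>(U, V). r U powr ?p U * s V powr ?p V"
    have inj: "inj_on (\<lambda>\<alpha>. (?U \<alpha>, ?V \<alpha>)) G"
      by (intro inj_onI) (auto intro: mask_inject)
    have "(\<Sum>\<alpha>\<in>G. r (?U \<alpha>) powr ?p (?U \<alpha>) * s (?V \<alpha>) powr ?p (?V \<alpha>))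
        = sum ?F ((\<lambda>\<alpha>. (?U \<alpha>, ?V \<alpha>)) ` G)"
      by (subst sum.reindex[OF inj]) simp
    also have "\<dots> \<le> sum ?F (?U ` G \<times> ?V ` G)"
      using fin by (intro sum_mono2) auto
    also have "\<dots> = (\<Sum>U\<in>?U ` G. r U powr ?p U) * (\<Sum>V\<in>?V ` G. s V powr ?p V)"
      by (simp add: sum_product sum.cartesian_product)
    also have "\<dots> \<le> 1 * 1"
      by (intro mult_mono) (use X Y in \<open>auto simp: r_def s_def intro!: sum_nonneg\<close>)
    finally show ?thesis by simp
  qed
  have "(\<Sum>\<alpha>\<in>G. t \<alpha> powr ?p \<alpha>) \<le> (\<Sum>\<alpha>\<in>G. \<tau> * ((t \<alpha>)\<^sup>2 * r (?U \<alpha>) powr (?p (?U \<alpha>) - 2))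
      + \<tau> * ((t \<alpha>)\<^sup>2 * s (?V \<alpha>) powr (?p (?V \<alpha>) - 2))
      + \<tau>' * (r (?U \<alpha>) powr ?p (?U \<alpha>) * s (?V \<alpha>) powr ?p (?V \<alpha>)))"
    by (intro sum_mono point)
  also have "\<dots> = \<tau> * (\<Sum>U\<in>?U ` G. r U powr ?p U) + \<tau> * (\<Sum>V\<in>?V ` G. s V powr ?p V)
      + \<tau>' * (\<Sum>\<alpha>\<in>G. r (?U \<alpha>) powr ?p (?U \<alpha>) * s (?V \<alpha>) powr ?p (?V \<alpha>))"
    unfolding sum.distrib sum_distrib_left[symmetric] r_def s_def sum_slice_norm_weighted[OF fin] ..
  also have "\<dots> \<le> \<tau> * 1 + \<tau> * 1 + \<tau>' * 1"
    using pos X Y XY by (intro add_mono mult_left_mono) (auto simp: r_def s_def)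
  finally show ?thesis by simp
qed

definition balanced_split :: "nat \<Rightarrow> nat \<Rightarrow> real \<Rightarrow> real \<Rightarrow> nat \<Rightarrow> nat \<Rightarrow> bool" where
  "balanced_split d k R \<tau> a b \<longleftrightarrow> 1 \<le> a \<and> a \<le> k \<and> 1 \<le> b \<and> b \<le> k \<and>
     real b \<le> R * real a \<and> real a \<le> R * real b \<and> (2 \<le> a \<and> 2 \<le> b \<or> real d \<le> R) \<and>
     real a \<le> \<tau> * real (a + b + 1) \<and> real b \<le> \<tau> * real (a + b + 1)"

lemma balanced_levels_le:
  assumes K: "K \<ge> 2" and R: "R \<ge> 1" and D: "D > 0" and c: "bounded_poly K N d c"
    and lev: "level_bound K N d k D" and pos: "0 \<le> \<tau>" "0 \<le> \<tau>'"
    and G: "G \<subseteq> multi_indices K N"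
    and bal: "\<And>\<alpha>. \<alpha> \<in> G \<Longrightarrow> balanced_split d k R \<tau> (interaction_order N (mask_index N A \<alpha>)) (interaction_order N (mask_index N (- A) \<alpha>))"
    and tau': "\<And>\<alpha>. \<alpha> \<in> G \<Longrightarrow> 1 \<le> \<tau>' * real (interaction_order N \<alpha> + 1)"
  shows "(\<Sum>\<alpha>\<in>G. (cmod (c \<alpha>) / (bonami_const K powr (2 * R) * D)) powr bh_exponent (interaction_order N \<alpha>)) \<le> 2 * \<tau> + \<tau>'"
proof (rule blei_sum)
  show "finite G" using finite_subset[OF G] by simp
  show "(\<Sum>U\<in>mask_index N A ` G. slice_norm N A G (\<lambda>\<alpha>. cmod (c \<alpha>) / (bonami_const K powr (2 * R) * D)) U
      powr bh_exponent (interaction_order N U)) \<le> 1"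
    by (rule sum_slice_norm_le_1[OF K R D c lev G]) (use bal in \<open>auto simp: balanced_split_def\<close>)
  show "(\<Sum>U\<in>mask_index N (- A) ` G. slice_norm N (- A) G (\<lambda>\<alpha>. cmod (c \<alpha>) / (bonami_const K powr (2 * R) * D)) U
      powr bh_exponent (interaction_order N U)) \<le> 1"
    by (rule sum_slice_norm_le_1[OF K R D c lev G]) (use bal in \<open>auto simp: balanced_split_def\<close>)
  show "0 \<le> cmod (c \<alpha>) / (bonami_const K powr (2 * R) * D)" for \<alpha> using D by simp
  have split: "interaction_order N \<alpha> = interaction_order N (mask_index N A \<alpha>) + interaction_order N (mask_index N (- A) \<alpha>)" for \<alpha>
    by (rule interaction_order_split)
  show "real (interaction_order N (mask_index N A \<alpha>)) \<le> \<tau> * real (interaction_order N \<alpha> + 1)" if "\<alpha> \<in> G" for \<alpha>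
    using bal[OF that] unfolding split[of \<alpha>] balanced_split_def by blast
  show "real (interaction_order N (mask_index N (- A) \<alpha>)) \<le> \<tau> * real (interaction_order N \<alpha> + 1)" if "\<alpha> \<in> G" for \<alpha>
    using bal[OF that] unfolding split[of \<alpha>] balanced_split_def by blast
qed (use bal pos tau' in \<open>auto simp: balanced_split_def\<close>)

text \<open>The hypothesis \<open>prob\<close> says that a uniformly random set \<open>A\<close> splits \<open>\<alpha>\<close> in a balanced way with
  probability at least \<open>\<pi>\<close>; the bound follows by averaging over \<open>A\<close>.\<close>

lemma level_step:
  assumes K: "K \<ge> 2" and R: "R \<ge> 1" and D: "D > 0" and c: "bounded_poly K N d c"
    and lev: "level_bound K N d k D" and pos: "0 \<le> \<tau>" "0 \<le> \<tau>'" "0 < \<pi>"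
    and prob: "\<And>\<alpha>. \<alpha> \<in> multi_indices K N \<Longrightarrow> k < interaction_order N \<alpha> \<Longrightarrow> interaction_order N \<alpha> \<le> k' \<Longrightarrow>
      \<pi> * 2 ^ N \<le> real (card {A \<in> Pow {..<N}. balanced_split d k R \<tau>
        (interaction_order N (mask_index N A \<alpha>)) (interaction_order N (mask_index N (- A) \<alpha>))})"
    and tau': "1 \<le> \<tau>' * real (k + 2)"
  shows "(\<Sum>\<alpha>\<in>{\<alpha> \<in> multi_indices K N. k < interaction_order N \<alpha> \<and> interaction_order N \<alpha> \<le> k'}.
      (cmod (c \<alpha>) / (bonami_const K powr (2 * R) * D)) powr bh_exponent (interaction_order N \<alpha>)) \<le> (2 * \<tau> + \<tau>') / \<pi>"
proof -
  define L where "L = {\<alpha> \<in> multi_indices K N. k < interaction_order N \<alpha> \<and> interaction_order N \<alpha> \<le> k'}"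
  define T where "T \<alpha> = (cmod (c \<alpha>) / (bonami_const K powr (2 * R) * D)) powr bh_exponent (interaction_order N \<alpha>)" for \<alpha>
  define good where "good A \<alpha> \<longleftrightarrow> balanced_split d k R \<tau>
        (interaction_order N (mask_index N A \<alpha>)) (interaction_order N (mask_index N (- A) \<alpha>))" for A \<alpha>
  have finL: "finite L" by (simp add: L_def)
  have "(\<Sum>\<alpha>\<in>L. T \<alpha>) * (\<pi> * 2 ^ N) = (\<Sum>\<alpha>\<in>L. T \<alpha> * (\<pi> * 2 ^ N))"
    by (simp add: sum_distrib_right)
  also have "\<dots> \<le> (\<Sum>\<alpha>\<in>L. T \<alpha> * real (card {A \<in> Pow {..<N}. good A \<alpha>}))"
    by (intro sum_mono mult_left_mono) (use prob in \<open>auto simp: L_def T_def good_def\<close>)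
  also have "\<dots> = (\<Sum>\<alpha>\<in>L. \<Sum>A\<in>Pow {..<N}. if good A \<alpha> then T \<alpha> else 0)"
    by (intro sum.cong refl) (simp add: sum.If_cases Int_def mult.commute)
  also have "\<dots> = (\<Sum>A\<in>Pow {..<N}. \<Sum>\<alpha>\<in>{\<alpha>\<in>L. good A \<alpha>}. T \<alpha>)"
    by (subst sum.swap) (simp add: sum.If_cases finL Int_def)
  also have "\<dots> \<le> (\<Sum>A\<in>Pow {..<N}. 2 * \<tau> + \<tau>')"
  proof (intro sum_mono)
    fix A
    show "(\<Sum>\<alpha>\<in>{\<alpha>\<in>L. good A \<alpha>}. T \<alpha>) \<le> 2 * \<tau> + \<tau>'"
      unfolding T_def
    proof (rule balanced_levels_le[OF K R D c lev pos(1,2)])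
      fix \<alpha> assume \<alpha>: "\<alpha> \<in> {\<alpha>\<in>L. good A \<alpha>}"
      have "\<tau>' * real (k + 2) \<le> \<tau>' * real (interaction_order N \<alpha> + 1)"
        using \<alpha> pos by (intro mult_left_mono) (auto simp: L_def)
      then show "1 \<le> \<tau>' * real (interaction_order N \<alpha> + 1)" using tau' by linarith
    qed (auto simp: L_def good_def)
  qed
  also have "\<dots> = (2 * \<tau> + \<tau>') * 2 ^ N" by (simp add: card_Pow)
  finally have "((\<Sum>\<alpha>\<in>L. T \<alpha>) * \<pi>) * 2 ^ N \<le> (2 * \<tau> + \<tau>') * 2 ^ N" by (simp add: mult_ac)
  then have "(\<Sum>\<alpha>\<in>L. T \<alpha>) * \<pi> \<le> 2 * \<tau> + \<tau>'" by simp
  then show ?thesis using pos by (simp add: L_def T_def pos_le_divide_eq)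
qed

text \<open>Because p >= 1, enlarging the scale by C shrinks each term at least by C whatever its
  exponent; this is how a sum with mixed exponents is renormalized.\<close>

lemma powr_scale_le:
  fixes x :: real
  assumes "0 \<le> x" "1 \<le> C" "1 \<le> p"
  shows "(x / C) powr p \<le> x powr p / C"
proof -
  have "C powr 1 \<le> C powr p" using assms by (intro powr_mono) auto
  then show ?thesis using assms by (simp add: powr_divide divide_left_mono)
qed

text \<open>With the new scale C B D, where B = A^(2R), the old levels contribute at most 1/(C B)
  and the new ones at most ((2\<tau> + \<tau>')/\<pi>)/C. From A >= 2 and R >= 1 one has B >= 4,
  which is the origin of the summand 1/4 in the condition on C.\<close>

lemma level_bound_extend:
  assumes K: "K \<ge> 2" and R: "R \<ge> 1" and D: "D > 0"
    and lev: "level_bound K N d k D" and pos: "0 \<le> \<tau>" "0 \<le> \<tau>'" "0 < \<pi>"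
    and prob: "\<And>\<alpha>. \<alpha> \<in> multi_indices K N \<Longrightarrow> k < interaction_order N \<alpha> \<Longrightarrow> interaction_order N \<alpha> \<le> k' \<Longrightarrow>
      \<pi> * 2 ^ N \<le> real (card {A \<in> Pow {..<N}. balanced_split d k R \<tau>
        (interaction_order N (mask_index N A \<alpha>)) (interaction_order N (mask_index N (- A) \<alpha>))})"
    and tau': "1 \<le> \<tau>' * real (k + 2)"
    and C: "1 \<le> C" "(2 * \<tau> + \<tau>') / \<pi> + 1 / 4 \<le> C"
  shows "level_bound K N d k' (C * (bonami_const K powr (2 * R) * D))"
  unfolding level_bound_def
proof (intro allI impI)
  fix c assume c: "bounded_poly K N d c"
  define B where "B = bonami_const K powr (2 * R)"
  let ?s = "interaction_order N"
  let ?T = "\<lambda>E \<alpha>. (cmod (c \<alpha>) / E) powr bh_exponent (?s \<alpha>)"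
  have "2 powr 2 \<le> bonami_const K powr (2 * R)"
    using bonami_const_ge[of K] R
    by (intro order_trans[OF powr_mono2[of 2 2 "bonami_const K"] powr_mono[of 2 "2 * R"]]) auto
  then have B: "4 \<le> B" by (simp add: B_def)
  define L1 L2 where "L1 = {\<alpha> \<in> multi_indices K N. 1 \<le> ?s \<alpha> \<and> ?s \<alpha> \<le> k}"
    and "L2 = {\<alpha> \<in> multi_indices K N. k < ?s \<alpha> \<and> ?s \<alpha> \<le> k'}"
  have low: "(\<Sum>\<alpha>\<in>L1. ?T (C * (B * D)) \<alpha>) \<le> 1 / (C * B)"
  proof -
    have "(\<Sum>\<alpha>\<in>L1. ?T (C * (B * D)) \<alpha>) \<le> (\<Sum>\<alpha>\<in>L1. ?T D \<alpha> / (C * B))"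
    proof (intro sum_mono)
      fix \<alpha> assume "\<alpha> \<in> L1"
      moreover have "1 * 1 \<le> C * B" using C B by (intro mult_mono) auto
      ultimately show "?T (C * (B * D)) \<alpha> \<le> ?T D \<alpha> / (C * B)"
        using powr_scale_le[of "cmod (c \<alpha>) / D" "C * B" "bh_exponent (?s \<alpha>)"] D bh_exponent_ge_1[of "?s \<alpha>"]
        by (simp add: L1_def mult_ac)
    qed
    also have "\<dots> = (\<Sum>\<alpha>\<in>L1. ?T D \<alpha>) / (C * B)" by (simp add: sum_divide_distrib)
    also have "\<dots> \<le> 1 / (C * B)"
      using level_boundD[OF lev c] C B by (intro divide_right_mono) (auto simp: L1_def)
    finally show ?thesis .
  qed
  have high: "(\<Sum>\<alpha>\<in>L2. ?T (C * (B * D)) \<alpha>) \<le> ((2 * \<tau> + \<tau>') / \<pi>) / C"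
  proof -
    have "(\<Sum>\<alpha>\<in>L2. ?T (C * (B * D)) \<alpha>) \<le> (\<Sum>\<alpha>\<in>L2. ?T (B * D) \<alpha> / C)"
    proof (intro sum_mono)
      fix \<alpha> assume "\<alpha> \<in> L2"
      then show "?T (C * (B * D)) \<alpha> \<le> ?T (B * D) \<alpha> / C"
        using powr_scale_le[of "cmod (c \<alpha>) / (B * D)" C "bh_exponent (?s \<alpha>)"] D B C bh_exponent_ge_1[of "?s \<alpha>"]
        by (simp add: L2_def mult_ac)
    qed
    also have "\<dots> = (\<Sum>\<alpha>\<in>L2. ?T (B * D) \<alpha>) / C" by (simp add: sum_divide_distrib)
    also have "\<dots> \<le> ((2 * \<tau> + \<tau>') / \<pi>) / C"
      unfolding B_def L2_def using C
      by (intro divide_right_mono level_step[OF K R D c lev pos prob tau']) auto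
    finally show ?thesis .
  qed
  have "(\<Sum>\<alpha>\<in>{\<alpha> \<in> multi_indices K N. 1 \<le> ?s \<alpha> \<and> ?s \<alpha> \<le> k'}. ?T (C * (B * D)) \<alpha>)
      \<le> (\<Sum>\<alpha>\<in>L1 \<union> L2. ?T (C * (B * D)) \<alpha>)"
    by (intro sum_mono2) (auto simp: L1_def L2_def)
  also have "\<dots> = (\<Sum>\<alpha>\<in>L1. ?T (C * (B * D)) \<alpha>) + (\<Sum>\<alpha>\<in>L2. ?T (C * (B * D)) \<alpha>)"
    by (intro sum.union_disjoint) (auto simp: L1_def L2_def)
  also have "\<dots> \<le> 1 / (C * B) + ((2 * \<tau> + \<tau>') / \<pi>) / C"
    by (intro add_mono low high)
  also have "\<dots> \<le> 1 / (C * 4) + ((2 * \<tau> + \<tau>') / \<pi>) / C"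
    using C B by (intro add_right_mono divide_left_mono mult_left_mono) auto
  also have "\<dots> = ((2 * \<tau> + \<tau>') / \<pi> + 1 / 4) / C" unfolding add_divide_distrib[of _ "1 / 4"] by simp
  also have "\<dots> \<le> 1" using C by simp
  finally show "(\<Sum>\<alpha>\<in>{\<alpha> \<in> multi_indices K N. 1 \<le> ?s \<alpha> \<and> ?s \<alpha> \<le> k'}.
      ?T (C * (bonami_const K powr (2 * R) * D)) \<alpha>) \<le> 1" by (simp add: B_def)
qed

section \<open>Counting the subsets that split an index in a prescribed or a balanced way\<close>

lemma card_subsets_with_trace:
  assumes "finite X" "T \<subseteq> X" "S \<subseteq> T"
  shows "2 ^ card X \<le> 2 ^ card T * card {A \<in> Pow X. A \<inter> T = S}"
proof -
  have "(\<union>) S ` Pow (X - T) \<subseteq> {A \<in> Pow X. A \<inter> T = S}" using assms by auto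
  moreover have "inj_on ((\<union>) S) (Pow (X - T))" using assms by (auto simp: inj_on_def)
  ultimately have "card (Pow (X - T)) \<le> card {A \<in> Pow X. A \<inter> T = S}"
    using assms(1) by (intro card_inj_on_le) auto
  then have le: "2 ^ (card X - card T) \<le> card {A \<in> Pow X. A \<inter> T = S}"
    using assms finite_subset[OF assms(2)] by (simp add: card_Pow card_Diff_subset)
  have "(2::nat) ^ card X = 2 ^ card T * 2 ^ (card X - card T)"
    using card_mono[OF assms(1,2)] by (simp flip: power_add)
  then show ?thesis using le by simp
qed

lemma sum_Pow_insert:
  assumes "finite X" "x \<notin> X"
  shows "(\<Sum>A\<in>Pow (insert x X). F A) = (\<Sum>A\<in>Pow X. F A + F (insert x A) :: 'a :: comm_monoid_add)"
proof -
  have inj: "inj_on (insert x) (Pow X)" using assms by (auto simp: inj_on_def)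
  have "(\<Sum>A\<in>Pow (insert x X). F A) = (\<Sum>A\<in>Pow X. F A) + (\<Sum>A\<in>insert x ` Pow X. F A)"
    unfolding Pow_insert using assms by (intro sum.union_disjoint) auto
  then show ?thesis by (simp add: sum.reindex[OF inj] sum.distrib)
qed

text \<open>The variance of a sum of independent signs. A new element of T replaces the deviation u
  by u - 1 and u + 1, whose squares add up to 2 u^2 + 2.\<close>

lemma sum_squared_deviation:
  assumes "finite X"
  shows "(\<Sum>A\<in>Pow X. (2 * real (card (A \<inter> T)) - real (card (X \<inter> T)))\<^sup>2) = 2 ^ card X * real (card (X \<inter> T))"
  using assms
proof (induction X)
  case (insert x X)
  have fin: "finite (A \<inter> T)" if "A \<in> Pow X" for A
    using that insert.hyps(1) finite_subset by blast
  show ?case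
  proof (cases "x \<in> T")
    case True
    have "(\<Sum>A\<in>Pow (insert x X). (2 * real (card (A \<inter> T)) - real (card (insert x X \<inter> T)))\<^sup>2)
      = (\<Sum>A\<in>Pow X. (2 * real (card (A \<inter> T)) - real (card (insert x X \<inter> T)))\<^sup>2
          + (2 * real (card (insert x A \<inter> T)) - real (card (insert x X \<inter> T)))\<^sup>2)"
      by (rule sum_Pow_insert[OF insert.hyps])
    also have "\<dots> = (\<Sum>A\<in>Pow X. 2 * (2 * real (card (A \<inter> T)) - real (card (X \<inter> T)))\<^sup>2 + 2)"
    proof (intro sum.cong refl)
      fix A assume A: "A \<in> Pow X"
      then have "x \<notin> A" using insert.hyps by auto
      then have "card (insert x A \<inter> T) = Suc (card (A \<inter> T))" "card (insert x X \<inter> T) = Suc (card (X \<inter> T))"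
        using True fin[OF A] insert.hyps by simp_all
      then show "(2 * real (card (A \<inter> T)) - real (card (insert x X \<inter> T)))\<^sup>2
          + (2 * real (card (insert x A \<inter> T)) - real (card (insert x X \<inter> T)))\<^sup>2
        = 2 * (2 * real (card (A \<inter> T)) - real (card (X \<inter> T)))\<^sup>2 + 2"
        by (simp add: power2_eq_square algebra_simps)
    qed
    also have "\<dots> = 2 * (2 ^ card X * real (card (X \<inter> T))) + 2 * 2 ^ card X"
      using insert.hyps by (simp add: sum.distrib card_Pow insert.IH flip: sum_distrib_left)
    finally show ?thesis using True insert.hyps by (simp add: algebra_simps)
  next
    case False
    then have "insert x A \<inter> T = A \<inter> T" for A by auto
    then show ?thesis using insert.hyps
      by (simp add: sum_Pow_insert insert.IH flip: mult_2 sum_distrib_left)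
  qed
qed simp

text \<open>Chebyshev's inequality: the variance is card T, so a relative deviation above \<epsilon>
  has probability at most 1/(\<epsilon>^2 card T), and this is at most 1/3.\<close>

lemma card_balanced_subsets:
  fixes \<epsilon> :: real
  assumes X: "finite X" and T: "T \<subseteq> X" and \<epsilon>: "\<epsilon> > 0" "3 \<le> \<epsilon>\<^sup>2 * real (card T)"
  shows "2 / 3 * 2 ^ card X \<le> real (card {A \<in> Pow X. \<bar>2 * real (card (A \<inter> T)) - real (card T)\<bar> \<le> \<epsilon> * real (card T)})"
proof -
  let ?u = "\<lambda>A. 2 * real (card (A \<inter> T)) - real (card T)"
  define bad where "bad = {A \<in> Pow X. \<not> \<bar>?u A\<bar> \<le> \<epsilon> * real (card T)}"
  have XT: "X \<inter> T = T" using T by auto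
  have n: "card T > 0" using \<epsilon> by (cases "card T = 0") auto
  have "real (card bad) * (\<epsilon> * real (card T))\<^sup>2 = (\<Sum>A\<in>bad. (\<epsilon> * real (card T))\<^sup>2)" by simp
  also have "\<dots> \<le> (\<Sum>A\<in>bad. (?u A)\<^sup>2)"
  proof (intro sum_mono)
    fix A assume "A \<in> bad"
    then have "\<epsilon> * real (card T) \<le> \<bar>?u A\<bar>" by (auto simp: bad_def)
    then show "(\<epsilon> * real (card T))\<^sup>2 \<le> (?u A)\<^sup>2"
      using \<epsilon> by (metis abs_ge_zero abs_le_square_iff abs_of_nonneg less_eq_real_def mult_nonneg_nonneg of_nat_0_le_iff)
  qed
  also have "\<dots> \<le> (\<Sum>A\<in>Pow X. (?u A)\<^sup>2)"
    using X by (intro sum_mono2) (auto simp: bad_def)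
  also have "\<dots> = 2 ^ card X * real (card T)"
    using sum_squared_deviation[OF X, of T] by (simp add: XT)
  finally have "real (card T) * (real (card bad) * (\<epsilon>\<^sup>2 * real (card T))) \<le> real (card T) * 2 ^ card X"
    by (simp add: power2_eq_square mult_ac)
  then have "real (card bad) * (\<epsilon>\<^sup>2 * real (card T)) \<le> 2 ^ card X" using n by simp
  moreover have "real (card bad) * 3 \<le> real (card bad) * (\<epsilon>\<^sup>2 * real (card T))"
    using \<epsilon> by (intro mult_left_mono) auto
  ultimately have bad: "real (card bad) * 3 \<le> 2 ^ card X" by linarith
  have "card (Pow X) = card {A \<in> Pow X. \<bar>?u A\<bar> \<le> \<epsilon> * real (card T)} + card bad"
    using X by (subst card_Un_disjoint[symmetric]) (auto simp: bad_def intro!: arg_cong[where f=card])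
  then have "2 ^ card X = real (card {A \<in> Pow X. \<bar>?u A\<bar> \<le> \<epsilon> * real (card T)}) + real (card bad)"
    using X by (simp add: card_Pow flip: of_nat_add)
  then show ?thesis using bad by linarith
qed

section \<open>Raising the level by one, and doubling it\<close>

lemma interaction_order_mask_Compl:
  "interaction_order N (mask_index N (- A) \<alpha>) = interaction_order N \<alpha> - interaction_order N (mask_index N A \<alpha>)"
  using interaction_order_split[of N \<alpha> A] by simp

lemma level_bound_mono:
  assumes "level_bound K N d k D" "0 < D" "D \<le> D'" "k' \<le> k"
  shows "level_bound K N d k' D'"
  unfolding level_bound_def
proof (intro allI impI)
  fix c assume c: "bounded_poly K N d c"
  let ?s = "interaction_order N"
  have "(\<Sum>\<alpha>\<in>{\<alpha> \<in> multi_indices K N. 1 \<le> ?s \<alpha> \<and> ?s \<alpha> \<le> k'}. (cmod (c \<alpha>) / D') powr bh_exponent (?s \<alpha>))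
    \<le> (\<Sum>\<alpha>\<in>{\<alpha> \<in> multi_indices K N. 1 \<le> ?s \<alpha> \<and> ?s \<alpha> \<le> k'}. (cmod (c \<alpha>) / D) powr bh_exponent (?s \<alpha>))"
    using assms bh_exponent_pos
    by (intro sum_mono powr_mono2 divide_left_mono) (auto simp: less_imp_le)
  also have "\<dots> \<le> (\<Sum>\<alpha>\<in>{\<alpha> \<in> multi_indices K N. 1 \<le> ?s \<alpha> \<and> ?s \<alpha> \<le> k}. (cmod (c \<alpha>) / D) powr bh_exponent (?s \<alpha>))"
    using assms by (intro sum_mono2) auto
  also have "\<dots> \<le> 1" by (rule level_boundD[OF assms(1) c])
  finally show "(\<Sum>\<alpha>\<in>{\<alpha> \<in> multi_indices K N. 1 \<le> ?s \<alpha> \<and> ?s \<alpha> \<le> k'}. (cmod (c \<alpha>) / D') powr bh_exponent (?s \<alpha>)) \<le> 1" .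
qed

text \<open>A wasteful step for boundedly many levels: a single prescribed trace on the support, of
  probability at least 2^-(k+1), already counts as a good split. With \<tau> = \<tau>' = 1 this
  gives the factor 3 * 2^(k+1) + 1.\<close>

lemma level_bound_Suc:
  assumes K: "K \<ge> 2" and k: "1 \<le> k" "3 \<le> k \<or> d \<le> 3" and D: "D > 0" and lev: "level_bound K N d k D"
  shows "level_bound K N d (Suc k) ((3 * 2 ^ Suc k + 1) * (bonami_const K powr (2 * real (max 3 k)) * D))"
proof (rule level_bound_extend[OF K _ D lev])
  show "(0::real) \<le> 1" "(0::real) \<le> 1" "(0::real) < 1 / 2 ^ Suc k" by simp_all
  show "1 \<le> 1 * real (k + 2)" by simp
  show "1 \<le> real (max 3 k)" by simp
  show "(1::real) \<le> 3 * 2 ^ Suc k + 1" by simp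
  show "(2 * 1 + 1) / (1 / 2 ^ Suc k) + 1 / 4 \<le> (3 * 2 ^ Suc k + 1 :: real)" by simp
  fix \<alpha> assume \<alpha>: "\<alpha> \<in> multi_indices K N" "k < interaction_order N \<alpha>" "interaction_order N \<alpha> \<le> Suc k"
  define T where "T = {j. j < N \<and> \<alpha> j \<noteq> 0}"
  have ord: "interaction_order N \<alpha> = card T" by (simp add: T_def interaction_order_def)
  then have card_T: "card T = Suc k" using \<alpha> by simp
  \<comment> \<open>For k >= 3 the halves have orders 2 and k - 1, both at least 2. For smaller k a
    half of order 1 is unavoidable; there d <= 3, and the ratio bound \<open>max 3 k\<close> is at
    least d.\<close>
  define a where "a = (if 3 \<le> k then 2 else 1::nat)"
  have a: "1 \<le> a" "a \<le> k" using k by (auto simp: a_def)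
  then obtain S where S: "S \<subseteq> T" "card S = a"
    using card_T obtain_subset_with_card_n[of a T] by auto
  have bal: "balanced_split d k (real (max 3 k)) 1 a (Suc k - a)"
  proof -
    have "3 * 2 \<le> real k * (real k - 1)" if "3 \<le> k" using that by (intro mult_mono) auto
    then show ?thesis using k unfolding balanced_split_def a_def by (auto simp: of_nat_diff max_def)
  qed
  have "2 ^ card {..<N} \<le> 2 ^ card T * card {A \<in> Pow {..<N}. A \<inter> T = S}"
    using S by (intro card_subsets_with_trace) (auto simp: T_def)
  also have "\<dots> \<le> 2 ^ card T * card {A \<in> Pow {..<N}. balanced_split d k (real (max 3 k)) 1
        (interaction_order N (mask_index N A \<alpha>)) (interaction_order N (mask_index N (- A) \<alpha>))}"
  proof (intro mult_left_mono card_mono)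
    show "{A \<in> Pow {..<N}. A \<inter> T = S} \<subseteq> {A \<in> Pow {..<N}. balanced_split d k (real (max 3 k)) 1
        (interaction_order N (mask_index N A \<alpha>)) (interaction_order N (mask_index N (- A) \<alpha>))}"
      using S bal card_T unfolding interaction_order_mask_Compl unfolding interaction_order_mask T_def[symmetric] ord
      by auto
  qed auto
  finally have "real (2 ^ N) \<le> real (2 ^ Suc k * card {A \<in> Pow {..<N}. balanced_split d k (real (max 3 k)) 1
        (interaction_order N (mask_index N A \<alpha>)) (interaction_order N (mask_index N (- A) \<alpha>))})"
    unfolding card_T card_lessThan of_nat_le_iff .
  then show "1 / 2 ^ Suc k * 2 ^ N \<le> real (card {A \<in> Pow {..<N}. balanced_split d k (real (max 3 k)) 1
        (interaction_order N (mask_index N A \<alpha>)) (interaction_order N (mask_index N (- A) \<alpha>))})"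
    by (simp add: divide_le_eq mult_ac)
qed

text \<open>The threshold comes from Chebyshev's inequality with relative deviation 1/41: it bounds the
  probability of an unbalanced split by $41^2 / 5043 = 1/3$.\<close>

lemma level_bound_double:
  assumes K: "K \<ge> 2" and k: "5043 \<le> k" "21 * k' \<le> 41 * k" and D: "D > 0" and lev: "level_bound K N d k D"
  shows "level_bound K N d k' (2 * (bonami_const K powr (21 / 10) * D))"
proof -
  have "level_bound K N d k' (2 * (bonami_const K powr (2 * (21 / 20)) * D))"
  proof (rule level_bound_extend[OF K _ D lev])
    show "(0::real) \<le> 21 / 41" "(0::real) \<le> 1 / 10" "(0::real) < 2 / 3" by simp_all
    show "1 \<le> 1 / 10 * real (k + 2)" using k by simp
    show "(1::real) \<le> 21 / 20" "(1::real) \<le> 2" by simp_all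
    \<comment> \<open>The left side is about 1.937. Without two weights near 1/2 and a probability
      well above 1/2 the factor per doubling would exceed 2.\<close>
    show "(2 * (21 / 41) + 1 / 10) / (2 / 3) + 1 / 4 \<le> (2 :: real)" by simp
    fix \<alpha> assume \<alpha>: "\<alpha> \<in> multi_indices K N" "k < interaction_order N \<alpha>" "interaction_order N \<alpha> \<le> k'"
    define T where "T = {j. j < N \<and> \<alpha> j \<noteq> 0}"
    define n where "n = card T"
    have ord: "interaction_order N \<alpha> = card T" by (simp add: T_def interaction_order_def)
    then have n: "k < n" "n \<le> k'" using \<alpha> by (simp_all add: n_def)
    have "2 / 3 * 2 ^ card {..<N} \<le> real (card {A \<in> Pow {..<N}. \<bar>2 * real (card (A \<inter> T)) - real (card T)\<bar> \<le> 1 / 41 * real (card T)})"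
    proof (rule card_balanced_subsets)
      show "3 \<le> (1 / 41)\<^sup>2 * real (card T)" using n k by (simp add: n_def power2_eq_square)
    qed (auto simp: T_def)
    also have "\<dots> \<le> real (card {A \<in> Pow {..<N}. balanced_split d k (21 / 20) (21 / 41)
        (interaction_order N (mask_index N A \<alpha>)) (interaction_order N (mask_index N (- A) \<alpha>))})"
    proof (intro of_nat_mono card_mono)
      have "balanced_split d k (21 / 20) (21 / 41)
        (interaction_order N (mask_index N A \<alpha>)) (interaction_order N (mask_index N (- A) \<alpha>))"
        if A: "\<bar>2 * real (card (A \<inter> T)) - real (card T)\<bar> \<le> 1 / 41 * real (card T)" for A
      proof -
        define a b where "a = card (A \<inter> T)" and "b = n - a"
        have "a \<le> n" unfolding a_def n_def T_def by (intro card_mono) auto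
        then have ab: "real n = real a + real b" by (simp add: b_def of_nat_diff)
        have dev: "\<bar>2 * real a - real n\<bar> \<le> real n / 41" using A by (simp add: a_def n_def)
        have n21: "21 * real n \<le> 41 * real k"
        proof -
          have "21 * n \<le> 41 * k" using n k by linarith
          then show ?thesis by linarith
        qed
        have n5: "5043 \<le> real n" using n k by linarith
        \<comment> \<open>Relative deviation 1/41 places both halves between 20/41 and 21/41 of n.
          This explains the ratio 21/20, the weight 21/41, and the condition 21 k' <= 41 k, which
          keeps both halves at most k.\<close>
        have a1: "real a \<le> 21 / 41 * real n" "real b \<le> 21 / 41 * real n"
          and a2: "20 / 41 * real n \<le> real a" "20 / 41 * real n \<le> real b"
          using dev ab by linarith+
        have "real a \<le> real k" "real b \<le> real k" "2 \<le> real a" "2 \<le> real b"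
          using a1 a2 n21 n5 by linarith+
        then have "a \<le> k" "b \<le> k" "2 \<le> a" "2 \<le> b" by linarith+
        moreover have "real b \<le> 21 / 20 * real a" "real a \<le> 21 / 20 * real b"
          using a1 a2 by linarith+
        moreover have "real a \<le> 21 / 41 * real (a + b + 1)" "real b \<le> 21 / 41 * real (a + b + 1)"
          using a1 ab by simp_all
        ultimately have "balanced_split d k (21 / 20) (21 / 41) a b"
          by (auto simp: balanced_split_def)
        then show ?thesis
          unfolding interaction_order_mask_Compl unfolding interaction_order_mask T_def[symmetric] ord
          by (simp add: a_def b_def n_def)
      qed
      then show "{A \<in> Pow {..<N}. \<bar>2 * real (card (A \<inter> T)) - real (card T)\<bar> \<le> 1 / 41 * real (card T)}
        \<subseteq> {A \<in> Pow {..<N}. balanced_split d k (21 / 20) (21 / 41)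
        (interaction_order N (mask_index N A \<alpha>)) (interaction_order N (mask_index N (- A) \<alpha>))}" by blast
    qed auto
    finally show "2 / 3 * 2 ^ N \<le> real (card {A \<in> Pow {..<N}. balanced_split d k (21 / 20) (21 / 41)
        (interaction_order N (mask_index N A \<alpha>)) (interaction_order N (mask_index N (- A) \<alpha>))})" by simp
  qed
  then show ?thesis by simp
qed

text \<open>Repeated one-level steps. The constant depends on n and K only, and bridges the gap
  between level 3 and the threshold of the doubling step.\<close>

lemma level_bound_constant:
  assumes K: "K \<ge> 2"
  shows "\<exists>C\<ge>1. \<forall>N d D. 0 < D \<longrightarrow> level_bound K N d 3 D \<longrightarrow> level_bound K N d (n + 3) (C * D)"
proof (induction n)
  case 0
  show ?case by (rule exI[of _ 1]) simp
next
  case (Suc n)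
  then obtain C where C: "C \<ge> 1"
    "\<And>N d D. 0 < D \<Longrightarrow> level_bound K N d 3 D \<Longrightarrow> level_bound K N d (n + 3) (C * D)" by blast
  define B where "B = (3 * 2 ^ Suc (n + 3) + 1) * (bonami_const K powr (2 * real (max 3 (n + 3))))"
  have "1 \<le> bonami_const K powr (2 * real (max 3 (n + 3)))"
    using bonami_const_ge[of K] by (intro ge_one_powr_ge_zero) auto
  then have "1 * 1 \<le> B" unfolding B_def by (intro mult_mono) auto
  then have B: "1 \<le> B" by simp
  show ?case
  proof (intro exI[of _ "B * C"] conjI allI impI)
    show "1 \<le> B * C" using B C(1) mult_mono[of 1 B 1 C] by simp
    fix N d D assume "0 < D" "level_bound K N d 3 D"
    then have "level_bound K N d (Suc (n + 3)) (B * (C * D))"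
      using level_bound_Suc[OF K, of "n + 3" d "C * D" N] C(1) C(2)[of D N d]
      by (simp add: B_def mult.assoc del: power_Suc)
    then show "level_bound K N d (Suc n + 3) (B * C * D)" by (simp add: mult.assoc)
  qed
qed

text \<open>The doubling step divides the level by almost 41/21; replacing this by 39/20 in the exponent
  absorbs the rounding.\<close>

lemma level_bound_growth:
  assumes K: "K \<ge> 2" and E: "0 \<le> E" "2 * bonami_const K powr (21 / 10) \<le> (39 / 20) powr E"
  shows "\<exists>C\<ge>1. \<forall>N d D n. 0 < D \<longrightarrow> level_bound K N d 3 D \<longrightarrow> 1 \<le> n \<longrightarrow> level_bound K N d n (C * D * real n powr E)"
proof -
  obtain C where C: "C \<ge> 1"
    "\<And>N d D. 0 < D \<Longrightarrow> level_bound K N d 3 D \<Longrightarrow> level_bound K N d (10000 + 3) (C * D)"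
    using level_bound_constant[OF K, of 10000] by blast
  have "level_bound K N d n (C * D * real n powr E)"
    if D: "0 < D" and lev: "level_bound K N d 3 D" and n: "1 \<le> n" for N d D n
    using n
  proof (induction n rule: less_induct)
    case (less n)
    have CD: "0 < C * D" using C(1) D by simp
    show ?case
    proof (cases "n \<le> 10003")
      case True
      have "1 \<le> real n powr E" using less.prems E by (intro ge_one_powr_ge_zero) auto
      then have "C * D * 1 \<le> C * D * real n powr E" using CD by (intro mult_left_mono) auto
      then show ?thesis using level_bound_mono[OF C(2)[OF D lev] CD] True by simp
    next
      case False
      \<comment> \<open>Here q is 21 n / 41 rounded down, and k = q + 1 satisfies 21 n <= 41 k. As
        39 * 21 / 41 < 20, the extra 1 is absorbed in 39 k <= 20 n for n > 10003, where k is also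
        above the doubling threshold.\<close>
      obtain q where q: "41 * q \<le> 21 * n" "21 * n < 41 * q + 41"
        using that[of "(21 * n) div 41"] mult_div_mod_eq[of 41 "21 * n"] mod_less_divisor[of 41 "21 * n"]
        by force
      define k where "k = q + 1"
      have k: "21 * n \<le> 41 * k" "k < n" "5043 \<le> k" "39 * k \<le> 20 * n"
        using False q k_def by linarith+
      have "0 < real k powr E" using k by simp
      with CD have pos: "0 < C * D * real k powr E" by (rule mult_pos_pos)
      have "level_bound K N d k (C * D * real k powr E)" using less.IH[of k] k by simp
      then have *: "level_bound K N d n (2 * (bonami_const K powr (21 / 10) * (C * D * real k powr E)))"
        using level_bound_double[OF K, of k n] k pos by blast
      have "2 * bonami_const K powr (21 / 10) * real k powr E \<le> (39 / 20) powr E * real k powr E"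
        using E by (intro mult_right_mono) auto
      also have "\<dots> = (39 / 20 * real k) powr E" by (subst powr_mult) auto
      also have "\<dots> \<le> real n powr E"
      proof (rule powr_mono2[OF E(1)])
        have "39 * real k \<le> 20 * real n" using k(4) by linarith
        then show "39 / 20 * real k \<le> real n" by simp
      qed simp
      finally have "C * D * (2 * bonami_const K powr (21 / 10) * real k powr E) \<le> C * D * real n powr E"
        using CD by (intro mult_left_mono) auto
      then have le: "2 * (bonami_const K powr (21 / 10) * (C * D * real k powr E)) \<le> C * D * real n powr E"
        by (simp add: mult_ac)
      have "0 < bonami_const K powr (21 / 10)" using bonami_const_ge[of K] by simp
      then have "0 < 2 * (bonami_const K powr (21 / 10) * (C * D * real k powr E))"
        using mult_pos_pos[OF _ pos] by simp
      then show ?thesis using level_bound_mono[OF * _ le] by simp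
    qed
  qed
  then show ?thesis using C(1) by blast
qed

section \<open>The cost of doubling compared with the exponent\<close>

lemma four_bh_gamma:
  assumes "K \<ge> 3"
  shows "4 * bh_gamma K = real K * ln (real K - 1) / (real K - 2)"
  using assms by (simp add: bh_gamma_def field_simps)

text \<open>Up to K = 6 one has 3 (K - 1) <= 16, so that \<open>bonami_const K\<close> is 2 and this
  crude bound on gamma_K suffices. Equality holds at K = 2.\<close>

lemma four_bh_gamma_ge_2:
  assumes "2 \<le> K" "K \<le> 6"
  shows "4 * bh_gamma K \<ge> 2"
proof -
  have ln2: "ln 2 \<ge> (2 / 3 :: real)" by (rule ln2_ge_two_thirds)
  have ln3: "ln 3 \<ge> (1 :: real)" using exp_le by (simp add: ln_ge_iff)
  have "ln 4 = 2 * ln (2 :: real)" using ln_realpow[of 2 2] by simp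
  then have ln4: "ln 4 \<ge> (4 / 3 :: real)" using ln2 by linarith
  have "ln 4 \<le> ln (5 :: real)" by simp
  then have ln5: "ln 5 \<ge> (4 / 3 :: real)" using ln4 by linarith
  have "K = 2 \<or> K = 3 \<or> K = 4 \<or> K = 5 \<or> K = 6" using assms by linarith
  then show ?thesis using ln2 ln3 ln4 ln5 by (auto simp: bh_gamma_def)
qed

text \<open>For K <= 6 the left side is 2^3.1, below (39/20)^4. For larger K the power of K - 1 on
  the left is 21/40, less than ln (39/20), and (39/20) powr ln (K - 1) is covered by 4 gamma_K >= ln
  (K - 1); the additional 2 in the exponent pays for the numerical factors.\<close>

lemma growth_factor_le:
  assumes K: "K \<ge> 2"
  shows "2 * bonami_const K powr (21 / 10) \<le> (39 / 20) powr (4 * bh_gamma K + 2)"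
proof (cases "K \<le> 6")
  case True
  have "(3 * (real K - 1)) powr (1 / 4) \<le> 16 powr (1 / 4)"
    using True K by (intro powr_mono2) auto
  also have "16 powr (1 / 4) = (2 powr 4) powr (1 / 4 :: real)" by simp
  also have "\<dots> = 2" unfolding powr_powr by simp
  finally have "bonami_const K = 2" by (simp add: bonami_const_def)
  then have "2 * bonami_const K powr (21 / 10) = 2 powr 1 * 2 powr (21 / 10)" by simp
  also have "\<dots> = 2 powr (1 + 21 / 10)" by (simp only: powr_add)
  also have "\<dots> \<le> 2 powr (7 / 2)" by (intro powr_mono) auto
  also have "\<dots> \<le> (39 / 20) powr 4"
  proof (rule power2_le_imp_le)
    have "(2 powr (7 / 2))\<^sup>2 = (2 powr 7 :: real)" by (simp add: power2_eq_square flip: powr_add)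
    then show "(2 powr (7 / 2))\<^sup>2 \<le> ((39 / 20) powr 4 :: real)\<^sup>2" by (simp add: power_divide)
  qed simp
  also have "\<dots> \<le> (39 / 20) powr (4 * bh_gamma K + 2)"
    using four_bh_gamma_ge_2[OF K True] by (intro powr_mono) auto
  finally show ?thesis .
next
  case False
  define m where "m = real K - 1"
  have m: "m \<ge> 6" using False by (simp add: m_def)
  have "16 powr (1 / 4) = (2 powr 4) powr (1 / 4 :: real)" by simp
  also have "\<dots> = 2" unfolding powr_powr by simp
  finally have "2 \<le> (3 * m) powr (1 / 4)" using m powr_mono2[of "1 / 4" 16 "3 * m"] by simp
  then have A: "bonami_const K = (3 * m) powr (1 / 4)" by (simp add: bonami_const_def m_def)
  \<comment> \<open>Rounding the exponent up to 11/20 reduces the estimate to the integer powers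
    3^11 <= (19/10)^20.\<close>
  have "3 powr (21 / 40) \<le> (3 powr (11 / 20) :: real)" by (intro powr_mono) auto
  also have "\<dots> \<le> 19 / 10"
  proof -
    have "(3 powr (11 / 20)) ^ 20 = (3 powr 11 :: real)" by (simp add: powr_power)
    also have "\<dots> \<le> (19 / 10) ^ 20" by (simp add: power_divide)
    finally show ?thesis by (subst (asm) power_mono_iff) auto
  qed
  finally have three: "3 powr (21 / 40) \<le> (19 / 10 :: real)" .
  \<comment> \<open>The bound ln x >= 1 - 1/x is too weak at 39/20 itself, where it gives 0.487. It
    is applied near the square root, 1.396, and doubled.\<close>
  have ln39: "21 / 40 \<le> ln (39 / 20 :: real)"
  proof -
    have "21 / 40 \<le> 2 * (1 - inverse (1396 / 1000 :: real))" by simp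
    also have "\<dots> \<le> 2 * ln (1396 / 1000)"
      using ln_le_minus_one[of "inverse (1396 / 1000 :: real)"] by (simp add: ln_inverse ln_div)
    also have "\<dots> = ln ((1396 / 1000)\<^sup>2)" by (simp add: ln_realpow)
    also have "\<dots> \<le> ln (39 / 20)" by (simp add: power2_eq_square)
    finally show ?thesis .
  qed
  have "2 * bonami_const K powr (21 / 10) = 2 * 3 powr (21 / 40) * m powr (21 / 40)"
    using m by (simp add: A powr_powr powr_mult)
  also have "\<dots> \<le> 2 * (19 / 10) * m powr ln (39 / 20)"
    using three ln39 m by (intro mult_mono powr_mono) auto
  \<comment> \<open>A narrow margin: 2 * 1.9 = 3.8 against 1.95^2 = 3.8025.\<close>
  also have "\<dots> \<le> (39 / 20) powr 2 * m powr ln (39 / 20)"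
    by (intro mult_right_mono) (auto simp: power2_eq_square)
  also have "m powr ln (39 / 20) = (39 / 20) powr ln m"
    using m by (simp add: powr_def mult.commute)
  also have "(39 / 20) powr 2 * (39 / 20) powr ln m = (39 / 20) powr (2 + ln m)"
    by (simp only: powr_add)
  also have "\<dots> \<le> (39 / 20) powr (4 * bh_gamma K + 2)"
  proof (intro powr_mono)
    have "ln m * (real K - 2) \<le> ln m * real K" using m by (intro mult_left_mono) auto
    then have "ln m \<le> real K * ln m / (real K - 2)"
      using False by (subst pos_le_divide_eq) (auto simp: mult.commute)
    then show "2 + ln m \<le> 4 * bh_gamma K + 2"
      using False by (simp add: four_bh_gamma m_def)
  qed auto
  finally show ?thesis .
qed

section \<open>Low levels\<close>

text \<open>The weights leave mass r at z and spread the mass 1 - r uniformly; the uniform part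
  annihilates every nonconstant power.\<close>

lemma noise_weighted_sum:
  assumes K: "K \<ge> 2" and z: "z \<in> cyclic_set K" and a: "a < K"
  shows "(\<Sum>v\<in>cyclic_set K. of_real ((1 - r) / real K + (if z = v then r else 0)) * v ^ a)
    = (if a = 0 then 1 else of_real r) * z ^ a"
proof -
  have "(\<Sum>v\<in>cyclic_set K. of_real ((1 - r) / real K + (if z = v then r else 0)) * v ^ a)
    = (\<Sum>v\<in>cyclic_set K. of_real ((1 - r) / real K) * (v ^ a * cnj v ^ 0) + (if z = v then of_real r * v ^ a else 0))"
    by (intro sum.cong refl) (simp add: algebra_simps)
  also have "\<dots> = of_real ((1 - r) / real K) * (\<Sum>v\<in>cyclic_set K. v ^ a * cnj v ^ 0) + of_real r * z ^ a"
    using z by (simp add: sum.distrib sum_distrib_left)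
  also have "\<dots> = (if a = 0 then 1 else of_real r) * z ^ a"
  proof -
    have "of_nat K \<noteq> (0 :: complex)" using K by simp
    then show ?thesis using a by (subst cyclic_set_power_orthogonal) (auto simp: field_simps)
  qed
  finally show ?thesis .
qed

text \<open>The noise operator averages with the kernel of a product of random walks; the weights stay
  nonnegative down to the parameter $-1/(K-1)$, which makes 0 an interior point.\<close>

lemma noise_bounded:
  assumes K: "K \<ge> 2" and r: "- 1 \<le> r * (real K - 1)" "r \<le> 1"
    and f: "\<And>x. x \<in> cyclic_cube K N \<Longrightarrow> cmod (trig_poly K N c x) \<le> 1"
    and x: "x \<in> cyclic_cube K N"
  shows "cmod (trig_poly K N (\<lambda>\<alpha>. of_real r ^ interaction_order N \<alpha> * c \<alpha>) x) \<le> 1"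
proof -
  define w where "w u v = (1 - r) / real K + (if u = v then r else 0)" for u v :: complex
  have w0: "0 \<le> w u v" for u v
  proof -
    have "0 \<le> (1 + r * (real K - 1)) / real K" using r K by (intro divide_nonneg_pos) auto
    then have "0 \<le> (1 - r) / real K + r" using K by (simp add: field_simps)
    then show ?thesis using r K by (simp add: w_def)
  qed
  have w1: "(\<Sum>v\<in>cyclic_set K. w z v) = 1" if "z \<in> cyclic_set K" for z
    using noise_weighted_sum[OF K that, of 0 r] K by (simp add: w_def flip: of_real_add of_real_sum)
  have char: "(\<Sum>z\<in>cyclic_cube K N. of_real (\<Prod>j<N. w (x j) (z j)) * character N \<alpha> z)
      = of_real r ^ interaction_order N \<alpha> * character N \<alpha> x" if \<alpha>: "\<alpha> \<in> multi_indices K N" for \<alpha>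
  proof -
    have "(\<Sum>z\<in>cyclic_cube K N. of_real (\<Prod>j<N. w (x j) (z j)) * character N \<alpha> z)
      = (\<Sum>z\<in>cyclic_cube K N. \<Prod>j<N. of_real (w (x j) (z j)) * z j ^ \<alpha> j)"
      by (simp add: character_def prod.distrib)
    also have "\<dots> = (\<Prod>j<N. \<Sum>v\<in>cyclic_set K. of_real (w (x j) v) * v ^ \<alpha> j)"
      by (rule cyclic_cube_sum_prod)
    also have "\<dots> = (\<Prod>j<N. (if \<alpha> j = 0 then 1 else of_real r) * x j ^ \<alpha> j)"
      unfolding w_def
      by (intro prod.cong refl noise_weighted_sum K) (use x \<alpha> in \<open>auto simp: cyclic_cube_mem multi_indices_mem\<close>)
    also have "\<dots> = (\<Prod>j<N. if \<alpha> j = 0 then 1 else of_real r) * character N \<alpha> x"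
      by (simp add: prod.distrib character_def)
    also have "(\<Prod>j<N. if \<alpha> j = 0 then 1 else of_real r :: complex) = of_real r ^ interaction_order N \<alpha>"
      by (simp add: prod.If_cases interaction_order_def Int_def conj_commute)
    finally show ?thesis .
  qed
  have "trig_poly K N (\<lambda>\<alpha>. of_real r ^ interaction_order N \<alpha> * c \<alpha>) x
      = (\<Sum>\<alpha>\<in>multi_indices K N. c \<alpha> * (\<Sum>z\<in>cyclic_cube K N. of_real (\<Prod>j<N. w (x j) (z j)) * character N \<alpha> z))"
    unfolding trig_poly_def by (intro sum.cong refl) (simp only: char, simp only: mult_ac)
  also have "\<dots> = (\<Sum>z\<in>cyclic_cube K N. of_real (\<Prod>j<N. w (x j) (z j)) * trig_poly K N c z)"
    unfolding trig_poly_def sum_distrib_left by (subst sum.swap) (simp add: mult_ac)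
  finally have "cmod (trig_poly K N (\<lambda>\<alpha>. of_real r ^ interaction_order N \<alpha> * c \<alpha>) x)
      \<le> (\<Sum>z\<in>cyclic_cube K N. cmod (of_real (\<Prod>j<N. w (x j) (z j)) * trig_poly K N c z))"
    by (simp only: norm_sum)
  also have "\<dots> \<le> (\<Sum>z\<in>cyclic_cube K N. \<Prod>j<N. w (x j) (z j))"
  proof (intro sum_mono)
    fix z assume z: "z \<in> cyclic_cube K N"
    have "0 \<le> (\<Prod>j<N. w (x j) (z j))" by (intro prod_nonneg) (simp add: w0)
    then show "cmod (of_real (\<Prod>j<N. w (x j) (z j)) * trig_poly K N c z) \<le> (\<Prod>j<N. w (x j) (z j))"
      using f[OF z] by (simp add: norm_mult mult_left_le del: of_real_prod)
  qed
  also have "\<dots> = (\<Prod>j<N. \<Sum>v\<in>cyclic_set K. w (x j) v)"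
    by (rule cyclic_cube_sum_prod)
  also have "\<dots> = 1" by (intro prod.neutral ballI w1) (use x in \<open>auto simp: cyclic_cube_mem\<close>)
  finally show ?thesis .
qed

section \<open>Derivative and coefficient bounds for polynomials bounded on an interval\<close>

lemma poly_eq_sum_atMost:
  fixes p :: "'a :: comm_semiring_1 poly"
  assumes "degree p \<le> n"
  shows "poly p x = (\<Sum>i\<le>n. coeff p i * x ^ i)"
  unfolding poly_altdef using assms by (intro sum.mono_neutral_left) (auto simp: coeff_eq_0)

text \<open>Bernstein's inequality at 1: $q'(1)$ is an average of $q$ over roots of unity against a
  modulated Fejer kernel of mass \<open>n\<close>.\<close>

lemma bernstein_at_1:
  fixes q :: "complex poly"
  assumes deg: "degree q \<le> n" and n: "1 \<le> n" and B: "\<And>w. cmod w = 1 \<Longrightarrow> cmod (poly q w) \<le> B"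
  shows "cmod (poly (pderiv q) 1) \<le> real n * B"
proof -
  \<comment> \<open>All exponents met below are less than 2 n + 1, so summation over M-th roots of
    unity detects their equality and not merely congruence.\<close>
  define M where "M = 2 * n + 1"
  have M: "M > 0" by (simp add: M_def)
  define F where "F w = (\<Sum>l<n. w ^ l)" for w :: complex
  \<comment> \<open>Exactly j pairs (l, m) satisfy j + l = n + m: the shifted Fejer kernel gives the
    coefficient of degree j the weight j, which is its weight in the derivative at 1.\<close>
  have count: "(\<Sum>l<n. \<Sum>m<n. if j + l = n + m then 1 else 0 :: complex) = of_nat j" if j: "j \<le> n" for j
  proof -
    have "(\<Sum>m<n. if j + l = n + m then 1 else 0 :: complex) = (if n \<le> j + l then 1 else 0)" if l: "l < n" for l
    proof (cases "n \<le> j + l")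
      case True
      then have "(j + l = n + m) = (m = j + l - n)" for m by auto
      moreover have "j + l - n < n" using j l by linarith
      ultimately show ?thesis using True by simp
    qed (auto intro: sum.neutral)
    then have "(\<Sum>l<n. \<Sum>m<n. if j + l = n + m then 1 else 0 :: complex) = (\<Sum>l<n. if n \<le> j + l then 1 else 0)"
      by (intro sum.cong) auto
    also have "\<dots> = of_nat (card {l. l < n \<and> n \<le> j + l})"
      by (simp add: sum.If_cases Int_def)
    also have "{l. l < n \<and> n \<le> j + l} = {n - j..<n}" using j by auto
    finally show ?thesis using j by simp
  qed
  have orth: "(\<Sum>w\<in>cyclic_set M. w ^ a * cnj w ^ b) = (if a = b then of_nat M else 0)" if "a < M" "b < M" for a b
    by (rule cyclic_set_power_orthogonal[OF that])
  have "(\<Sum>w\<in>cyclic_set M. poly q w * cnj w ^ n * (F w * cnj (F w)))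
     = (\<Sum>w\<in>cyclic_set M. \<Sum>j\<le>n. \<Sum>l<n. \<Sum>m<n. coeff q j * (w ^ (j + l) * cnj w ^ (n + m)))"
    unfolding poly_eq_sum_atMost[OF deg] F_def cnj_sum sum_product sum_distrib_right
    by (intro sum.cong refl) (simp add: sum_distrib_left power_add mult_ac)
  also have "\<dots> = (\<Sum>j\<le>n. \<Sum>l<n. \<Sum>m<n. coeff q j * (\<Sum>w\<in>cyclic_set M. w ^ (j + l) * cnj w ^ (n + m)))"
    unfolding sum_distrib_left
    by (subst sum.swap, intro sum.cong refl, subst sum.swap, intro sum.cong refl, subst sum.swap, rule refl)
  also have "\<dots> = (\<Sum>j\<le>n. \<Sum>l<n. \<Sum>m<n. coeff q j * (of_nat M * (if j + l = n + m then 1 else 0)))"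
    by (intro sum.cong refl, subst orth) (auto simp: M_def)
  also have "\<dots> = (\<Sum>j\<le>n. coeff q j * of_nat M * of_nat j)"
    by (intro sum.cong refl) (simp add: sum_distrib_left[symmetric] count)
  also have "\<dots> = of_nat M * poly (pderiv q) 1"
  proof -
    have "poly (pderiv q) 1 = (\<Sum>j\<le>n. of_nat j * coeff q j)"
    proof -
      have "poly (pderiv q) 1 = (\<Sum>i\<le>n. coeff (pderiv q) i)"
        using deg by (subst poly_eq_sum_atMost[of _ n]) (auto simp: degree_pderiv)
      also have "\<dots> = (\<Sum>i\<le>n. of_nat (Suc i) * coeff q (Suc i))" by (simp add: coeff_pderiv)
      also have "\<dots> = (\<Sum>j\<le>Suc n. of_nat j * coeff q j)"
        by (subst sum.atMost_Suc_shift) simp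
      also have "\<dots> = (\<Sum>j\<le>n. of_nat j * coeff q j)" using deg by (simp add: coeff_eq_0)
      finally show ?thesis .
    qed
    then show ?thesis by (simp add: sum_distrib_left mult_ac)
  qed
  finally have id: "of_nat M * poly (pderiv q) 1
      = (\<Sum>w\<in>cyclic_set M. poly q w * cnj w ^ n * (F w * cnj (F w)))" ..
  have fejer: "(\<Sum>w\<in>cyclic_set M. (cmod (F w))\<^sup>2) = real M * real n"
  proof -
    have "complex_of_real (\<Sum>w\<in>cyclic_set M. (cmod (F w))\<^sup>2)
       = (\<Sum>w\<in>cyclic_set M. \<Sum>l<n. \<Sum>m<n. w ^ l * cnj w ^ m)"
      unfolding of_real_sum complex_norm_square F_def cnj_sum sum_product by simp
    also have "\<dots> = (\<Sum>l<n. \<Sum>m<n. \<Sum>w\<in>cyclic_set M. w ^ l * cnj w ^ m)"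
      by (subst sum.swap, intro sum.cong refl, subst sum.swap, rule refl)
    also have "\<dots> = (\<Sum>l<n. \<Sum>m<n. if l = m then of_nat M else 0)"
      by (intro sum.cong refl orth) (auto simp: M_def)
    also have "\<dots> = complex_of_real (real M * real n)" by simp
    finally show ?thesis by (simp only: of_real_eq_iff)
  qed
  have "real M * cmod (poly (pderiv q) 1) = cmod (of_nat M * poly (pderiv q) 1)"
    by (simp add: norm_mult)
  also have "\<dots> \<le> (\<Sum>w\<in>cyclic_set M. B * (cmod (F w))\<^sup>2)"
    unfolding id
  proof (intro sum_norm_le)
    fix w assume "w \<in> cyclic_set M"
    then have "cmod w = 1" by (rule norm_cyclic_set)
    then show "cmod (poly q w * cnj w ^ n * (F w * cnj (F w))) \<le> B * (cmod (F w))\<^sup>2"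
      using B[of w] by (simp add: norm_mult norm_power power2_eq_square mult_right_mono)
  qed
  also have "\<dots> = real M * (real n * B)"
    unfolding sum_distrib_left[symmetric] fejer by simp
  finally show ?thesis using M by simp
qed

lemma pderiv_sum: "pderiv (\<Sum>i\<in>I. f i) = (\<Sum>i\<in>I. pderiv (f i))"
  by (induction I rule: infinite_finite_induct) (simp_all add: pderiv_add)

text \<open>Substitute \<open>\<rho> * Im w\<close> for the variable and clear denominators: on the unit circle
  $\mathrm{Im}\, w = (w^2 - 1) / (2 i w)$.\<close>

lemma poly_deriv_at_0_bound:
  fixes \<phi> :: "complex poly"
  assumes deg: "degree \<phi> \<le> d" and d: "1 \<le> d" and \<rho>: "0 < \<rho>"
    and B: "\<And>r. \<bar>r\<bar> \<le> \<rho> \<Longrightarrow> cmod (poly \<phi> (of_real r)) \<le> B"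
  shows "cmod (poly (pderiv \<phi>) 0) \<le> 3 * real d / \<rho> * B"
proof -
  define m where "m = complex_of_real \<rho> / (2 * \<i>)"
  define q where "q = (\<Sum>j\<le>d. smult (coeff \<phi> j * m ^ j) (monom 1 (d - j) * [:-1, 0, 1:] ^ j))"
  have degq: "degree q \<le> 2 * d"
    unfolding q_def
  proof (intro degree_sum_le)
    fix j assume j: "j \<in> {..d}"
    have "degree (monom (1::complex) (d - j) * [:-1, 0, 1:] ^ j) \<le> (d - j) + 2 * j"
      by (intro order_trans[OF degree_mult_le] add_mono degree_monom_le order_trans[OF degree_power_le]) simp
    then show "degree (smult (coeff \<phi> j * m ^ j) (monom 1 (d - j) * [:-1, 0, 1:] ^ j)) \<le> 2 * d"
      using j by (intro order_trans[OF degree_smult_le]) auto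
  qed simp
  have bound: "cmod (poly q w) \<le> B" if w: "cmod w = 1" for w
  proof -
    have "w * cnj w = 1" using w by (simp add: complex_norm_square[symmetric])
    then have "w * (w - cnj w) = w\<^sup>2 - 1" by (simp add: algebra_simps power2_eq_square)
    moreover have "w - cnj w = of_real (2 * Im w) * \<i>" by (rule complex_diff_cnj)
    ultimately have w2: "w\<^sup>2 - 1 = w * (of_real (2 * Im w) * \<i>)" by simp
    have "m * (w\<^sup>2 - 1) = (m * \<i>) * (w * of_real (2 * Im w))"
      unfolding w2 by (simp only: mult_ac)
    also have "m * \<i> = of_real (\<rho> / 2)" by (simp add: m_def complex_eq_iff)
    also have "of_real (\<rho> / 2) * (w * of_real (2 * Im w)) = w * of_real (\<rho> * Im w)" by simp
    finally have "m * (w\<^sup>2 - 1) = w * of_real (\<rho> * Im w)" .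
    then have powers: "m ^ j * (w ^ (d - j) * (w\<^sup>2 - 1) ^ j) = w ^ d * of_real (\<rho> * Im w) ^ j" if "j \<le> d" for j
      using that by (simp add: power_mult_distrib[symmetric] mult.left_commute[of "m ^ j"] del: of_real_mult)
        (simp add: power_mult_distrib mult.assoc[symmetric] flip: power_add)
    have "poly q w = (\<Sum>j\<le>d. coeff \<phi> j * (m ^ j * (w ^ (d - j) * (w\<^sup>2 - 1) ^ j)))"
      unfolding q_def poly_sum by (intro sum.cong refl) (simp add: poly_monom power2_eq_square algebra_simps)
    also have "\<dots> = (\<Sum>j\<le>d. w ^ d * (coeff \<phi> j * of_real (\<rho> * Im w) ^ j))"
      by (intro sum.cong refl) (simp add: powers del: of_real_mult)
    also have "\<dots> = w ^ d * poly \<phi> (of_real (\<rho> * Im w))"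
      by (simp only: poly_eq_sum_atMost[OF deg] sum_distrib_left)
    finally have "cmod (poly q w) = cmod (poly \<phi> (of_real (\<rho> * Im w)))"
      using w by (simp add: norm_mult norm_power)
    also have "\<dots> \<le> B"
      using abs_Im_le_cmod[of w] w \<rho> by (intro B) (simp add: abs_mult)
    finally show ?thesis .
  qed
  \<comment> \<open>The factor w^2 - 1 vanishes at 1, so only the terms j = 0 and j = 1 survive. The
    former is controlled by the value of \<phi> at 0, the latter contains the derivative
    sought.\<close>
  have "poly (pderiv q) 1 = (\<Sum>j\<le>d. coeff \<phi> j * m ^ j * (if j = 0 then of_nat d else if j = 1 then 2 else 0))"
    unfolding q_def pderiv_sum poly_sum
  proof (intro sum.cong refl)
    fix j
    show "poly (pderiv (smult (coeff \<phi> j * m ^ j) (monom 1 (d - j) * [:-1, 0, 1:] ^ j))) 1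
        = coeff \<phi> j * m ^ j * (if j = 0 then of_nat d else if j = 1 then 2 else 0)"
    proof (cases j)
      case 0
      then show ?thesis by (simp add: pderiv_smult pderiv_monom poly_monom)
    next
      case (Suc n)
      obtain P where P: "P = ([:-1, 0, 1:] :: complex poly)" by blast
      then have P1: "poly P 1 = 0" "poly (pderiv P) 1 = 2" by (simp_all add: pderiv_pCons)
      show ?thesis
        unfolding P[symmetric] Suc pderiv_smult pderiv_mult pderiv_power_Suc
        using P1 by (simp add: poly_monom power_0_left)
    qed
  qed
  also have "\<dots> = (\<Sum>j\<in>{0, 1}. coeff \<phi> j * m ^ j * (if j = 0 then of_nat d else if j = 1 then 2 else 0))"
    using d by (intro sum.mono_neutral_right) auto
  also have "\<dots> = of_nat d * coeff \<phi> 0 + 2 * m * coeff \<phi> 1" by simp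
  finally have q1: "2 * m * coeff \<phi> 1 = poly (pderiv q) 1 - of_nat d * coeff \<phi> 0" by simp
  have "\<rho> * cmod (coeff \<phi> 1) = cmod (2 * m * coeff \<phi> 1)"
    using \<rho> by (simp add: m_def norm_mult norm_divide)
  also have "\<dots> \<le> cmod (poly (pderiv q) 1) + cmod (of_nat d * coeff \<phi> 0)"
    unfolding q1 by (rule norm_triangle_ineq4)
  also have "\<dots> \<le> real (2 * d) * B + real d * B"
  proof (intro add_mono)
    show "cmod (poly (pderiv q) 1) \<le> real (2 * d) * B"
      by (rule bernstein_at_1[OF degq _ bound]) (use d in auto)
    show "cmod (of_nat d * coeff \<phi> 0) \<le> real d * B"
      using B[of 0] \<rho> by (simp add: norm_mult poly_0_coeff_0 mult_left_mono)
  qed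
  finally have "\<rho> * cmod (coeff \<phi> 1) \<le> 3 * real d * B" by (simp add: mult_ac)
  moreover have "poly (pderiv \<phi>) 0 = coeff \<phi> 1" by (simp add: poly_0_coeff_0 coeff_pderiv)
  ultimately show ?thesis using \<rho> by (simp add: field_simps)
qed

text \<open>Translation by s: the interval of radius \<rho>/2 around s lies in the original one. A
  bound on a whole interval, not only at 0, is what permits iteration to higher derivatives.\<close>

lemma poly_deriv_interior_bound:
  fixes \<phi> :: "complex poly"
  assumes deg: "degree \<phi> \<le> d" and d: "1 \<le> d" and \<rho>: "0 < \<rho>"
    and B: "\<And>r. \<bar>r\<bar> \<le> \<rho> \<Longrightarrow> cmod (poly \<phi> (of_real r)) \<le> B" and s: "\<bar>s\<bar> \<le> \<rho> / 2"
  shows "cmod (poly (pderiv \<phi>) (of_real s)) \<le> 6 * real d / \<rho> * B"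
proof -
  let ?\<psi> = "pcompose \<phi> [:of_real s, 1:]"
  have "cmod (poly (pderiv ?\<psi>) 0) \<le> 3 * real d / (\<rho> / 2) * B"
  proof (rule poly_deriv_at_0_bound[OF _ d])
    show "degree ?\<psi> \<le> d" using deg degree_pcompose_le[of \<phi> "[:of_real s, 1:]"] by simp
    fix r :: real assume "\<bar>r\<bar> \<le> \<rho> / 2"
    then have "\<bar>s + r\<bar> \<le> \<rho>" using s by linarith
    then show "cmod (poly ?\<psi> (of_real r)) \<le> B" using B[of "s + r"] by (simp add: poly_pcompose)
  qed (use \<rho> in simp)
  moreover have "poly (pderiv ?\<psi>) 0 = poly (pderiv \<phi>) (of_real s)"
    by (simp add: pderiv_pcompose poly_pcompose pderiv_pCons)
  ultimately show ?thesis by simp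
qed

text \<open>Three derivatives on successively halved intervals: the constants are 6, 6 * 12 = 72 and
  72 * 24 = 1728. Because d/\<rho> is at least 1, the cubic bound dominates for all three
  coefficients.\<close>

lemma poly_low_coeff_bound:
  fixes \<phi> :: "complex poly"
  assumes deg: "degree \<phi> \<le> d" and d: "1 \<le> d" and \<rho>: "0 < \<rho>" "\<rho> \<le> 1"
    and B: "\<And>r. \<bar>r\<bar> \<le> \<rho> \<Longrightarrow> cmod (poly \<phi> (of_real r)) \<le> 1"
    and j: "1 \<le> j" "j \<le> 3"
  shows "cmod (coeff \<phi> j) \<le> 1728 * (real d / \<rho>) ^ 3"
proof -
  define t where "t = real d / \<rho>"
  have t: "1 \<le> t" using d \<rho> by (simp add: t_def field_simps)
  have 1: "cmod (poly (pderiv \<phi>) (of_real s)) \<le> 6 * t" if "\<bar>s\<bar> \<le> \<rho> / 2" for s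
    using poly_deriv_interior_bound[OF deg d \<rho>(1) B that] by (simp add: t_def)
  have d2: "degree (pderiv \<phi>) \<le> d" "degree (pderiv (pderiv \<phi>)) \<le> d"
    using deg by (auto simp: degree_pderiv)
  have 2: "cmod (poly (pderiv (pderiv \<phi>)) (of_real s)) \<le> 72 * t\<^sup>2" if "\<bar>s\<bar> \<le> \<rho> / 4" for s
    using poly_deriv_interior_bound[OF d2(1) d _ 1, of "\<rho> / 2"] that \<rho> by (simp add: t_def power2_eq_square)
  have 3: "cmod (poly (pderiv (pderiv (pderiv \<phi>))) (of_real s)) \<le> 1728 * t ^ 3" if "\<bar>s\<bar> \<le> \<rho> / 8" for s
    using poly_deriv_interior_bound[OF d2(2) d _ 2, of "\<rho> / 4"] that \<rho> by (simp add: t_def power2_eq_square power3_eq_cube mult_ac)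
  have c1: "cmod (coeff \<phi> 1) \<le> 6 * t"
    using 1[of 0] \<rho> by (simp add: poly_0_coeff_0 coeff_pderiv)
  have c2: "2 * cmod (coeff \<phi> 2) \<le> 72 * t\<^sup>2"
    using 2[of 0] \<rho> by (simp add: poly_0_coeff_0 coeff_pderiv norm_mult numeral_2_eq_2)
  have c3: "6 * cmod (coeff \<phi> 3) \<le> 1728 * t ^ 3"
    using 3[of 0] \<rho> by (simp add: poly_0_coeff_0 coeff_pderiv norm_mult numeral_3_eq_3)
  have "t \<le> t ^ 3" "t\<^sup>2 \<le> t ^ 3" using t power_increasing[of 1 3 t] power_increasing[of 2 3 t] by auto
  moreover have "j = 1 \<or> j = 2 \<or> j = 3" using j by linarith
  ultimately have "cmod (coeff \<phi> j) \<le> 1728 * t ^ 3"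
    using c1 c2 c3 t norm_ge_zero[of "coeff \<phi> 2"] norm_ge_zero[of "coeff \<phi> 3"] by (elim disjE) (hypsubst, linarith)+
  then show ?thesis by (simp add: t_def)
qed

text \<open>At a fixed point x the noisy function is a polynomial of degree at most d in the noise
  parameter r, bounded by 1 for |r| <= 1/(K - 1). Its coefficient at r^j is the order-j part at
  x.\<close>

lemma level_part_bounded:
  assumes K: "K \<ge> 2" and d: "1 \<le> d" and c: "bounded_poly K N d c" and j: "1 \<le> j" "j \<le> 3"
    and x: "x \<in> cyclic_cube K N"
  shows "cmod (trig_poly K N (\<lambda>\<alpha>. if interaction_order N \<alpha> = j then c \<alpha> else 0) x) \<le> 1728 * (real d * (real K - 1)) ^ 3"
proof -
  define \<phi> where "\<phi> = (\<Sum>\<alpha>\<in>multi_indices K N. monom (c \<alpha> * character N \<alpha> x) (interaction_order N \<alpha>))"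
  have "degree \<phi> \<le> d"
    unfolding \<phi>_def
  proof (intro degree_sum_le)
    fix \<alpha> assume "\<alpha> \<in> multi_indices K N"
    then show "degree (monom (c \<alpha> * character N \<alpha> x) (interaction_order N \<alpha>)) \<le> d"
      using c by (cases "c \<alpha> = 0") (auto simp: bounded_poly_def intro: order_trans[OF degree_monom_le])
  qed simp
  moreover have "cmod (poly \<phi> (of_real r)) \<le> 1" if r: "\<bar>r\<bar> \<le> 1 / (real K - 1)" for r
  proof -
    have "poly \<phi> (of_real r) = trig_poly K N (\<lambda>\<alpha>. of_real r ^ interaction_order N \<alpha> * c \<alpha>) x"
      unfolding \<phi>_def trig_poly_def poly_sum by (intro sum.cong refl) (simp add: poly_monom mult_ac)
    moreover have "- 1 \<le> r * (real K - 1)"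
    proof -
      have "- (1 / (real K - 1)) \<le> r" using r by linarith
      then show ?thesis using K by (simp add: field_simps)
    qed
    moreover have "1 / (real K - 1) \<le> 1" using K by simp
    then have "r \<le> 1" using r by linarith
    ultimately show ?thesis using noise_bounded[OF K, of r N c x] c x by (auto simp: bounded_poly_def)
  qed
  ultimately have "cmod (coeff \<phi> j) \<le> 1728 * (real d / (1 / (real K - 1))) ^ 3"
    using K d j by (intro poly_low_coeff_bound) auto
  moreover have "coeff \<phi> j = trig_poly K N (\<lambda>\<alpha>. if interaction_order N \<alpha> = j then c \<alpha> else 0) x"
    unfolding \<phi>_def trig_poly_def coeff_sum by (intro sum.cong refl) simp
  ultimately show ?thesis by simp
qed

text \<open>The maxima of the separate summands are attained simultaneously by choosing each
  coordinate independently. A mean-zero function on K points has absolute sum at most 2 K times its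
  maximum.\<close>

lemma sum_abs_le_separable:
  fixes \<phi> :: "nat \<Rightarrow> complex \<Rightarrow> real"
  assumes K: "K > 0" and mean: "\<And>j. j < N \<Longrightarrow> (\<Sum>z\<in>cyclic_set K. \<phi> j z) = 0"
    and bd: "\<And>x. x \<in> cyclic_cube K N \<Longrightarrow> (\<Sum>j<N. \<phi> j (x j)) \<le> B"
  shows "(\<Sum>j<N. \<Sum>z\<in>cyclic_set K. \<bar>\<phi> j z\<bar>) \<le> 2 * real K * B"
proof -
  have ne: "cyclic_set K \<noteq> {}" using root_of_unity_in_cyclic_set[OF K] by auto
  have "\<exists>z\<in>cyclic_set K. \<forall>v\<in>cyclic_set K. \<phi> j v \<le> \<phi> j z" for j
  proof -
    have "Max (\<phi> j ` cyclic_set K) \<in> \<phi> j ` cyclic_set K" using ne by (intro Max_in) auto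
    then obtain z where "z \<in> cyclic_set K" "\<phi> j z = Max (\<phi> j ` cyclic_set K)" by auto
    then show ?thesis by (intro bexI[of _ z]) auto
  qed
  then obtain m where m: "\<And>j. m j \<in> cyclic_set K" "\<And>j v. v \<in> cyclic_set K \<Longrightarrow> \<phi> j v \<le> \<phi> j (m j)"
    by metis
  define x where "x = (\<lambda>j\<in>{..<N}. m j)"
  have "x \<in> cyclic_cube K N" using m by (auto simp: x_def cyclic_cube_def)
  then have "(\<Sum>j<N. \<phi> j (m j)) \<le> B" using bd[of x] by (simp add: x_def)
  have "(\<Sum>z\<in>cyclic_set K. \<bar>\<phi> j z\<bar>) \<le> 2 * real K * \<phi> j (m j)" if j: "j < N" for j
  proof -
    have "0 = (\<Sum>z\<in>cyclic_set K. \<phi> j z)" using mean[OF j] by simp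
    also have "\<dots> \<le> (\<Sum>z\<in>cyclic_set K. \<phi> j (m j))" by (intro sum_mono m)
    finally have "0 \<le> real K * \<phi> j (m j)" using K by (simp add: card_cyclic_set)
    then have m0: "0 \<le> \<phi> j (m j)" using K by (simp add: zero_le_mult_iff)
    have "(\<Sum>z\<in>cyclic_set K. \<bar>\<phi> j z\<bar>) \<le> (\<Sum>z\<in>cyclic_set K. 2 * \<phi> j (m j) - \<phi> j z)"
    proof (intro sum_mono)
      fix z assume "z \<in> cyclic_set K"
      then show "\<bar>\<phi> j z\<bar> \<le> 2 * \<phi> j (m j) - \<phi> j z" using m(2)[of z j] m0 by linarith
    qed
    also have "\<dots> = 2 * real K * \<phi> j (m j)"
      using K mean[OF j] by (simp add: sum_subtractf card_cyclic_set)
    finally show ?thesis .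
  qed
  then have "(\<Sum>j<N. \<Sum>z\<in>cyclic_set K. \<bar>\<phi> j z\<bar>) \<le> (\<Sum>j<N. 2 * real K * \<phi> j (m j))"
    by (intro sum_mono) auto
  then have "(\<Sum>j<N. \<Sum>z\<in>cyclic_set K. \<bar>\<phi> j z\<bar>) \<le> 2 * real K * (\<Sum>j<N. \<phi> j (m j))"
    by (simp only: sum_distrib_left)
  moreover have "2 * real K * (\<Sum>j<N. \<phi> j (m j)) \<le> 2 * real K * B"
    using \<open>(\<Sum>j<N. \<phi> j (m j)) \<le> B\<close> by (intro mult_left_mono) auto
  ultimately show ?thesis by linarith
qed

section \<open>Indices of order one and their l^1 bound\<close>

definition single_index :: "nat \<Rightarrow> nat \<Rightarrow> nat \<Rightarrow> nat \<Rightarrow> nat" where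
  "single_index N j a = (\<lambda>i\<in>{..<N}. if i = j then a else 0)"

lemma interaction_order_1_eq_image:
  "{\<alpha> \<in> multi_indices K N. interaction_order N \<alpha> = 1} = (\<lambda>(j, a). single_index N j a) ` ({..<N} \<times> {1..<K})"
proof (intro equalityI subsetI)
  fix \<alpha> assume \<alpha>: "\<alpha> \<in> {\<alpha> \<in> multi_indices K N. interaction_order N \<alpha> = 1}"
  then obtain j where j: "{j. j < N \<and> \<alpha> j \<noteq> 0} = {j}"
    by (auto simp: interaction_order_def card_1_singleton_iff)
  then have "j < N" "\<alpha> j \<noteq> 0" "\<And>i. i < N \<Longrightarrow> i \<noteq> j \<Longrightarrow> \<alpha> i = 0" by blast+
  moreover have "\<alpha> i = undefined" if "\<not> i < N" for i
    using \<alpha> that by (auto simp: multi_indices_def PiE_iff extensional_def)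
  ultimately have "\<alpha> = single_index N j (\<alpha> j)" by (auto simp: single_index_def restrict_def)
  moreover have "\<alpha> j \<in> {1..<K}" using \<alpha> \<open>j < N\<close> \<open>\<alpha> j \<noteq> 0\<close> by (auto simp: multi_indices_mem)
  ultimately show "\<alpha> \<in> (\<lambda>(j, a). single_index N j a) ` ({..<N} \<times> {1..<K})"
    using \<open>j < N\<close> by (intro image_eqI[of _ _ "(j, \<alpha> j)"]) auto
next
  fix \<alpha> assume "\<alpha> \<in> (\<lambda>(j, a). single_index N j a) ` ({..<N} \<times> {1..<K})"
  then obtain j a where ja: "j < N" "1 \<le> a" "a < K" "\<alpha> = single_index N j a" by auto
  then have "{i. i < N \<and> \<alpha> i \<noteq> 0} = {j}" by (auto simp: single_index_def)
  then show "\<alpha> \<in> {\<alpha> \<in> multi_indices K N. interaction_order N \<alpha> = 1}"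
    using ja by (auto simp: interaction_order_def multi_indices_def single_index_def)
qed

lemma inj_single_index: "inj_on (\<lambda>(j, a). single_index N j a) ({..<N} \<times> {1..<K})"
proof (rule inj_onI)
  fix u v
  assume "u \<in> {..<N} \<times> {1..<K}" "v \<in> {..<N} \<times> {1..<K}"
    and eq: "(\<lambda>(j, a). single_index N j a) u = (\<lambda>(j, a). single_index N j a) v"
  moreover obtain j a i b where uv: "u = (j, a)" "v = (i, b)" by fastforce
  ultimately have *: "j \<in> {..<N}" "i \<in> {..<N}" "a \<in> {1..<K}" "b \<in> {1..<K}" "single_index N j a = single_index N i b"
    by auto
  have "a = single_index N i b j" using fun_cong[OF *(5), of j] *(1) by (simp add: single_index_def)
  then have "i = j \<and> a = b" using * by (auto simp: single_index_def split: if_splits)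
  then show "u = v" using uv by simp
qed

lemma sum_interaction_order_1:
  "(\<Sum>\<alpha>\<in>{\<alpha> \<in> multi_indices K N. interaction_order N \<alpha> = 1}. F \<alpha>)
    = (\<Sum>j<N. \<Sum>a\<in>{1..<K}. F (single_index N j a) :: 'a :: comm_monoid_add)"
  unfolding interaction_order_1_eq_image
  by (subst sum.reindex[OF inj_single_index]) (simp add: sum.cartesian_product split_def)

lemma character_single_index:
  assumes "j < N"
  shows "character N (single_index N j a) x = x j ^ a"
proof -
  have "character N (single_index N j a) x = (\<Prod>i<N. if i = j then x i ^ a else 1)"
    unfolding character_def by (intro prod.cong) (auto simp: single_index_def)
  then show ?thesis using assms by simp
qed

text \<open>The order-1 part is a sum of mean-zero functions of one coordinate each, treated through
  real and imaginary parts. An l^1 bound is the right goal since p_1 = 1. The two parts cost 2 K B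
  each; the K - 1 coefficients per coordinate are offset by the factor 1/K in Fourier
  inversion.\<close>

lemma level_1_sum_le:
  assumes K: "K \<ge> 2"
    and bd: "\<And>x. x \<in> cyclic_cube K N \<Longrightarrow> cmod (trig_poly K N (\<lambda>\<alpha>. if interaction_order N \<alpha> = 1 then c \<alpha> else 0) x) \<le> B"
  shows "(\<Sum>\<alpha>\<in>{\<alpha> \<in> multi_indices K N. interaction_order N \<alpha> = 1}. cmod (c \<alpha>)) \<le> 4 * real K * B"
proof -
  define g where "g j z = (\<Sum>a\<in>{1..<K}. c (single_index N j a) * z ^ a)" for j and z :: complex
  have eq: "trig_poly K N (\<lambda>\<alpha>. if interaction_order N \<alpha> = 1 then c \<alpha> else 0) x = (\<Sum>j<N. g j (x j))" for x
  proof -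
    have "trig_poly K N (\<lambda>\<alpha>. if interaction_order N \<alpha> = 1 then c \<alpha> else 0) x
      = (\<Sum>\<alpha>\<in>multi_indices K N. if interaction_order N \<alpha> = 1 then c \<alpha> * character N \<alpha> x else 0)"
      unfolding trig_poly_def by (intro sum.cong) auto
    also have "\<dots> = (\<Sum>\<alpha>\<in>{\<alpha> \<in> multi_indices K N. interaction_order N \<alpha> = 1}. c \<alpha> * character N \<alpha> x)"
      by (simp add: sum.If_cases Int_def)
    also have "\<dots> = (\<Sum>j<N. g j (x j))"
      unfolding sum_interaction_order_1 g_def by (intro sum.cong refl) (simp add: character_single_index)
    finally show ?thesis .
  qed
  have mean: "(\<Sum>z\<in>cyclic_set K. g j z) = 0" for j
  proof -
    have "(\<Sum>z\<in>cyclic_set K. g j z) = (\<Sum>a\<in>{1..<K}. c (single_index N j a) * (\<Sum>z\<in>cyclic_set K. z ^ a * cnj z ^ 0))"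
      unfolding g_def sum_distrib_left by (subst sum.swap) simp
    also have "\<dots> = 0"
      by (intro sum.neutral ballI) (use K in \<open>subst cyclic_set_power_orthogonal, auto\<close>)
    finally show ?thesis .
  qed
  have re: "(\<Sum>j<N. \<Sum>z\<in>cyclic_set K. \<bar>Re (g j z)\<bar>) \<le> 2 * real K * B"
  proof (rule sum_abs_le_separable)
    show "(\<Sum>z\<in>cyclic_set K. Re (g j z)) = 0" for j using mean[of j] by (simp flip: Re_sum)
    show "(\<Sum>j<N. Re (g j (x j))) \<le> B" if "x \<in> cyclic_cube K N" for x
      using order_trans[OF complex_Re_le_cmod bd[OF that]] unfolding eq by simp
  qed (use K in simp)
  have im: "(\<Sum>j<N. \<Sum>z\<in>cyclic_set K. \<bar>Im (g j z)\<bar>) \<le> 2 * real K * B"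
  proof (rule sum_abs_le_separable)
    show "(\<Sum>z\<in>cyclic_set K. Im (g j z)) = 0" for j using mean[of j] by (simp flip: Im_sum)
    show "(\<Sum>j<N. Im (g j (x j))) \<le> B" if "x \<in> cyclic_cube K N" for x
      using order_trans[OF order_trans[OF abs_ge_self abs_Im_le_cmod] bd[OF that]] unfolding eq by simp
  qed (use K in simp)
  have coeff: "real K * cmod (c (single_index N j a)) \<le> (\<Sum>z\<in>cyclic_set K. \<bar>Re (g j z)\<bar> + \<bar>Im (g j z)\<bar>)"
    if a: "a \<in> {1..<K}" for j a
  proof -
    have "(\<Sum>z\<in>cyclic_set K. g j z * cnj z ^ a)
        = (\<Sum>b\<in>{1..<K}. c (single_index N j b) * (\<Sum>z\<in>cyclic_set K. z ^ b * cnj z ^ a))"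
      unfolding g_def sum_distrib_left sum_distrib_right by (subst sum.swap) (simp add: mult_ac)
    also have "\<dots> = (\<Sum>b\<in>{1..<K}. if b = a then of_nat K * c (single_index N j b) else 0)"
      using a by (intro sum.cong refl, subst cyclic_set_power_orthogonal) auto
    also have "\<dots> = of_nat K * c (single_index N j a)" using a by simp
    finally have "real K * cmod (c (single_index N j a)) = cmod (\<Sum>z\<in>cyclic_set K. g j z * cnj z ^ a)"
      by (simp add: norm_mult)
    also have "\<dots> \<le> (\<Sum>z\<in>cyclic_set K. \<bar>Re (g j z)\<bar> + \<bar>Im (g j z)\<bar>)"
    proof (intro sum_norm_le)
      fix z assume "z \<in> cyclic_set K"
      then show "cmod (g j z * cnj z ^ a) \<le> \<bar>Re (g j z)\<bar> + \<bar>Im (g j z)\<bar>"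
        by (simp add: norm_mult norm_power norm_cyclic_set cmod_le)
    qed
    finally show ?thesis .
  qed
  have "real K * (\<Sum>\<alpha>\<in>{\<alpha> \<in> multi_indices K N. interaction_order N \<alpha> = 1}. cmod (c \<alpha>))
      = (\<Sum>j<N. \<Sum>a\<in>{1..<K}. real K * cmod (c (single_index N j a)))"
    unfolding sum_interaction_order_1 by (simp add: sum_distrib_left)
  also have "\<dots> \<le> (\<Sum>j<N. \<Sum>a\<in>{1..<K}. \<Sum>z\<in>cyclic_set K. \<bar>Re (g j z)\<bar> + \<bar>Im (g j z)\<bar>)"
    by (intro sum_mono coeff)
  also have "\<dots> = real (K - 1) * ((\<Sum>j<N. \<Sum>z\<in>cyclic_set K. \<bar>Re (g j z)\<bar>) + (\<Sum>j<N. \<Sum>z\<in>cyclic_set K. \<bar>Im (g j z)\<bar>))"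
    by (simp add: sum.distrib flip: sum_distrib_left)
  also have "\<dots> \<le> real K * (2 * real K * B + 2 * real K * B)"
    using re im by (intro mult_mono add_mono) (auto intro!: add_nonneg_nonneg sum_nonneg)
  finally show ?thesis using K by (simp add: mult_ac)
qed

text \<open>The l^1 bound gives level 1, and two one-level steps follow; these may use halves of
  order 1 because the degree is 3.\<close>

lemma level_bound_degree_3:
  assumes K: "K \<ge> 2"
  shows "\<exists>D>0. \<forall>N. level_bound K N 3 3 D"
proof -
  define D where "D = 4 * real K * (1728 * (3 * (real K - 1)) ^ 3)"
  have D: "D > 0" using K by (simp add: D_def)
  have lev1: "level_bound K N 3 1 D" for N
    unfolding level_bound_def
  proof (intro allI impI)
    fix c assume c: "bounded_poly K N 3 c"
    have "{\<alpha> \<in> multi_indices K N. 1 \<le> interaction_order N \<alpha> \<and> interaction_order N \<alpha> \<le> 1}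
        = {\<alpha> \<in> multi_indices K N. interaction_order N \<alpha> = 1}" by auto
    then have "(\<Sum>\<alpha>\<in>{\<alpha> \<in> multi_indices K N. 1 \<le> interaction_order N \<alpha> \<and> interaction_order N \<alpha> \<le> 1}.
        (cmod (c \<alpha>) / D) powr bh_exponent (interaction_order N \<alpha>))
      = (\<Sum>\<alpha>\<in>{\<alpha> \<in> multi_indices K N. interaction_order N \<alpha> = 1}. cmod (c \<alpha>)) / D"
      using D by (simp add: bh_exponent_def sum_divide_distrib)
    also have "\<dots> \<le> 1"
      using level_1_sum_le[OF K level_part_bounded[OF K _ c, of 1]] D by (simp add: D_def)
    finally show "(\<Sum>\<alpha>\<in>{\<alpha> \<in> multi_indices K N. 1 \<le> interaction_order N \<alpha> \<and> interaction_order N \<alpha> \<le> 1}.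
        (cmod (c \<alpha>) / D) powr bh_exponent (interaction_order N \<alpha>)) \<le> 1" .
  qed
  have A: "bonami_const K > 0" using bonami_const_ge[of K] by simp
  define D2 where "D2 = (3 * 2 ^ Suc 1 + 1) * (bonami_const K powr (2 * real (max 3 1)) * D)"
  define D3 where "D3 = (3 * 2 ^ Suc 2 + 1) * (bonami_const K powr (2 * real (max 3 2)) * D2)"
  have D23: "D2 > 0" "D3 > 0" using A D by (simp_all add: D2_def D3_def)
  have "level_bound K N 3 2 D2" for N
    using level_bound_Suc[OF K _ _ D lev1[of N]] by (simp add: D2_def numeral_2_eq_2)
  then have "level_bound K N 3 (Suc 2) D3" for N
    unfolding D3_def by (intro level_bound_Suc K D23) auto
  then show ?thesis using D23 by (auto simp: numeral_3_eq_3 numeral_2_eq_2)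
qed

text \<open>The claim involves only the orders 1 to 3 of c, so c may be replaced by this part,
  divided by a bound M for its sup norm. The replacement has degree 3 for every d; the dependence on
  d sits entirely in M.\<close>

lemma level_bound_3:
  assumes K: "K \<ge> 2"
  shows "\<exists>D>0. \<forall>N d. 1 \<le> d \<longrightarrow> level_bound K N d 3 (D * real d ^ 3)"
proof -
  obtain D where D: "D > 0" "\<And>N. level_bound K N 3 3 D"
    using level_bound_degree_3[OF K] by blast
  define B where "B = 3 * (1728 * (real K - 1) ^ 3)"
  have B: "B > 0" using K by (simp add: B_def)
  have "level_bound K N d 3 (B * D * real d ^ 3)" if d: "1 \<le> d" for N d
    unfolding level_bound_def
  proof (intro allI impI)
    fix c assume c: "bounded_poly K N d c"
    let ?s = "interaction_order N"
    define M where "M = B * real d ^ 3"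
    have M: "M > 0" using B d by (simp add: M_def)
    define e where "e \<alpha> = (if 1 \<le> ?s \<alpha> \<and> ?s \<alpha> \<le> 3 then c \<alpha> / of_real M else 0)" for \<alpha>
    have "bounded_poly K N 3 e"
      unfolding bounded_poly_def
    proof (intro conjI ballI impI)
      show "?s \<alpha> \<le> 3" if "e \<alpha> \<noteq> 0" for \<alpha> using that by (auto simp: e_def split: if_splits)
      fix x assume x: "x \<in> cyclic_cube K N"
      let ?P = "\<lambda>j. trig_poly K N (\<lambda>\<alpha>. if ?s \<alpha> = j then c \<alpha> else 0) x"
      have "e \<alpha> = (\<Sum>j\<in>{1..3}. if ?s \<alpha> = j then c \<alpha> else 0) / of_real M" for \<alpha>
        by (simp add: e_def)
      then have "trig_poly K N e x = (\<Sum>\<alpha>\<in>multi_indices K N. \<Sum>j\<in>{1..3}. (if ?s \<alpha> = j then c \<alpha> else 0) * character N \<alpha> x / of_real M)"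
        unfolding trig_poly_def by (simp add: sum_distrib_right sum_divide_distrib del: sum.delta sum.delta')
      also have "\<dots> = (\<Sum>j\<in>{1..3}. ?P j) / of_real M"
        unfolding trig_poly_def sum_divide_distrib by (rule sum.swap)
      finally have "cmod (trig_poly K N e x) = cmod (\<Sum>j\<in>{1..3}. ?P j) / M"
        using M by (simp add: norm_divide)
      also have "\<dots> \<le> (\<Sum>j\<in>{1..3::nat}. 1728 * (real d * (real K - 1)) ^ 3) / M"
        using M by (intro divide_right_mono sum_norm_le level_part_bounded[OF K d c _ _ x]) auto
      also have "\<dots> = M / M" by (simp add: M_def B_def power_mult_distrib)
      also have "\<dots> = 1" using M by simp
      finally show "cmod (trig_poly K N e x) \<le> 1" .
    qed
    then have "(\<Sum>\<alpha>\<in>{\<alpha> \<in> multi_indices K N. 1 \<le> ?s \<alpha> \<and> ?s \<alpha> \<le> 3}. (cmod (e \<alpha>) / D) powr bh_exponent (?s \<alpha>)) \<le> 1"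
      by (rule level_boundD[OF D(2)])
    moreover have "cmod (e \<alpha>) / D = cmod (c \<alpha>) / (B * D * real d ^ 3)" if "1 \<le> ?s \<alpha> \<and> ?s \<alpha> \<le> 3" for \<alpha>
    proof -
      have "cmod (e \<alpha>) = cmod (c \<alpha>) / M" using that M by (simp add: e_def norm_divide)
      then show ?thesis by (simp add: M_def mult_ac)
    qed
    ultimately show "(\<Sum>\<alpha>\<in>{\<alpha> \<in> multi_indices K N. 1 \<le> ?s \<alpha> \<and> ?s \<alpha> \<le> 3}.
        (cmod (c \<alpha>) / (B * D * real d ^ 3)) powr bh_exponent (?s \<alpha>)) \<le> 1" by simp
  qed
  then show ?thesis using B D(1) by (intro exI[of _ "B * D"]) auto
qed

text \<open>The powers add up: d^3 from the reduction to degree 3 and 4 gamma_K + 2 from the growth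
  in the level, taken at level d.\<close>

lemma level_bound_polynomial:
  assumes K: "K \<ge> 2"
  shows "\<exists>C\<ge>1. \<forall>N d. 1 \<le> d \<longrightarrow> level_bound K N d d (C * real d powr (4 * bh_gamma K + 5))"
proof -
  let ?E = "4 * bh_gamma K + 2"
  have E: "0 \<le> ?E"
  proof (cases "K \<le> 6")
    case False
    then show ?thesis by (simp add: four_bh_gamma)
  qed (use four_bh_gamma_ge_2[OF K] in linarith)
  obtain C where C: "C \<ge> 1" "\<And>N d D n. 0 < D \<Longrightarrow> level_bound K N d 3 D \<Longrightarrow> 1 \<le> n \<Longrightarrow> level_bound K N d n (C * D * real n powr ?E)"
    using level_bound_growth[OF K E growth_factor_le[OF K]] by blast
  obtain D where D: "D > 0" "\<And>N d. 1 \<le> d \<Longrightarrow> level_bound K N d 3 (D * real d ^ 3)"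
    using level_bound_3[OF K] by blast
  have "level_bound K N d d (max 1 (C * D) * real d powr (4 * bh_gamma K + 5))" if d: "1 \<le> d" for N d
  proof -
    have "real d ^ 3 * real d powr ?E = real d powr (3 + ?E)"
      using d by (simp only: powr_add) simp
    then have eq: "C * (D * real d ^ 3) * real d powr ?E = C * D * real d powr (4 * bh_gamma K + 5)"
      by (simp add: mult.assoc add_ac)
    have lev: "level_bound K N d d (C * D * real d powr (4 * bh_gamma K + 5))"
      unfolding eq[symmetric] using d D by (intro C(2)) auto
    have "0 < C * D * real d powr (4 * bh_gamma K + 5)" using C(1) D(1) d by simp
    moreover have "C * D * real d powr (4 * bh_gamma K + 5) \<le> max 1 (C * D) * real d powr (4 * bh_gamma K + 5)"
      by (intro mult_right_mono) auto
    ultimately show ?thesis by (rule level_bound_mono[OF lev]) simp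
  qed
  then show ?thesis by (intro exI[of _ "max 1 (C * D)"]) auto
qed

section \<open>From the level bound to the Fourier coefficients\<close>

lemma cube_sup_norm_ge: "x \<in> cyclic_cube K N \<Longrightarrow> cmod (f x) \<le> cube_sup_norm K N f"
  unfolding cube_sup_norm_def by (intro Max_ge) auto

text \<open>After normalization all coefficients are at most 1 in modulus, so raising the exponent
  of each order to p_d only shrinks the terms. The index of order 0, which the level bound omits,
  adds at most 1; the total 2 becomes the factor 2 because 1/p_d <= 1.\<close>

lemma fourier_coeff_sum_le:
  assumes K: "K \<ge> 2" and d: "1 \<le> d" and D: "D \<ge> 1" and lev: "level_bound K N d d D"
    and supp: "fourier_support K N f \<subseteq> {\<alpha>. interaction_order N \<alpha> \<le> d}"
  shows "(\<Sum>\<alpha>\<in>{\<alpha> \<in> multi_indices K N. interaction_order N \<alpha> \<le> d}.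
      cmod (fourier_coeff K N f \<alpha>) powr bh_exponent d) powr (1 / bh_exponent d) \<le> 2 * D * cube_sup_norm K N f"
proof -
  let ?s = "interaction_order N"
  define p where "p = bh_exponent d"
  have p: "1 \<le> p" using bh_exponent_ge_1[OF d] by (simp add: p_def)
  define S where "S = cube_sup_norm K N f"
  define h where "h = fourier_coeff K N f"
  define L where "L = {\<alpha> \<in> multi_indices K N. ?s \<alpha> \<le> d}"
  define L1 where "L1 = {\<alpha> \<in> multi_indices K N. 1 \<le> ?s \<alpha> \<and> ?s \<alpha> \<le> d}"
  have K0: "K > 0" using K by simp
  have "cyclic_cube K N \<noteq> {}" using card_cyclic_cube[OF K0, of N] K by auto
  then obtain x0 where x0: "x0 \<in> cyclic_cube K N" by auto
  have S0: "S \<ge> 0" unfolding S_def using order_trans[OF norm_ge_zero cube_sup_norm_ge[OF x0]] .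
  have h_le: "cmod (h \<alpha>) \<le> S" for \<alpha>
  proof -
    have "cmod (h \<alpha>) \<le> (\<Sum>x\<in>cyclic_cube K N. cmod (f x * cnj (character N \<alpha> x))) / real (card (cyclic_cube K N))"
      unfolding h_def fourier_coeff_def cube_expectation_def
      by (simp add: norm_divide divide_right_mono norm_sum)
    also have "\<dots> \<le> (\<Sum>x\<in>cyclic_cube K N. S) / real (card (cyclic_cube K N))"
      by (intro divide_right_mono sum_mono) (auto simp: norm_mult norm_character S_def cube_sup_norm_ge)
    also have "\<dots> = S" using K by (simp add: card_cyclic_cube)
    finally show ?thesis .
  qed
  show ?thesis
  proof (cases "S = 0")
    case True
    then have "cmod (h \<alpha>) = 0" for \<alpha> using h_le[of \<alpha>] by simp
    then show ?thesis using True by (simp add: S_def h_def)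
  next
    case False
    then have S: "S > 0" using S0 by simp
    define c where "c \<alpha> = h \<alpha> / of_real S" for \<alpha>
    have c_le: "cmod (c \<alpha>) / D \<le> 1" for \<alpha>
      using h_le[of \<alpha>] S D order_trans[of "cmod (h \<alpha>)" "1 * S" "D * S"]
      by (simp add: c_def norm_divide divide_le_eq mult.commute)
    have bp: "bounded_poly K N d c"
      unfolding bounded_poly_def
    proof (intro conjI ballI impI)
      show "?s \<alpha> \<le> d" if "\<alpha> \<in> multi_indices K N" "c \<alpha> \<noteq> 0" for \<alpha>
        using that supp by (auto simp: c_def h_def fourier_support_def)
      fix x assume x: "x \<in> cyclic_cube K N"
      have "trig_poly K N c x = trig_poly K N h x / of_real S"
        by (simp add: trig_poly_def c_def sum_divide_distrib)
      also have "\<dots> = f x / of_real S" unfolding h_def using trig_poly_fourier_coeff[OF x K0] by simp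
      finally show "cmod (trig_poly K N c x) \<le> 1"
        using cube_sup_norm_ge[OF x, of f] S by (simp add: norm_divide S_def)
    qed
    have "(\<Sum>\<alpha>\<in>L. (cmod (c \<alpha>) / D) powr p) \<le> (\<Sum>\<alpha>\<in>L1 \<union> {\<alpha> \<in> multi_indices K N. ?s \<alpha> = 0}. (cmod (c \<alpha>) / D) powr p)"
      by (intro sum_mono2) (auto simp: L_def L1_def)
    also have "\<dots> = (\<Sum>\<alpha>\<in>L1. (cmod (c \<alpha>) / D) powr p) + (\<Sum>\<alpha>\<in>{\<alpha> \<in> multi_indices K N. ?s \<alpha> = 0}. (cmod (c \<alpha>) / D) powr p)"
      by (intro sum.union_disjoint) (auto simp: L1_def)
    also have "\<dots> \<le> 1 + 1"
    proof (intro add_mono)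
      have "(\<Sum>\<alpha>\<in>L1. (cmod (c \<alpha>) / D) powr p) \<le> (\<Sum>\<alpha>\<in>L1. (cmod (c \<alpha>) / D) powr bh_exponent (?s \<alpha>))"
      proof (intro sum_mono)
        fix \<alpha> assume "\<alpha> \<in> L1"
        then have "bh_exponent (?s \<alpha>) \<le> p" by (auto simp: L1_def p_def intro: bh_exponent_mono)
        then show "(cmod (c \<alpha>) / D) powr p \<le> (cmod (c \<alpha>) / D) powr bh_exponent (?s \<alpha>)"
          using c_le[of \<alpha>] D by (intro powr_mono') auto
      qed
      also have "\<dots> \<le> 1" unfolding L1_def by (rule level_boundD[OF lev bp])
      finally show "(\<Sum>\<alpha>\<in>L1. (cmod (c \<alpha>) / D) powr p) \<le> 1" .
      have "{\<alpha> \<in> multi_indices K N. ?s \<alpha> = 0} \<subseteq> {\<lambda>i\<in>{..<N}. 0}"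
        by (auto simp: interaction_order_def multi_indices_def PiE_iff extensional_def restrict_def)
      then have "card {\<alpha> \<in> multi_indices K N. ?s \<alpha> = 0} \<le> card {\<lambda>i\<in>{..<N}. 0 :: nat}"
        by (intro card_mono) auto
      then have "card {\<alpha> \<in> multi_indices K N. ?s \<alpha> = 0} \<le> 1" by simp
      moreover have "(cmod (c \<alpha>) / D) powr p \<le> 1" for \<alpha>
        using c_le[of \<alpha>] D p by (intro powr_le1) auto
      ultimately show "(\<Sum>\<alpha>\<in>{\<alpha> \<in> multi_indices K N. ?s \<alpha> = 0}. (cmod (c \<alpha>) / D) powr p) \<le> 1"
        by (intro order_trans[OF sum_bounded_above[of _ _ 1]]) auto
    qed
    finally have two: "(\<Sum>\<alpha>\<in>L. (cmod (c \<alpha>) / D) powr p) \<le> 2" by simp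
    have "(\<Sum>\<alpha>\<in>L. cmod (h \<alpha>) powr p) = (D * S) powr p * (\<Sum>\<alpha>\<in>L. (cmod (c \<alpha>) / D) powr p)"
      unfolding sum_distrib_left
    proof (intro sum.cong refl)
      fix \<alpha>
      have "cmod (h \<alpha>) = D * S * (cmod (c \<alpha>) / D)" using S D by (simp add: c_def norm_divide)
      then show "cmod (h \<alpha>) powr p = (D * S) powr p * (cmod (c \<alpha>) / D) powr p"
        using S D by (simp only: powr_mult)
    qed
    also have "\<dots> \<le> (D * S) powr p * 2" using two by (intro mult_left_mono) auto
    finally have "(\<Sum>\<alpha>\<in>L. cmod (h \<alpha>) powr p) powr (1 / p) \<le> ((D * S) powr p * 2) powr (1 / p)"
      using p by (intro powr_mono2 sum_nonneg) auto
    also have "\<dots> = D * S * 2 powr (1 / p)"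
      using S D p by (simp add: powr_mult powr_powr)
    also have "\<dots> \<le> D * S * 2 powr 1"
      using S D p by (intro mult_left_mono powr_mono) auto
    finally show ?thesis by (simp add: L_def h_def p_def S_def mult_ac)
  qed
qed

lemma interaction_order_le_total_degree: "interaction_order N \<alpha> \<le> total_degree N \<alpha>"
proof -
  have "interaction_order N \<alpha> = (\<Sum>j\<in>{j. j < N \<and> \<alpha> j \<noteq> 0}. 1)" by (simp add: interaction_order_def)
  also have "\<dots> \<le> (\<Sum>j\<in>{j. j < N \<and> \<alpha> j \<noteq> 0}. \<alpha> j)" by (intro sum_mono) auto
  also have "\<dots> \<le> (\<Sum>j<N. \<alpha> j)" by (intro sum_mono2) auto
  finally show ?thesis by (simp add: total_degree_def)
qed

theorem theorem1p1:
  fixes K :: nat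
  assumes "K \<ge> 2"
  shows
    "(\<exists>C::real.
        (\<forall>(d::nat) (N::nat) (f :: (nat \<Rightarrow> complex) \<Rightarrow> complex).
           d \<ge> 1 \<longrightarrow> N \<ge> 1 \<longrightarrow>
           fourier_support K N f \<subseteq> {\<alpha>. interaction_order N \<alpha> \<le> d} \<longrightarrow>
           (\<Sum>\<alpha> \<in> {\<alpha> \<in> multi_indices K N. interaction_order N \<alpha> \<le> d}.
               cmod (fourier_coeff K N f \<alpha>) powr bh_exponent d) powr (1 / bh_exponent d)
             \<le> C * real d powr (4 * bh_gamma K + 5) * cube_sup_norm K N f) \<and>
        (\<forall>(d::nat) (N::nat) (f :: (nat \<Rightarrow> complex) \<Rightarrow> complex).
           d \<ge> 1 \<longrightarrow> N \<ge> 1 \<longrightarrow>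
           fourier_support K N f \<subseteq> {\<alpha>. total_degree N \<alpha> \<le> d} \<longrightarrow>
           (\<Sum>\<alpha> \<in> {\<alpha> \<in> multi_indices K N. total_degree N \<alpha> \<le> d}.
               cmod (fourier_coeff K N f \<alpha>) powr bh_exponent d) powr (1 / bh_exponent d)
             \<le> C * real d powr (4 * bh_gamma K + 5) * cube_sup_norm K N f))
     \<and> (K \<ge> 3 \<longrightarrow>
          4 * bh_gamma K + 5 = 5 + real K * ln (real K - 1) / (real K - 2))"
proof (intro conjI impI)
  obtain C where C: "C \<ge> 1" "\<And>N d. 1 \<le> d \<Longrightarrow> level_bound K N d d (C * real d powr (4 * bh_gamma K + 5))"
    using level_bound_polynomial[OF assms] by blast
  have gamma: "0 \<le> 4 * bh_gamma K + 5"
  proof (cases "K \<le> 6")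
    case False
    then show ?thesis by (simp add: four_bh_gamma)
  qed (use four_bh_gamma_ge_2[OF assms] in linarith)
  have main: "(\<Sum>\<alpha> \<in> {\<alpha> \<in> multi_indices K N. interaction_order N \<alpha> \<le> d}.
               cmod (fourier_coeff K N f \<alpha>) powr bh_exponent d) powr (1 / bh_exponent d)
             \<le> 2 * C * real d powr (4 * bh_gamma K + 5) * cube_sup_norm K N f"
    if d: "d \<ge> 1" and supp: "fourier_support K N f \<subseteq> {\<alpha>. interaction_order N \<alpha> \<le> d}" for d N f
  proof -
    \<comment> \<open>The scale must be at least 1 for the normalized coefficients to be at most 1;
      this uses that the exponent of d is nonnegative.\<close>
    have "1 * 1 \<le> C * real d powr (4 * bh_gamma K + 5)"
      using C(1) d gamma by (intro mult_mono ge_one_powr_ge_zero) auto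
    then show ?thesis
      using fourier_coeff_sum_le[OF assms d _ C(2)[OF d] supp] by (simp add: mult_ac)
  qed
  show "\<exists>C::real.
        (\<forall>(d::nat) (N::nat) (f :: (nat \<Rightarrow> complex) \<Rightarrow> complex).
           d \<ge> 1 \<longrightarrow> N \<ge> 1 \<longrightarrow>
           fourier_support K N f \<subseteq> {\<alpha>. interaction_order N \<alpha> \<le> d} \<longrightarrow>
           (\<Sum>\<alpha> \<in> {\<alpha> \<in> multi_indices K N. interaction_order N \<alpha> \<le> d}.
               cmod (fourier_coeff K N f \<alpha>) powr bh_exponent d) powr (1 / bh_exponent d)
             \<le> C * real d powr (4 * bh_gamma K + 5) * cube_sup_norm K N f) \<and>
        (\<forall>(d::nat) (N::nat) (f :: (nat \<Rightarrow> complex) \<Rightarrow> complex).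
           d \<ge> 1 \<longrightarrow> N \<ge> 1 \<longrightarrow>
           fourier_support K N f \<subseteq> {\<alpha>. total_degree N \<alpha> \<le> d} \<longrightarrow>
           (\<Sum>\<alpha> \<in> {\<alpha> \<in> multi_indices K N. total_degree N \<alpha> \<le> d}.
               cmod (fourier_coeff K N f \<alpha>) powr bh_exponent d) powr (1 / bh_exponent d)
             \<le> C * real d powr (4 * bh_gamma K + 5) * cube_sup_norm K N f)"
  proof (intro exI[of _ "2 * C"] conjI allI impI)
    fix d N :: nat and f :: "(nat \<Rightarrow> complex) \<Rightarrow> complex"
    assume d: "d \<ge> 1" and supp: "fourier_support K N f \<subseteq> {\<alpha>. total_degree N \<alpha> \<le> d}"
    have "(\<Sum>\<alpha> \<in> {\<alpha> \<in> multi_indices K N. total_degree N \<alpha> \<le> d}.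
               cmod (fourier_coeff K N f \<alpha>) powr bh_exponent d) powr (1 / bh_exponent d)
        \<le> (\<Sum>\<alpha> \<in> {\<alpha> \<in> multi_indices K N. interaction_order N \<alpha> \<le> d}.
               cmod (fourier_coeff K N f \<alpha>) powr bh_exponent d) powr (1 / bh_exponent d)"
      using bh_exponent_pos[OF d] order_trans[OF interaction_order_le_total_degree]
      by (intro powr_mono2 sum_mono2 sum_nonneg) auto
    also have "\<dots> \<le> 2 * C * real d powr (4 * bh_gamma K + 5) * cube_sup_norm K N f"
      by (rule main[OF d]) (use supp order_trans[OF interaction_order_le_total_degree] in blast)
    finally show "(\<Sum>\<alpha> \<in> {\<alpha> \<in> multi_indices K N. total_degree N \<alpha> \<le> d}.
               cmod (fourier_coeff K N f \<alpha>) powr bh_exponent d) powr (1 / bh_exponent d)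
        \<le> 2 * C * real d powr (4 * bh_gamma K + 5) * cube_sup_norm K N f" .
  qed (rule main)
  show "4 * bh_gamma K + 5 = 5 + real K * ln (real K - 1) / (real K - 2)" if "K \<ge> 3"
    using four_bh_gamma[OF that] by simp
qed

end
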